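(* Let $(X,d)$ be a compact metric space, $f\colon X\to X$ a continuous map, $m\in\mathcal{M}(X)$ a Borel probability measure, and $\varphi\colon X\to\mathbb{R}$ a continuous function. Suppose that: [A.1] $(X,f)$ satisfies the one-way (W)-specification property; [A.2] $\displaystyle \lim_{\epsilon\to 0}\liminf_{n\to\infty}\inf_{x\in X}\Big(\frac1n\log m(B_n(x,\epsilon))+\frac1n\sum_{j=0}^{n-1}\varphi(f^j(x))\Big)\ge 0$; [A.3] the entropy map $\mu\mapsto h(\mu)$ is upper semicontinuous on $\mathcal{M}_f(X)$; [A.4] $\displaystyle \lim_{\epsilon\to 0}\limsup_{n\to\infty}\sup_{x\in X}\Big(\frac1n\log m(B_n(x,\epsilon))+\frac1n\sum_{j=0}^{n-1}\varphi(f^j(x))\Big)\le 0$. Then $(X,f)$ satisfies a level-2 large deviation principle with reference measure $m$ and rate function the free energy $\mathcal{F}_\varphi$.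
   Context: $\mathcal{M}(X)$ denotes the set of Borel probability measures on $X$ with the weak topology, $\mathcal{M}_f(X)$ the $f$-invariant ones, and $h(\mu)$ the metric (Kolmogorov–Sinai) entropy of $\mu\in\mathcal{M}_f(X)$. $B_n(x,\epsilon)=\{y\in X: d(f^j(x),f^j(y))\le\epsilon,\ 0\le j\le n-1\}$. $\mathcal{E}_n(x)=\frac1n\sum_{j=0}^{n-1}\delta_{f^j(x)}$. The non-wandering set $\Omega(f)$ is the set of $x\in X$ such that for every neighborhood $U$ of $x$ there is $n>0$ with $U\cap f^{-n}(U)\neq\emptyset$. One-way (W)-specification property: there exist compact sets $X_1,\dots,X_q\subset X$ such that (1) $f(X_i)\subset X_i$ for all $i$; (2) $\Omega(f)=\bigcup_{i=1}^q X_i$; (3) for every $\epsilon>0$ there is an integer $M\ge0$ such that for any $k\ge1$, any $x_1\in X_{i(1)},\dots,x_k\in X_{i(k)}$ with $i(1)\le\cdots\le i(k)$ and any $n_1,\dots,n_k\in\mathbb{N}$, there exist $y\in X$ and integers $0\le M_1,\dots,M_{k-1}\le M$ with $d(f^i(x_j),f^{i+\sum_{t=1}^{j-1}(n_t+M_t)}(y))\le\epsilon$ for $0\le i\le n_j-1$, $1\le j\le k$ (empty sum $=0$). Level-2 large deviation principle with reference measure $m$ and rate function $q$: $q\colon\mathcal{M}(X)\to[-\infty,0]$ is upper semicontinuous, and for every open $G\subset\mathcal{M}(X)$, $\liminf_{n\to\infty}\frac1n\log m(\{x:\mathcal{E}_n(x)\in G\})\ge\sup_{\mu\in G}q(\mu)$,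 and for every closed $F\subset\mathcal{M}(X)$, $\limsup_{n\to\infty}\frac1n\log m(\{x:\mathcal{E}_n(x)\in F\})\le\sup_{\mu\in F}q(\mu)$. Free energy: $\mathcal{F}_\varphi(\mu)=h(\mu)-\int\varphi\,d\mu$ if $\mu$ is $f$-invariant, and $\mathcal{F}_\varphi(\mu)=-\infty$ otherwise. *)

theory Defs
  imports "HOL-Probability.Probability"
begin

definition borel_on :: "'a::metric_space set \<Rightarrow> 'a measure" where
  "borel_on X = restrict_space borel X"

definition probs :: "'a::metric_space set \<Rightarrow> 'a measure set" where
  "probs X = {\<mu>. prob_space \<mu> \<and> space \<mu> = X \<and> sets \<mu> = sets (borel_on X)}"

definition wk_open :: "'a::metric_space set \<Rightarrow> 'a measure set \<Rightarrow> bool" where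
  "wk_open X G \<longleftrightarrow> G \<subseteq> probs X \<and>
     (\<forall>\<mu>\<in>G. \<exists>(F::('a \<Rightarrow> real) set) e. finite F \<and> (\<forall>g\<in>F. continuous_on X g) \<and> e > 0 \<and>
        {\<nu>\<in>probs X. \<forall>g\<in>F. \<bar>integral\<^sup>L \<nu> g - integral\<^sup>L \<mu> g\<bar> < e} \<subseteq> G)"

definition wk_closed :: "'a::metric_space set \<Rightarrow> 'a measure set \<Rightarrow> bool" where
  "wk_closed X F \<longleftrightarrow> F \<subseteq> probs X \<and> wk_open X (probs X - F)"

definition wk_usc_on :: "'a::metric_space set \<Rightarrow> 'a measure set \<Rightarrow> ('a measure \<Rightarrow> ereal) \<Rightarrow> bool" where
  "wk_usc_on X S q \<longleftrightarrow> (\<forall>c. \<exists>G. wk_open X G \<and> {\<mu>\<in>S. q \<mu> < c} = G \<inter> S)"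

definition invariant_probs :: "'a::metric_space set \<Rightarrow> ('a \<Rightarrow> 'a) \<Rightarrow> 'a measure set" where
  "invariant_probs X f = {\<mu>\<in>probs X. \<forall>A\<in>sets \<mu>. measure \<mu> (f -` A \<inter> X) = measure \<mu> A}"

definition fin_partitions :: "'a::metric_space set \<Rightarrow> 'a set set set" where
  "fin_partitions X = {P. finite P \<and> P \<subseteq> sets (borel_on X) \<and> \<Union>P = X \<and>
                         disjoint P}"

definition eta0 :: "real \<Rightarrow> real" where "eta0 t = (if t = 0 then 0 else t * ln t)"

definition iter_join :: "'a set \<Rightarrow> ('a \<Rightarrow> 'a) \<Rightarrow> 'a set set \<Rightarrow> nat \<Rightarrow> 'a set set" where
  "iter_join X f P n = {(\<Inter>i<n. (f ^^ i) -` (A i) \<inter> X) \<inter> X | A. \<forall>i<n. A i \<in> P}"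

definition part_entropy_rate :: "'a set \<Rightarrow> ('a \<Rightarrow> 'a) \<Rightarrow> 'a measure \<Rightarrow> 'a set set \<Rightarrow> real" where
  "part_entropy_rate X f \<mu> P =
     lim (\<lambda>n. (\<Sum>A\<in>iter_join X f P n. - eta0 (measure \<mu> A)) / real n)"

definition ks_entropy :: "'a::metric_space set \<Rightarrow> ('a \<Rightarrow> 'a) \<Rightarrow> 'a measure \<Rightarrow> ereal" where
  "ks_entropy X f \<mu> = (SUP P\<in>fin_partitions X. ereal (part_entropy_rate X f \<mu> P))"

definition bowen_ball :: "'a::metric_space set \<Rightarrow> ('a \<Rightarrow> 'a) \<Rightarrow> nat \<Rightarrow> 'a \<Rightarrow> real \<Rightarrow> 'a set" where
  "bowen_ball X f n x e = {y\<in>X. \<forall>j<n. dist ((f ^^ j) x) ((f ^^ j) y) \<le> e}"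

definition empirical :: "'a::metric_space set \<Rightarrow> ('a \<Rightarrow> 'a) \<Rightarrow> nat \<Rightarrow> 'a \<Rightarrow> 'a measure" where
  "empirical X f n x = measure_of X (sets (borel_on X))
      (\<lambda>A. ennreal (real (card {j\<in>{..<n}. (f ^^ j) x \<in> A}) / real n))"

definition nonwandering :: "'a::metric_space set \<Rightarrow> ('a \<Rightarrow> 'a) \<Rightarrow> 'a set" where
  "nonwandering X f = {x\<in>X. \<forall>U. openin (top_of_set X) U \<and> x \<in> U \<longrightarrow>
                          (\<exists>n>0. U \<inter> (f ^^ n) -` U \<noteq> {})}"

text \<open>One-way (W)-specification property; the sets X_1..X_q are indexed by 0..q-1,
  blocks 1..k by 0..k-1, and the lengths n_j are positive integers.\<close>
definition one_way_W_spec :: "'a::metric_space set \<Rightarrow> ('a \<Rightarrow> 'a) \<Rightarrow> bool" where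
  "one_way_W_spec X f \<longleftrightarrow>
    (\<exists>q::nat. \<exists>Xs :: nat \<Rightarrow> 'a set.
       (\<forall>i<q. compact (Xs i) \<and> Xs i \<subseteq> X \<and> f ` Xs i \<subseteq> Xs i) \<and>
       nonwandering X f = (\<Union>i<q. Xs i) \<and>
       (\<forall>e>0. \<exists>M::nat. \<forall>k\<ge>1. \<forall>(idx::nat \<Rightarrow> nat) (xs::nat \<Rightarrow> 'a) (ns::nat \<Rightarrow> nat).
          (\<forall>j<k. idx j < q \<and> xs j \<in> Xs (idx j) \<and> ns j \<ge> 1) \<and>
          (\<forall>j. Suc j < k \<longrightarrow> idx j \<le> idx (Suc j)) \<longrightarrow>
          (\<exists>y\<in>X. \<exists>Ms::nat \<Rightarrow> nat. (\<forall>t. Suc t < k \<longrightarrow> Ms t \<le> M) \<and>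
             (\<forall>j<k. \<forall>i<ns j.
                dist ((f ^^ i) (xs j)) ((f ^^ (i + (\<Sum>t<j. ns t + Ms t))) y) \<le> e))))"

definition elog :: "real \<Rightarrow> ereal" where
  "elog t = (if t > 0 then ereal (ln t) else -\<infinity>)"

definition free_energy :: "'a::metric_space set \<Rightarrow> ('a \<Rightarrow> 'a) \<Rightarrow> ('a \<Rightarrow> real) \<Rightarrow> 'a measure \<Rightarrow> ereal" where
  "free_energy X f \<phi> \<mu> =
     (if \<mu> \<in> invariant_probs X f then ks_entropy X f \<mu> - ereal (integral\<^sup>L \<mu> \<phi>) else -\<infinity>)"

definition level2_LDP :: "'a::metric_space set \<Rightarrow> ('a \<Rightarrow> 'a) \<Rightarrow> 'a measure \<Rightarrow> ('a measure \<Rightarrow> ereal) \<Rightarrow> bool" where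
  "level2_LDP X f m q \<longleftrightarrow>
     (\<forall>\<mu>\<in>probs X. q \<mu> \<le> 0) \<and>
     wk_usc_on X (probs X) q \<and>
     (\<forall>G. wk_open X G \<longrightarrow>
        liminf (\<lambda>n. ereal (1 / real n) * elog (measure m {x\<in>X. empirical X f n x \<in> G}))
          \<ge> (SUP \<mu>\<in>G. q \<mu>)) \<and>
     (\<forall>F. wk_closed X F \<longrightarrow>
        limsup (\<lambda>n. ereal (1 / real n) * elog (measure m {x\<in>X. empirical X f n x \<in> F}))
          \<le> (SUP \<mu>\<in>F. q \<mu>))"

definition local_rate :: "'a::metric_space set \<Rightarrow> ('a \<Rightarrow> 'a) \<Rightarrow> 'a measure \<Rightarrow> ('a \<Rightarrow> real) \<Rightarrow> real \<Rightarrow> nat \<Rightarrow> 'a \<Rightarrow> ereal" where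
  "local_rate X f m \<phi> e n x =
     ereal (1 / real n) * elog (measure m (bowen_ball X f n x e))
     + ereal ((1 / real n) * (\<Sum>j<n. \<phi> ((f ^^ j) x)))"

end

theory Submission
  imports Defs "HOL-Combinatorics.Multiset_Permutations"
begin

text \<open>
  Lower bound: let \<open>\<mu>\<close> be invariant. Cut time into blocks of a large length \<open>N\<close> and let \<open>p\<close> be the
  distribution under \<open>\<mu>\<close> of the nearest point in an \<open>(N, d)\<close>-separated set; its entropy is almost
  that of the \<open>N\<close>-fold join of a given partition. Concatenations of blocks with empirical
  frequencies \<open>p\<close> are numerous by Stirling's formula, have empirical measure close to \<open>\<mu>\<close>, and are
  realised by true orbits through specification; as the gaps are bounded independently of \<open>N\<close>,
  they are negligible. The volume estimate [A.2] then bounds the measure of the disjoint Bowen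
  balls around these orbits. Neither the ergodic decomposition nor an ergodic theorem is needed.

  Upper bound: Bowen balls around a maximal separated set cover the event, so [A.4] bounds its
  measure by a partition sum. As in Misiurewicz's proof of the variational principle, a weak limit
  of the correspondingly weighted orbit measures has free energy at least the exponential growth
  rate of these sums; it lies in the closed set because the event is first split into finitely
  many pieces on which the empirical measures nearly agree.

  That the free energy is nonpositive follows from the lower bound for the whole space.
\<close>

section \<open>Finite entropy estimates\<close>

text \<open>Entropy is a supremum over arbitrary Borel partitions, while specification and Bowen
  balls only see distances. In the lower bound a Fano-type estimate bridges this: cells are shrunk
  to compact cores at positive mutual distance, so a code point within a small \<open>d\<close> of
  the orbit names the cell at each time with error probability at most \<beta>. The upper bound
  needs a single partition, of diameter at most the separation scale and with null boundaries for
  the limit \<mu>, chosen after \<mu>. The order of choices in the lower bound is forced: the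
  partition and the test functions fix \<beta> and \<open>d\<close>, these fix the gap bound
  \<open>M\<close>, the block length \<open>N\<close> is large against \<open>M\<close>,
  \<open>N\<close> determines the finite code, and the number of blocks is about n / (N + M).
  Typical points never enter: prescribing how often each block occurs prescribes the Birkhoff sums,
  and by invariance the mean of a block sum under \<mu> is \<open>N\<close> times the integral,
  ergodic or not. The main entropy inequalities come from Gibbs' inequality with tailored reference
  weights, which may be subprobabilities.\<close>

lemma eta0_eq: "eta0 t = t * ln t"
  by (simp add: eta0_def)

text \<open>This is ln t \<le> t - 1 at t = q i / p i, multiplied by p i and summed. Since only
  \<open>sum q I \<le> sum p I\<close> is assumed, subprobability weights are admissible as
  references.\<close>

lemma gibbs_inequality:
  fixes p q :: "'i \<Rightarrow> real"
  assumes "\<And>i. i \<in> I \<Longrightarrow> 0 \<le> p i" "\<And>i. i \<in> I \<Longrightarrow> 0 \<le> q i"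
    and "\<And>i. i \<in> I \<Longrightarrow> 0 < p i \<Longrightarrow> 0 < q i" and "sum q I \<le> sum p I"
  shows "(\<Sum>i\<in>I. - eta0 (p i)) \<le> (\<Sum>i\<in>I. - (p i * ln (q i)))"
proof -
  have "- eta0 (p i) - (q i - p i) \<le> - (p i * ln (q i))" if "i \<in> I" for i
  proof (cases "p i = 0")
    case True
    then show ?thesis using assms(2)[OF that] by (simp add: eta0_def)
  next
    case False
    with assms that have p: "p i > 0" and q: "q i > 0" by force+
    have "ln (q i / p i) \<le> q i / p i - 1"
      using p q by (intro ln_le_minus_one) simp
    then have "p i * ln (q i / p i) \<le> p i * (q i / p i - 1)"
      using p by (intro mult_left_mono) auto
    then show ?thesis using p q by (simp add: eta0_eq ln_div algebra_simps)
  qed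
  then have "(\<Sum>i\<in>I. - eta0 (p i) - (q i - p i)) \<le> (\<Sum>i\<in>I. - (p i * ln (q i)))"
    by (rule sum_mono)
  then show ?thesis using assms(4) by (simp add: sum_subtractf)
qed

text \<open>Away from 0 this is continuity of ln. At 0 the values are squeezed by the bound |s ln s|
  \<le> 2 sqrt s on [0, 1], which comes from ln t \<le> t - 1 at t = 1 / sqrt s.\<close>

lemma tendsto_eta0:
  fixes a :: "'b \<Rightarrow> real"
  assumes a: "(a \<longlongrightarrow> t) F" "\<And>x. 0 \<le> a x" and t: "0 \<le> t"
  shows "((\<lambda>x. eta0 (a x)) \<longlongrightarrow> eta0 t) F"
proof (cases "t = 0")
  case False
  then show ?thesis unfolding eta0_eq using a(1) by (intro tendsto_mult tendsto_ln) auto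
next
  case True
  have bnd: "\<bar>eta0 s\<bar> \<le> 2 * sqrt s" if s: "0 \<le> s" "s \<le> 1" for s :: real
  proof (cases "s = 0")
    case False
    then have s0: "0 < s" using s by simp
    have "ln (1 / sqrt s) \<le> 1 / sqrt s - 1" using s0 by (intro ln_le_minus_one) simp
    moreover have "ln (1 / sqrt s) = - ln s / 2" using s0 by (simp add: ln_div ln_sqrt)
    ultimately have "- ln s \<le> 2 / sqrt s" by simp
    then have "s * - ln s \<le> s * (2 / sqrt s)" using s0 by (intro mult_left_mono) auto
    also have "\<dots> = 2 * sqrt s" using s0 by (simp add: field_simps)
    finally show ?thesis using s0 s by (simp add: eta0_eq abs_mult)
  qed (simp add: eta0_def)
  have "((\<lambda>x. 2 * sqrt (a x)) \<longlongrightarrow> 2 * sqrt 0) F"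
    using a(1) True by (intro tendsto_intros) simp
  moreover have "eventually (\<lambda>x. norm (eta0 (a x)) \<le> 2 * sqrt (a x)) F"
  proof -
    have "eventually (\<lambda>x. a x < 1) F" using a(1) True by (intro order_tendstoD(2)[of a 0]) auto
    then show ?thesis by eventually_elim (use a(2) bnd in auto)
  qed
  ultimately have "((\<lambda>x. eta0 (a x)) \<longlongrightarrow> 0) F" by (intro Lim_null_comparison[of "\<lambda>x. eta0 (a x)"]) auto
  then show ?thesis using True by (simp add: eta0_def)
qed

section \<open>Words and blockwise reference weights\<close>

definition words :: "'b set \<Rightarrow> nat \<Rightarrow> 'b list set" where
  "words V n = {w. set w \<subseteq> V \<and> length w = n}"

lemma finite_words: "finite V \<Longrightarrow> finite (words V n)"
  unfolding words_def by (rule finite_lists_length_eq)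

lemma card_words: "finite V \<Longrightarrow> card (words V n) = card V ^ n"
  unfolding words_def by (rule card_lists_length_eq)

lemma sum_words_add:
  fixes F :: "'b list \<Rightarrow> real"
  shows "(\<Sum>w\<in>words V (a + b). F w) = (\<Sum>u\<in>words V a. \<Sum>v\<in>words V b. F (u @ v))"
proof -
  have "bij_betw (\<lambda>(u, v). u @ v) (words V a \<times> words V b) (words V (a + b))"
  proof (rule bij_betw_byWitness[where f' = "\<lambda>w. (take a w, drop a w)"])
    show "(\<lambda>w. (take a w, drop a w)) ` words V (a + b) \<subseteq> words V a \<times> words V b"
      by (auto simp: words_def dest: in_set_takeD in_set_dropD)
  qed (auto simp: words_def)
  then have "(\<Sum>w\<in>words V (a + b). F w) = (\<Sum>(u, v)\<in>words V a \<times> words V b. F (u @ v))"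
    by (simp add: sum.reindex_bij_betw[symmetric] case_prod_unfold)
  then show ?thesis by (simp add: sum.cartesian_product)
qed

text \<open>
  The reference weight on words that reads the word in consecutive blocks of length \<open>k\<close>,
  weighted by \<open>Q\<close>, and uses the uniform weight on the incomplete last block. Comparing with it
  through Gibbs' inequality replaces subadditivity and concavity of entropy.
\<close>

function blockw :: "nat \<Rightarrow> real \<Rightarrow> ('b list \<Rightarrow> real) \<Rightarrow> 'b list \<Rightarrow> real" where
  "blockw k c Q w =
     (if k = 0 \<or> length w < k then c ^ length w else Q (take k w) * blockw k c Q (drop k w))"
  by auto
termination by (relation "Wellfounded.measure (\<lambda>(k, c, Q, w). length w)") auto

declare blockw.simps [simp del]

lemma blockw_nonneg:
  assumes "0 \<le> c" "\<And>v. 0 \<le> Q v"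
  shows "0 \<le> blockw k c Q v"
  using assms by (induction k c Q v rule: blockw.induct) (subst blockw.simps, auto)

text \<open>Admits \<open>blockw\<close> as a reference weight in Gibbs' inequality: each complete
  block contributes a factor at most 1, the total weight of \<open>Q\<close>, and the uniform
  weights of the incomplete last block add up to exactly 1.\<close>

lemma sum_blockw_le_1:
  assumes V: "finite V" and "V \<noteq> {}" and Q0: "\<And>v. 0 \<le> Q v" and Q1: "(\<Sum>v\<in>words V k. Q v) \<le> 1"
  shows "(\<Sum>w\<in>words V n. blockw k (1 / card V) Q w) \<le> 1"
proof (induction n rule: less_induct)
  case (less n)
  show ?case
  proof (cases "k = 0 \<or> n < k")
    case True
    have "(\<Sum>w\<in>words V n. blockw k (1 / card V) Q w) = (\<Sum>w\<in>words V n. (1 / card V) ^ n)"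
      using True by (intro sum.cong refl) (subst blockw.simps, auto simp: words_def)
    also have "\<dots> = 1" using assms
      by (simp add: card_words power_divide)
    finally show ?thesis by simp
  next
    case False
    then have k: "k > 0" "n = k + (n - k)" by auto
    have "(\<Sum>w\<in>words V n. blockw k (1 / card V) Q w)
       = (\<Sum>u\<in>words V k. \<Sum>v\<in>words V (n - k). blockw k (1 / card V) Q (u @ v))"
      using sum_words_add[of _ V k "n - k"] k(2) by simp
    also have "\<dots> = (\<Sum>u\<in>words V k. \<Sum>v\<in>words V (n - k). Q u * blockw k (1 / card V) Q v)"
      using k by (intro sum.cong refl) (subst blockw.simps, auto simp: words_def)
    also have "\<dots> = (\<Sum>u\<in>words V k. Q u) * (\<Sum>v\<in>words V (n - k). blockw k (1 / card V) Q v)"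
      by (simp add: sum_product)
    also have "\<dots> \<le> 1 * 1"
      using less[of "n - k"] False Q1
      by (intro mult_mono) (auto intro!: sum_nonneg Q0 blockw_nonneg)
    finally show ?thesis by simp
  qed
qed

lemma blockw_pos:
  assumes "c > 0" "\<And>j. j + k \<le> length w \<Longrightarrow> Q (take k (drop j w)) > 0"
  shows "blockw k c Q w > 0"
  using assms(2)
proof (induction "length w" arbitrary: w rule: less_induct)
  case less
  show ?case
  proof (cases "k = 0 \<or> length w < k")
    case True
    then show ?thesis using assms(1) by (subst blockw.simps) auto
  next
    case False
    have "blockw k c Q (drop k w) > 0"
    proof (rule less.hyps)
      show "length (drop k w) < length w" using False by auto
      show "0 < Q (take k (drop j (drop k w)))" if "j + k \<le> length (drop k w)" for j
        using less.prems[of "j + k"] that False by auto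
    qed
    then show ?thesis using False less.prems[of 0] by (subst blockw.simps) auto
  qed
qed

text \<open>
  Summed over all shifts \<open>t < k\<close>, the recursion of \<open>blockw\<close> telescopes: dropping the first letter
  of a word changes the sum by a single block term.
\<close>

lemma sum_ln_blockw_le:
  assumes "0 < c" "c \<le> 1" "k > 0"
    and "\<And>j. j + k \<le> length w \<Longrightarrow> Q (take k (drop j w)) > 0"
  shows "(\<Sum>t<k. - ln (blockw k c Q (drop t w)))
     \<le> (\<Sum>j<Suc (length w) - k. - ln (Q (take k (drop j w)))) + real k * real k * (- ln c)"
  using assms(4)
proof (induction w)
  case Nil
  have *: "blockw k c Q [] = 1" by (subst blockw.simps) simp
  have "{..<Suc 0 - k} = {}" using assms(3) by auto
  moreover have "0 \<le> real k * real k * (- ln c)"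
    using assms by (intro mult_nonneg_nonneg) auto
  ultimately show ?case by (simp add: *)
next
  case (Cons a w)
  define L where "L v = - ln (blockw k c Q v)" for v
  show ?case
  proof (cases "length (a # w) < k")
    case True
    \<comment> \<open>A word shorter than k is an incomplete block for every shift; at most k
      letters at - ln c each, over k shifts, give the error term k * k * (- ln c).\<close>
    have "L (drop t (a # w)) \<le> k * (- ln c)" for t
    proof -
      have "L (drop t (a # w)) = (length (a # w) - t) * (- ln c)"
        using True assms(1) unfolding L_def by (subst blockw.simps) (simp add: ln_realpow)
      also have "\<dots> \<le> k * (- ln c)"
        using True assms by (intro mult_right_mono) auto
      finally show ?thesis .
    qed
    then have "(\<Sum>t<k. L (drop t (a # w))) \<le> (\<Sum>t<k. k * (- ln c))" by (intro sum_mono)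
    moreover have "{..<Suc (length (a # w)) - k} = {}" using True by auto
    ultimately show ?thesis by (simp add: L_def)
  next
    case False
    have IH: "(\<Sum>t<k. L (drop t w))
      \<le> (\<Sum>j<Suc (length w) - k. - ln (Q (take k (drop j w)))) + real k * real k * (- ln c)"
      unfolding L_def using Cons.prems[of "Suc _"] by (intro Cons.IH) auto
    have pos: "Q (take k (a # w)) > 0" using Cons.prems[of 0] False by auto
    have pos2: "blockw k c Q (drop k (a # w)) > 0"
      using Cons.prems[of "_ + k"] False by (intro blockw_pos assms) (auto simp: add.commute)
    have "L (a # w) = - ln (Q (take k (a # w))) + L (drop k (a # w))"
      unfolding L_def using False assms pos pos2 by (subst blockw.simps) (auto simp: ln_mult)
    \<comment> \<open>Both sides are the sum over the shifts 0, ..., k of \<open>a # w\<close>; the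
      shift k is the one exchanged for a block term by the recursion of
      \<open>blockw\<close>.\<close>
    moreover have "(\<Sum>t<k. L (drop t (a # w))) + L (drop k (a # w)) = L (a # w) + (\<Sum>t<k. L (drop t w))"
      using sum.lessThan_Suc_shift[of "\<lambda>t. L (drop t (a # w))" k] by simp
    moreover have "(\<Sum>j<Suc (length (a # w)) - k. - ln (Q (take k (drop j (a # w)))))
      = - ln (Q (take k (a # w))) + (\<Sum>j<Suc (length w) - k. - ln (Q (take k (drop j w))))"
    proof -
      have "Suc (length (a # w)) - k = Suc (Suc (length w) - k)" using False by auto
      then show ?thesis by (simp only: sum.lessThan_Suc_shift) simp
    qed
    ultimately show ?thesis using IH by (simp add: L_def)
  qed
qed

text \<open>For each offset t < k, Gibbs' inequality is applied to the weight that reads t uniform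
  letters followed by \<open>blockw\<close>; over the k offsets every position becomes the start of
  a block. One error term k * k * ln (card V) comes from the initial letters, one from the
  incomplete last blocks. \<open>Q\<close> is left free because it serves both for an invariant
  measure and for the orbit averages of a separated set, which are only nearly invariant.\<close>

lemma entropy_block_bound:
  fixes p :: "'i \<Rightarrow> real" and W :: "'i \<Rightarrow> 'b list"
  assumes I: "finite I" and V: "finite V" "V \<noteq> {}" and p: "\<And>i. i \<in> I \<Longrightarrow> 0 < p i" "sum p I = 1"
    and W: "\<And>i. i \<in> I \<Longrightarrow> W i \<in> words V n" "inj_on W I"
    and Q0: "\<And>v. 0 \<le> Q v" and Q1: "(\<Sum>v\<in>words V k. Q v) \<le> 1"
    and Qpos: "\<And>i j. i \<in> I \<Longrightarrow> j + k \<le> n \<Longrightarrow> 0 < Q (take k (drop j (W i)))"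
    and k: "0 < k" "k \<le> n"
  shows "k * (\<Sum>i\<in>I. - eta0 (p i)) \<le> 2 * real k * real k * ln (card V)
    + (\<Sum>i\<in>I. p i * (\<Sum>j<Suc n - k. - ln (Q (take k (drop j (W i))))))"
proof -
  define c where "c = 1 / real (card V)"
  have cV: "card V \<ge> 1" using V by (simp add: Suc_leI card_gt_0_iff)
  then have c: "0 < c" "c \<le> 1" by (auto simp: c_def)
  have lnc: "- ln c = ln (card V)" using cV by (simp add: c_def ln_div)
  define H where "H = (\<Sum>i\<in>I. - eta0 (p i))"
  have len: "length (W i) = n" if "i \<in> I" for i using W(1)[OF that] by (simp add: words_def)
  have pos: "blockw k c Q (drop t (W i)) > 0" if "i \<in> I" for t i
  proof (rule blockw_pos[OF c(1)])
    fix j assume "j + k \<le> length (drop t (W i))"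
    then have "j + t + k \<le> n" using len[OF that] k(1) by auto
    from Qpos[OF that this] show "0 < Q (take k (drop j (drop t (W i))))" by simp
  qed
  have "H \<le> t * ln (card V) + (\<Sum>i\<in>I. p i * - ln (blockw k c Q (drop t (W i))))" if t: "t < k" for t
  proof -
    define q where "q w = c ^ t * blockw k c Q (drop t w)" for w
    have "(\<Sum>i\<in>I. q (W i)) = (\<Sum>w\<in>W ` I. q w)"
      using W(2) by (simp add: sum.reindex)
    also have "\<dots> \<le> (\<Sum>w\<in>words V (t + (n - t)). q w)"
    proof (rule sum_mono2)
      show "W ` I \<subseteq> words V (t + (n - t))" using W(1) t k by auto
      fix b assume "b \<in> words V (t + (n - t)) - W ` I"
      show "0 \<le> q b" using c Q0 by (simp add: q_def blockw_nonneg)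
    qed (simp add: finite_words V)
    also have "\<dots> = (\<Sum>u\<in>words V t. \<Sum>v\<in>words V (n - t). c ^ t * blockw k c Q v)"
      unfolding sum_words_add by (intro sum.cong refl) (simp add: q_def words_def)
    also have "\<dots> = (\<Sum>v\<in>words V (n - t). blockw k c Q v)"
      using cV V by (simp add: sum_distrib_left card_words c_def power_divide)
    also have "\<dots> \<le> 1" unfolding c_def using V Q0 Q1 by (intro sum_blockw_le_1) auto
    finally have q1: "(\<Sum>i\<in>I. q (W i)) \<le> 1" .
    have "H \<le> (\<Sum>i\<in>I. - (p i * ln (q (W i))))"
      unfolding H_def using p q1 pos c
      by (intro gibbs_inequality) (auto simp: q_def less_imp_le)
    also have "\<dots> = (\<Sum>i\<in>I. p i * (t * ln (card V)) + p i * - ln (blockw k c Q (drop t (W i))))"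
    proof (intro sum.cong refl)
      fix i assume i: "i \<in> I"
      have "ln (q (W i)) = - (t * ln (card V)) + ln (blockw k c Q (drop t (W i)))"
        unfolding q_def 
        using c pos[OF i] by (simp add: ln_mult_pos ln_realpow c_def ln_div)
      then show "- (p i * ln (q (W i))) = p i * (t * ln (card V)) + p i * - ln (blockw k c Q (drop t (W i)))"
        by (simp only:) (simp add: algebra_simps)
    qed
    also have "\<dots> = t * ln (card V) + (\<Sum>i\<in>I. p i * - ln (blockw k c Q (drop t (W i))))"
      using p(2) by (simp only: sum.distrib sum_distrib_right[symmetric] mult_1)
    finally show ?thesis .
  qed
  then have "(\<Sum>t<k. H) \<le> (\<Sum>t<k. k * ln (card V) + (\<Sum>i\<in>I. p i * - ln (blockw k c Q (drop t (W i)))))"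
  proof (intro sum_mono)
    fix t assume A: "\<And>t. t < k \<Longrightarrow> H \<le> t * ln (card V) + (\<Sum>i\<in>I. p i * - ln (blockw k c Q (drop t (W i))))"
      and t: "t \<in> {..<k}"
    have "t * ln (card V) \<le> k * ln (card V)" using t cV by (intro mult_right_mono) auto
    with A[of t] t show "H \<le> k * ln (card V) + (\<Sum>i\<in>I. p i * - ln (blockw k c Q (drop t (W i))))"
      by simp
  qed
  also have "\<dots> = real k * real k * ln (card V) + (\<Sum>i\<in>I. p i * (\<Sum>t<k. - ln (blockw k c Q (drop t (W i)))))"
    by (subst sum.distrib, subst sum.swap) (simp add: sum_distrib_left)
  also have "\<dots> \<le> real k * real k * ln (card V) + (\<Sum>i\<in>I. p i *
      ((\<Sum>j<Suc n - k. - ln (Q (take k (drop j (W i))))) + real k * real k * ln (card V)))"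
  proof (intro add_left_mono sum_mono mult_left_mono)
    fix i assume i: "i \<in> I"
    have "(\<Sum>t<k. - ln (blockw k c Q (drop t (W i))))
        \<le> (\<Sum>j<Suc (length (W i)) - k. - ln (Q (take k (drop j (W i))))) + real k * real k * (- ln c)"
      using len[OF i] by (intro sum_ln_blockw_le c k Qpos i) auto
    then show "(\<Sum>t<k. - ln (blockw k c Q (drop t (W i))))
      \<le> (\<Sum>j<Suc n - k. - ln (Q (take k (drop j (W i))))) + real k * real k * ln (card V)"
      by (simp only: len[OF i] lnc)
  qed (use p in \<open>auto simp: less_imp_le\<close>)
  also have "\<dots> = 2 * real k * real k * ln (card V)
    + (\<Sum>i\<in>I. p i * (\<Sum>j<Suc n - k. - ln (Q (take k (drop j (W i))))))"
    using p(2) by (simp add: distrib_left sum.distrib sum_distrib_right[symmetric] del: sum_negf)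
  finally show ?thesis by (simp add: H_def)
qed

section \<open>Borel probability measures on a compact metric space\<close>

lemma probsD:
  assumes "\<mu> \<in> probs X"
  shows "prob_space \<mu>" "space \<mu> = X" "sets \<mu> = sets (borel_on X)"
  using assms by (auto simp: probs_def)

lemma space_borel_on [simp]: "space (borel_on X) = X"
  by (simp add: borel_on_def space_restrict_space)

lemma borel_on_iff: "A \<in> sets (borel_on X) \<longleftrightarrow> (\<exists>B\<in>sets borel. A = B \<inter> X)"
  by (auto simp: borel_on_def sets_restrict_space)

lemma openin_borel_on: "openin (top_of_set X) U \<Longrightarrow> U \<in> sets (borel_on X)"
  unfolding borel_on_iff openin_open by (metis borel_open inf_commute)

lemma closedin_borel_on: "closedin (top_of_set X) C \<Longrightarrow> C \<in> sets (borel_on X)"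
  unfolding borel_on_iff closedin_closed by (metis borel_closed inf_commute)

lemma continuous_measurable_borel_on:
  "continuous_on X g \<Longrightarrow> g \<in> borel_measurable (borel_on X)"
  unfolding borel_on_def by (rule borel_measurable_continuous_on_restrict)

lemma continuous_on_compact_bounded:
  fixes g :: "'a::metric_space \<Rightarrow> real"
  assumes "compact X" "continuous_on X g"
  obtains B where "B > 0" "\<And>x. x \<in> X \<Longrightarrow> \<bar>g x\<bar> \<le> B"
proof -
  have "bounded (g ` X)"
    using assms by (intro compact_imp_bounded compact_continuous_image)
  then obtain B where "B > 0" "\<forall>x\<in>g ` X. norm x \<le> B" by (auto simp: bounded_pos)
  then show ?thesis by (intro that[of B]) auto
qed

lemma continuous_integrable:
  fixes g :: "'a::metric_space \<Rightarrow> real"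
  assumes "compact X" "continuous_on X g" "\<mu> \<in> probs X"
  shows "integrable \<mu> g"
proof -
  interpret prob_space \<mu> using assms by (simp add: probsD)
  obtain B where "\<And>x. x \<in> X \<Longrightarrow> \<bar>g x\<bar> \<le> B"
    using continuous_on_compact_bounded[OF assms(1,2)] by blast
  moreover have "g \<in> borel_measurable \<mu>"
    using continuous_measurable_borel_on[OF assms(2)] probsD(3)[OF assms(3)]
    by (simp cong: measurable_cong_sets)
  ultimately show ?thesis
    by (intro integrable_const_bound[where B = B]) (auto simp: probsD(2)[OF assms(3)])
qed

section \<open>Regularity of Borel probability measures\<close>

text \<open>A closed set is the decreasing intersection of its metric neighbourhoods. The empty set
  is excluded because \<open>infdist x {}\<close> is 0 by convention, which would make every
  neighbourhood all of X.\<close>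

lemma closed_nhds_measure:
  assumes \<mu>: "\<mu> \<in> probs X" and C: "closedin (top_of_set X) C" "C \<noteq> {}" and e: "0 < e"
  shows "\<exists>n. measure \<mu> {x\<in>X. infdist x C < 1 / real (Suc n)} < measure \<mu> C + e"
proof -
  interpret prob_space \<mu> using \<mu> by (simp add: probsD)
  define U where "U n = {x\<in>X. infdist x C < 1 / real (Suc n)}" for n
  have "U n = X \<inter> (\<lambda>x. infdist x C) -` {..<1 / real (Suc n)}" for n by (auto simp: U_def)
  moreover have "openin (top_of_set X) (X \<inter> (\<lambda>x. infdist x C) -` {..<1 / real (Suc n)})" for n
    by (intro continuous_openin_preimage_gen continuous_intros)
  ultimately have "openin (top_of_set X) (U n)" for n by simp
  then have "range U \<subseteq> sets \<mu>"
    using probsD(3)[OF \<mu>] openin_borel_on by blast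
  moreover have "decseq U"
  proof (rule decseq_SucI)
    fix n
    have "1 / real (Suc (Suc n)) \<le> 1 / real (Suc n)" by (simp add: field_simps)
    then show "U (Suc n) \<subseteq> U n" by (auto simp: U_def simp del: of_nat_Suc)
  qed
  ultimately have lim: "(\<lambda>n. measure \<mu> (U n)) \<longlonglongrightarrow> measure \<mu> (\<Inter>n. U n)"
    by (rule finite_Lim_measure_decseq)
  have "(\<Inter>n. U n) = C"
  proof
    show "C \<subseteq> (\<Inter>n. U n)" using closedin_imp_subset[OF C(1)] by (auto simp: U_def)
    show "(\<Inter>n. U n) \<subseteq> C"
    proof
      fix x assume x: "x \<in> (\<Inter>n. U n)"
      then have X: "x \<in> X" by (auto simp: U_def)
      have "infdist x C \<le> 0"
      proof (rule field_le_epsilon)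
        fix d :: real assume "0 < d"
        then obtain n where "1 / real (Suc n) < d" using nat_approx_posE by blast
        moreover have "x \<in> U n" using x by blast
        ultimately show "infdist x C \<le> 0 + d" by (simp add: U_def del: of_nat_Suc)
      qed
      then have "x \<in> closure C"
        using C(2) infdist_nonneg[of x C] by (simp add: in_closure_iff_infdist_zero)
      moreover obtain S where "closed S" "C = X \<inter> S"
        using C(1) by (auto simp: closedin_closed)
      ultimately show "x \<in> C" using X closure_minimal[of C S] by auto
    qed
  qed
  with lim have "eventually (\<lambda>n. measure \<mu> (U n) < measure \<mu> C + e) sequentially"
    using e by (intro order_tendstoD) auto
  then show ?thesis unfolding U_def using eventually_happens by force
qed

text \<open>The tent function \<open>max 0 (1 - real (Suc n) * infdist x C)\<close> is 1 on C and
  vanishes outside the neighbourhood of radius 1 / (n + 1), whose measure is close to that of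
  C.\<close>

lemma continuous_upper_approx:
  assumes \<mu>: "\<mu> \<in> probs X" and X: "compact X" and C: "closedin (top_of_set X) C" and e: "0 < e"
  obtains g :: "'a::metric_space \<Rightarrow> real" where "continuous_on X g" "\<And>x. 0 \<le> g x" "\<And>x. g x \<le> 1"
    "\<And>x. x \<in> C \<Longrightarrow> g x = 1" "integral\<^sup>L \<mu> g < measure \<mu> C + e"
proof (cases "C = {}")
  case True
  then show ?thesis using e by (intro that[of "\<lambda>_. 0"]) auto
next
  case False
  interpret prob_space \<mu> using \<mu> by (simp add: probsD)
  obtain n where n: "measure \<mu> {x\<in>X. infdist x C < 1 / real (Suc n)} < measure \<mu> C + e"
    using closed_nhds_measure[OF \<mu> C False e] by blast
  define U where "U = {x\<in>X. infdist x C < 1 / real (Suc n)}"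
  have "U = X \<inter> (\<lambda>x. infdist x C) -` {..<1 / real (Suc n)}" by (auto simp: U_def)
  moreover have "openin (top_of_set X) (X \<inter> (\<lambda>x. infdist x C) -` {..<1 / real (Suc n)})"
    by (intro continuous_openin_preimage_gen continuous_intros)
  ultimately have U: "U \<in> sets \<mu>"
    using probsD(3)[OF \<mu>] openin_borel_on by auto
  define g where "g x = max 0 (1 - real (Suc n) * infdist x C)" for x
  have cont: "continuous_on X g" unfolding g_def by (intro continuous_intros)
  have "integral\<^sup>L \<mu> g \<le> (\<integral>x. indicator U x \<partial>\<mu>)"
  proof (rule integral_mono)
    show "integrable \<mu> g" by (rule continuous_integrable[OF X cont \<mu>])
    show "integrable \<mu> (indicat_real U)" using U by (simp add: integrable_indicator_iff less_top[symmetric])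
    fix x assume "x \<in> space \<mu>"
    then have "x \<in> X" by (simp add: probsD(2)[OF \<mu>])
    then show "g x \<le> indicator U x"
      by (auto simp: g_def U_def indicator_def field_simps infdist_nonneg simp del: of_nat_Suc)
  qed
  also have "\<dots> = measure \<mu> U" using U by (simp add: sets.sets_into_space Int_absorb1)
  finally show ?thesis using n cont
    by (intro that[of g]) (auto simp: g_def U_def infdist_nonneg)
qed

text \<open>The sets squeezed between relatively closed and relatively open sets of nearly equal
  measure include the closed sets and are stable under complements and countable unions, hence
  include all Borel sets.\<close>

lemma borel_on_regular:
  fixes X :: "'a::metric_space set"
  assumes \<mu>: "\<mu> \<in> probs X" and A: "A \<in> sets (borel_on X)" and e: "0 < e"
  shows "\<exists>C U. closedin (top_of_set X) C \<and> openin (top_of_set X) U \<and> C \<subseteq> A \<and> A \<subseteq> U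
    \<and> measure \<mu> (U - C) < e"
proof -
  interpret prob_space \<mu> using \<mu> by (simp add: probsD)
  have sets: "sets \<mu> = sets (borel_on X)" and space: "space \<mu> = X" by (rule probsD[OF \<mu>])+
  define R where "R A \<longleftrightarrow> (\<forall>e>0. \<exists>C U. closedin (top_of_set X) C \<and> openin (top_of_set X) U \<and>
     C \<subseteq> A \<and> A \<subseteq> U \<and> measure \<mu> (U - C) < e)" for A
  have compl: "R (X - A)" if "R A" "A \<subseteq> X" for A
    unfolding R_def
  proof (intro allI impI)
    fix e :: real assume e: "0 < e"
    from that(1)[unfolded R_def, rule_format, OF e]
    obtain C U where CU: "closedin (top_of_set X) C" "openin (top_of_set X) U"
      "C \<subseteq> A" "A \<subseteq> U" "measure \<mu> (U - C) < e" by (elim exE conjE)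
    have "U \<subseteq> X" by (rule openin_imp_subset[OF CU(2)])
    then have "(X - C) - (X - U) = U - C" by blast
    then have m: "measure \<mu> ((X - C) - (X - U)) < e" using CU(5) by simp
    have c: "closedin (top_of_set X) (X - U)"
      using closedin_diff[OF closedin_topspace[of "top_of_set X"] CU(2)]
      by (simp only: topspace_euclidean_subtopology)
    have o: "openin (top_of_set X) (X - C)"
      using openin_diff[OF openin_topspace[of "top_of_set X"] CU(1)]
      by (simp only: topspace_euclidean_subtopology)
    show "\<exists>C U. closedin (top_of_set X) C \<and> openin (top_of_set X) U \<and>
       C \<subseteq> X - A \<and> X - A \<subseteq> U \<and> measure \<mu> (U - C) < e"
    proof (intro exI conjI)
      show "X - U \<subseteq> X - A" "X - A \<subseteq> X - C" using CU(3,4) by auto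
    qed (rule c o m)+
  qed
  have clos: "R C" if C: "closedin (top_of_set X) C" for C
  proof (cases "C = {}")
    case True then show ?thesis unfolding R_def by (intro allI impI exI[of _ "{}"]) simp
  next
    case False
    show ?thesis unfolding R_def
    proof (intro allI impI)
      fix e :: real assume "0 < e"
      then obtain n where n: "measure \<mu> {x\<in>X. infdist x C < 1 / real (Suc n)} < measure \<mu> C + e"
        using closed_nhds_measure[OF \<mu> C False] by blast
      define U where "U = {x\<in>X. infdist x C < 1 / real (Suc n)}"
      have "U = X \<inter> (\<lambda>x. infdist x C) -` {..<1 / real (Suc n)}" by (auto simp: U_def)
      moreover have "openin (top_of_set X) (X \<inter> (\<lambda>x. infdist x C) -` {..<1 / real (Suc n)})"
        by (intro continuous_openin_preimage_gen continuous_intros)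
      ultimately have U: "openin (top_of_set X) U" by simp
      have CU: "C \<subseteq> U" using closedin_imp_subset[OF C] by (auto simp: U_def)
      have "measure \<mu> (U - C) = measure \<mu> U - measure \<mu> C"
        using U C CU by (intro finite_measure_Diff) (auto simp: sets openin_borel_on closedin_borel_on)
      then show "\<exists>Ca U. closedin (top_of_set X) Ca \<and> openin (top_of_set X) U \<and>
         Ca \<subseteq> C \<and> C \<subseteq> U \<and> measure \<mu> (U - Ca) < e"
        using C CU U n[folded U_def] by (intro exI[of _ C] exI[of _ U] conjI) simp_all
    qed
  qed
  obtain B where B: "B \<in> sets borel" "A = B \<inter> X" using A by (auto simp: borel_on_iff)
  have "B \<in> sigma_sets UNIV {S. open S}" using B(1) by (simp add: borel_def)
  then have "R (B \<inter> X)"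
  proof induction
    case (Basic S)
    have "X - S = X \<inter> - S" by auto
    moreover have "closedin (top_of_set X) (X \<inter> - S)"
      using Basic by (intro closedin_closed_Int) (simp add: closed_Compl)
    ultimately have "closedin (top_of_set X) (X - S)" by simp
    then have "R (X - (X - S))" by (intro compl clos) auto
    moreover have "X - (X - S) = S \<inter> X" by auto
    ultimately show ?case by simp
  next
    case Empty
    show ?case using clos[of "{}"] by simp
  next
    case (Compl a)
    have "(UNIV - a) \<inter> X = X - (a \<inter> X)" by auto
    then show ?case using compl[OF Compl.IH] by simp
  next
    case (Union a)
    show ?case unfolding R_def
    proof (intro allI impI)
      fix e :: real assume e: "0 < e"
      \<comment> \<open>The errors of the individual sets add up to e / 2; the other half is spent
        on replacing the countable union of closed sets by a finite one, which is again
        closed.\<close>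
      define G where "G i C U \<longleftrightarrow> closedin (top_of_set X) C \<and> openin (top_of_set X) U \<and> C \<subseteq> a i \<inter> X \<and> a i \<inter> X \<subseteq> U
          \<and> measure \<mu> (U - C) < e / 2 * (1 / 2) ^ Suc i" for i C U
      have "\<exists>C U. G i C U" for i
        unfolding G_def by (rule Union.IH[of i, unfolded R_def, rule_format]) (use e in simp)
      then obtain C U where G: "\<And>i. G i (C i) (U i)" by metis
      then have CU: "\<And>i. closedin (top_of_set X) (C i)" "\<And>i. openin (top_of_set X) (U i)"
        "\<And>i. C i \<subseteq> a i \<inter> X" "\<And>i. a i \<inter> X \<subseteq> U i"
        "\<And>i. measure \<mu> (U i - C i) < e / 2 * (1 / 2) ^ Suc i" by (simp_all add: G_def)
      have m: "C i \<in> sets \<mu>" "U i \<in> sets \<mu>" for i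
        using CU by (auto simp: sets openin_borel_on closedin_borel_on)
      have s: "(\<lambda>i. e / 2 * (1 / 2) ^ Suc i) sums (e / 2)"
        using sums_mult[OF power_half_series, of "e/2"] by (simp only: mult_1_right)
      have sm: "summable (\<lambda>i. measure \<mu> (U i - C i))"
        by (rule summable_comparison_test[OF _ sums_summable[OF s]])
          (use CU(5) in \<open>auto intro!: exI[of _ 0] less_imp_le\<close>)
      have "measure \<mu> ((\<Union>i. U i) - (\<Union>i. C i)) \<le> measure \<mu> (\<Union>i. U i - C i)"
        using m by (intro finite_measure_mono) auto
      also have "\<dots> \<le> (\<Sum>i. measure \<mu> (U i - C i))"
        using m sm by (intro finite_measure_subadditive_countably) auto
      also have "\<dots> \<le> e / 2"
        using suminf_le[OF _ sm sums_summable[OF s]] CU(5) sums_unique[OF s] by (simp add: less_imp_le)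
      finally have 1: "measure \<mu> ((\<Union>i. U i) - (\<Union>i. C i)) \<le> e / 2" .
      have "incseq (\<lambda>n. \<Union>i\<le>n. C i)" by (rule incseq_SucI) (rule UN_mono, auto)
      then have "(\<lambda>n. measure \<mu> (\<Union>i\<le>n. C i)) \<longlonglongrightarrow> measure \<mu> (\<Union>n. \<Union>i\<le>n. C i)"
        using m by (intro finite_Lim_measure_incseq) auto
      moreover have "(\<Union>n. \<Union>i\<le>n. C i) = (\<Union>i. C i)" by blast
      ultimately have "eventually (\<lambda>n. measure \<mu> (\<Union>i\<le>n. C i) > measure \<mu> (\<Union>i. C i) - e / 2) sequentially"
        using e by (intro order_tendstoD) auto
      then obtain n where n: "measure \<mu> (\<Union>i\<le>n. C i) > measure \<mu> (\<Union>i. C i) - e / 2"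
        using eventually_happens by force
      have sub: "(\<Union>i. C i) \<subseteq> (\<Union>i. U i)"
      proof (rule UN_mono)
        show "C i \<subseteq> U i" for i using CU(3)[of i] CU(4)[of i] by (rule order_trans)
      qed simp
      have subn: "(\<Union>i\<le>n. C i) \<subseteq> (\<Union>i. U i)" using sub by (rule order_trans[rotated]) (rule UN_mono, auto)
      have "measure \<mu> ((\<Union>i. U i) - (\<Union>i\<le>n. C i)) = measure \<mu> (\<Union>i. U i) - measure \<mu> (\<Union>i\<le>n. C i)"
        using m by (intro finite_measure_Diff subn) auto
      moreover have "measure \<mu> ((\<Union>i. U i) - (\<Union>i. C i)) = measure \<mu> (\<Union>i. U i) - measure \<mu> (\<Union>i. C i)"
        using m by (intro finite_measure_Diff sub) auto
      ultimately have "measure \<mu> ((\<Union>i. U i) - (\<Union>i\<le>n. C i)) < e" using 1 n by linarith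
      moreover have "closedin (top_of_set X) (\<Union>i\<le>n. C i)" using CU(1) by (intro closedin_Union) auto
      moreover have "openin (top_of_set X) (\<Union>i. U i)" using CU(2) by (intro openin_Union) auto
      ultimately show "\<exists>C U. closedin (top_of_set X) C \<and> openin (top_of_set X) U \<and>
          C \<subseteq> \<Union> (range a) \<inter> X \<and> \<Union> (range a) \<inter> X \<subseteq> U \<and> measure \<mu> (U - C) < e"
        using CU(3,4) by (intro exI[of _ "\<Union>i\<le>n. C i"] exI[of _ "\<Union>i. U i"] conjI) blast+
    qed
  qed
  from this[unfolded R_def, rule_format, OF e] show ?thesis unfolding B(2) .
qed

lemma borel_on_inner_regular:
  fixes X :: "'a::metric_space set"
  assumes \<mu>: "\<mu> \<in> probs X" and A: "A \<in> sets (borel_on X)" and e: "0 < e"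
  obtains C where "closedin (top_of_set X) C" "C \<subseteq> A" "measure \<mu> (A - C) < e"
proof -
  interpret prob_space \<mu> using \<mu> by (simp add: probsD)
  obtain C U where CU: "closedin (top_of_set X) C" "openin (top_of_set X) U" "C \<subseteq> A" "A \<subseteq> U"
    "measure \<mu> (U - C) < e" using borel_on_regular[OF assms] by blast
  have "measure \<mu> (A - C) \<le> measure \<mu> (U - C)"
    using CU by (intro finite_measure_mono) (auto simp: probsD[OF \<mu>] openin_borel_on closedin_borel_on)
  with CU show ?thesis by (intro that[of C]) auto
qed

lemma measure_closed_le_integral:
  assumes \<mu>: "\<mu> \<in> probs X" and X: "compact X" and C: "closedin (top_of_set X) C"
    and g: "continuous_on X g" "\<And>x. 0 \<le> g x" "\<And>x. x \<in> C \<Longrightarrow> g x = (1::real)"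
  shows "measure \<mu> C \<le> integral\<^sup>L \<mu> g"
proof -
  interpret prob_space \<mu> using \<mu> by (simp add: probsD)
  have m: "C \<in> sets \<mu>" using C by (simp add: probsD[OF \<mu>] closedin_borel_on)
  then have "measure \<mu> C = (\<integral>x. indicator C x \<partial>\<mu>)"
    by (simp add: sets.sets_into_space Int_absorb1)
  also have "\<dots> \<le> integral\<^sup>L \<mu> g"
  proof (rule integral_mono)
    show "integrable \<mu> (indicat_real C)" using m by (simp add: integrable_indicator_iff less_top[symmetric])
    show "integrable \<mu> g" by (rule continuous_integrable[OF X g(1) \<mu>])
  qed (use g in \<open>auto simp: indicator_def\<close>)
  finally show ?thesis .
qed

text \<open>Inner regularity reduces to closed sets, whose indicators are approximated from above by
  continuous functions. One inequality suffices by symmetry, so \<open>le\<close> is stated for an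
  arbitrary pair of measures.\<close>

lemma probs_eqI:
  assumes \<mu>: "\<mu> \<in> probs X" and \<nu>: "\<nu> \<in> probs X" and X: "compact X"
    and eq: "\<And>g::'a::metric_space \<Rightarrow> real. continuous_on X g \<Longrightarrow> integral\<^sup>L \<mu> g = integral\<^sup>L \<nu> g"
  shows "\<mu> = \<nu>"
proof -
  have le: "measure \<mu> A \<le> measure \<nu> A" if A: "A \<in> sets (borel_on X)" and \<mu>: "\<mu> \<in> probs X" and \<nu>: "\<nu> \<in> probs X"
    and eq: "\<And>g::'a \<Rightarrow> real. continuous_on X g \<Longrightarrow> integral\<^sup>L \<mu> g = integral\<^sup>L \<nu> g" for A \<mu> \<nu>
  proof (rule field_le_epsilon)
    fix e :: real assume e: "0 < e"
    interpret \<mu>: prob_space \<mu> using \<mu> by (simp add: probsD)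
    interpret \<nu>: prob_space \<nu> using \<nu> by (simp add: probsD)
    obtain C where C: "closedin (top_of_set X) C" "C \<subseteq> A" "measure \<mu> (A - C) < e / 2"
      using borel_on_inner_regular[OF \<mu> A, of "e/2"] e by auto
    obtain g where g: "continuous_on X g" "\<And>x. 0 \<le> g x" "\<And>x. g x \<le> 1"
      "\<And>x. x \<in> C \<Longrightarrow> g x = 1" "integral\<^sup>L \<nu> g < measure \<nu> C + e / 2"
      using continuous_upper_approx[OF \<nu> X C(1), of "e/2"] e by auto
    have "measure \<mu> C \<le> integral\<^sup>L \<mu> g"
      by (rule measure_closed_le_integral[OF \<mu> X C(1) g(1,2,4)])
    moreover have "measure \<mu> (A - C) = measure \<mu> A - measure \<mu> C"
      using A C by (intro \<mu>.finite_measure_Diff) (auto simp: probsD[OF \<mu>] closedin_borel_on)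
    moreover have "measure \<nu> C \<le> measure \<nu> A"
      using A C by (intro \<nu>.finite_measure_mono) (auto simp: probsD[OF \<nu>])
    ultimately show "measure \<mu> A \<le> measure \<nu> A + e" using C(3) g(5) eq[OF g(1)] by linarith
  qed
  interpret \<mu>: prob_space \<mu> using \<mu> by (simp add: probsD)
  interpret \<nu>: prob_space \<nu> using \<nu> by (simp add: probsD)
  show ?thesis
  proof (rule measure_eqI)
    show "sets \<mu> = sets \<nu>" by (simp add: probsD[OF \<mu>] probsD[OF \<nu>])
    fix A assume "A \<in> sets \<mu>"
    then have "A \<in> sets (borel_on X)" by (simp add: probsD[OF \<mu>])
    with le[of A \<mu> \<nu>] le[of A \<nu> \<mu>] have "measure \<mu> A = measure \<nu> A"
      using \<mu> \<nu> eq by force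
    then show "emeasure \<mu> A = emeasure \<nu> A"
      by (simp add: \<mu>.emeasure_eq_measure \<nu>.emeasure_eq_measure)
  qed
qed

section \<open>Weak convergence\<close>

text \<open>Only sequences occur: a limit is extracted by sequential compactness, and membership in
  a weakly closed set passes to limits of sequences.\<close>

definition wk_conv :: "'a::metric_space set \<Rightarrow> (nat \<Rightarrow> 'a measure) \<Rightarrow> 'a measure \<Rightarrow> bool" where
  "wk_conv X M \<mu> \<longleftrightarrow> (\<forall>g. continuous_on X g \<longrightarrow> (\<lambda>n. integral\<^sup>L (M n) g) \<longlonglongrightarrow> (integral\<^sup>L \<mu> g :: real))"

text \<open>The portmanteau inequality for closed sets: a continuous function that is 1 on C and
  nearly optimal for \<mu> dominates the indicator of C for every \<open>M n\<close> as
  well.\<close>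

lemma wk_conv_closed_measure:
  assumes X: "compact X" and M: "\<And>n. M n \<in> probs X" and \<mu>: "\<mu> \<in> probs X" and conv: "wk_conv X M \<mu>"
    and C: "closedin (top_of_set X) C" and e: "0 < e"
  shows "eventually (\<lambda>n. measure (M n) C < measure \<mu> C + e) sequentially"
proof -
  obtain g where g: "continuous_on X g" "\<And>x. 0 \<le> g x" "\<And>x. g x \<le> 1"
    "\<And>x. x \<in> C \<Longrightarrow> g x = 1" "integral\<^sup>L \<mu> g < measure \<mu> C + e"
    using continuous_upper_approx[OF \<mu> X C e] by auto
  have "(\<lambda>n. integral\<^sup>L (M n) g) \<longlonglongrightarrow> integral\<^sup>L \<mu> g" using conv g(1) by (simp add: wk_conv_def)
  then have "eventually (\<lambda>n. integral\<^sup>L (M n) g < measure \<mu> C + e) sequentially"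
    using g(5) by (rule order_tendstoD)
  then show ?thesis
  proof eventually_elim
    case (elim n)
    then show ?case using measure_closed_le_integral[OF M[of n] X C g(1,2,4)] by linarith
  qed
qed

text \<open>\<open>D\<close> stands in for the boundary of A: any null set whose union with A and
  with the complement of A is closed. For sets of points with a given itinerary such a
  \<open>D\<close> is easier to exhibit than the topological boundary. The estimate for closed sets,
  applied to both unions, bounds the measures of A from above and from below.\<close>

lemma wk_conv_null_boundary:
  assumes X: "compact X" and M: "\<And>n. M n \<in> probs X" and \<mu>: "\<mu> \<in> probs X" and conv: "wk_conv X M \<mu>"
    and A: "A \<in> sets (borel_on X)" and D: "D \<in> sets (borel_on X)" "measure \<mu> D = 0"
    and AD: "closedin (top_of_set X) (A \<union> D)" "closedin (top_of_set X) ((X - A) \<union> D)"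
  shows "(\<lambda>n. measure (M n) A) \<longlonglongrightarrow> measure \<mu> A"
proof (rule order_tendstoI)
  interpret \<mu>: prob_space \<mu> using \<mu> by (simp add: probsD)
  have U: "measure \<mu> (B \<union> D) = measure \<mu> B" if "B \<in> sets (borel_on X)" for B
    using that D by (intro \<mu>.measure_zero_union) (auto simp: probsD[OF \<mu>])
  have mono: "measure (M n) B \<le> measure (M n) (B \<union> D)" if "B \<in> sets (borel_on X)" for n B
  proof -
    interpret \<nu>: prob_space "M n" by (rule probsD[OF M])
    show ?thesis using that D by (intro \<nu>.finite_measure_mono) (auto simp: probsD[OF M])
  qed
  fix a assume a: "measure \<mu> A < a"
  have "eventually (\<lambda>n. measure (M n) (A \<union> D) < measure \<mu> (A \<union> D) + (a - measure \<mu> A)) sequentially"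
    using a by (intro wk_conv_closed_measure[OF X M \<mu> conv AD(1)]) auto
  then show "eventually (\<lambda>n. measure (M n) A < a) sequentially"
  proof eventually_elim
    case (elim n)
    then show ?case using mono[OF A, of n] U[OF A] by simp
  qed
next
  fix a assume a: "a < measure \<mu> A"
  interpret \<mu>: prob_space \<mu> using \<mu> by (simp add: probsD)
  have U: "measure \<mu> (B \<union> D) = measure \<mu> B" if "B \<in> sets (borel_on X)" for B
    using that D by (intro \<mu>.measure_zero_union) (auto simp: probsD[OF \<mu>])
  have AC: "X - A \<in> sets (borel_on X)" using sets.compl_sets[OF A] by simp
  have c: "measure \<nu> (X - A) = 1 - measure \<nu> A" if "\<nu> \<in> probs X" for \<nu>
  proof -
    interpret \<nu>: prob_space \<nu> using that by (simp add: probsD)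
    show ?thesis using \<nu>.prob_compl[of A] A by (simp add: probsD[OF that])
  qed
  have "eventually (\<lambda>n. measure (M n) ((X - A) \<union> D) < measure \<mu> ((X - A) \<union> D) + (measure \<mu> A - a)) sequentially"
    using a by (intro wk_conv_closed_measure[OF X M \<mu> conv AD(2)]) auto
  then show "eventually (\<lambda>n. a < measure (M n) A) sequentially"
  proof eventually_elim
    case (elim n)
    interpret \<nu>: prob_space "M n" by (rule probsD[OF M])
    have "measure (M n) (X - A) \<le> measure (M n) ((X - A) \<union> D)"
      using AC D by (intro \<nu>.finite_measure_mono) (auto simp: probsD[OF M])
    then show ?case using elim U[OF AC] c[OF \<mu>] c[OF M[of n]] by simp
  qed
qed

lemma wk_closed_limit:
  assumes F: "wk_closed X F" and M: "\<And>n. M n \<in> F" and \<mu>: "\<mu> \<in> probs X" and conv: "wk_conv X M \<mu>"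
  shows "\<mu> \<in> F"
proof (rule ccontr)
  assume "\<mu> \<notin> F"
  with \<mu> have "\<mu> \<in> probs X - F" by simp
  with F obtain S e where S: "finite S" "\<forall>g\<in>S. continuous_on X g" "e > 0"
    "{\<nu>\<in>probs X. \<forall>g\<in>S. \<bar>integral\<^sup>L \<nu> g - integral\<^sup>L \<mu> g\<bar> < (e::real)} \<subseteq> probs X - F"
    unfolding wk_closed_def wk_open_def by blast
  have "eventually (\<lambda>n. \<forall>g\<in>S. \<bar>integral\<^sup>L (M n) g - integral\<^sup>L \<mu> g\<bar> < e) sequentially"
  proof (intro eventually_ball_finite S ballI)
    fix g assume "g \<in> S"
    then have "(\<lambda>n. integral\<^sup>L (M n) g) \<longlonglongrightarrow> integral\<^sup>L \<mu> g" using conv S by (simp add: wk_conv_def)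
    then show "eventually (\<lambda>n. \<bar>integral\<^sup>L (M n) g - integral\<^sup>L \<mu> g\<bar> < e) sequentially"
      using S(3) by (auto dest!: tendstoD simp: dist_real_def)
  qed
  then obtain n where "\<forall>g\<in>S. \<bar>integral\<^sup>L (M n) g - integral\<^sup>L \<mu> g\<bar> < e"
    using eventually_happens by force
  moreover have "M n \<in> probs X" using F M unfolding wk_closed_def by auto
  ultimately have "M n \<notin> F" using S(4) by auto
  then show False using M by simp
qed

section \<open>Sequential compactness of the space of measures\<close>

text \<open>At the first index k where the digits differ, that digit contributes (1/3)^k and all
  later ones together at most half of it. With digits 0 and 1 the base has to exceed 2 for such a
  gap; hence base 3.\<close>

lemma base3_digits_eq:
  fixes a b :: "nat \<Rightarrow> real"
  assumes a: "\<And>n. a n \<in> {0, 1}" and b: "\<And>n. b n \<in> {0, 1}"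
    and close: "\<bar>(\<Sum>n. a n * (1/3)^n) - (\<Sum>n. b n * (1/3)^n)\<bar> < (1/3)^m / 2" and i: "i \<le> m"
  shows "a i = b i"
proof (rule ccontr)
  assume "a i \<noteq> b i"
  define k where "k = (LEAST k. a k \<noteq> b k)"
  have k: "a k \<noteq> b k" unfolding k_def using \<open>a i \<noteq> b i\<close> by (rule LeastI)
  have km: "k \<le> m" using Least_le[of "\<lambda>k. a k \<noteq> b k" i] \<open>a i \<noteq> b i\<close> i by (simp add: k_def)
  have lt: "a j = b j" if "j < k" for j using not_less_Least[of j "\<lambda>k. a k \<noteq> b k"] that by (auto simp: k_def)
  define d where "d n = (a n - b n) * (1/3)^n" for n
  have sumg: "summable (\<lambda>n. (1/3 :: real)^n)" by (rule summable_geometric) simp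
  have s01: "summable (\<lambda>n. u n * (1/3)^n)" if "\<And>n. u n \<in> {0, 1}" for u :: "nat \<Rightarrow> real"
  proof (rule summable_comparison_test[OF _ sumg], intro exI allI impI)
    show "norm (u n * (1/3)^n) \<le> (1/3)^n" for n using that[of n] by auto
  qed
  note sa = s01[OF a] and sb = s01[OF b]
  have sd: "summable d" using summable_diff[OF sa sb] by (simp add: d_def[abs_def] left_diff_distrib)
  have eq: "(\<Sum>n. a n * (1/3)^n) - (\<Sum>n. b n * (1/3)^n) = suminf d"
    using suminf_diff[OF sa sb] by (simp add: d_def[abs_def] left_diff_distrib)
  have dle: "\<bar>d n\<bar> \<le> (1/3)^n" for n
  proof -
    have "\<bar>a n - b n\<bar> \<le> 1" using a[of n] b[of n] by auto
    then show ?thesis unfolding d_def abs_mult by (auto intro: mult_left_le_one_le)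
  qed
  have split: "suminf d = (\<Sum>n. d (n + Suc k)) + (\<Sum>j<Suc k. d j)"
    by (rule suminf_split_initial_segment[OF sd])
  have "(\<Sum>j<Suc k. d j) = d k" using lt by (simp add: d_def)
  moreover have "\<bar>d k\<bar> = (1/3)^k" using a[of k] b[of k] k by (auto simp: d_def)
  moreover have "\<bar>\<Sum>n. d (n + Suc k)\<bar> \<le> (1/3)^k / 2"
  proof -
    have s1: "(\<lambda>n. (1/3)^Suc k * (1/3 :: real)^n) sums ((1/3)^Suc k * (1 / (1 - 1/3)))"
      by (intro sums_mult geometric_sums) simp
    have le: "\<bar>d (n + Suc k)\<bar> \<le> (1/3)^Suc k * (1/3)^n" for n
      using dle[of "n + Suc k"] by (simp add: power_add mult_ac)
    have sabs: "summable (\<lambda>n. \<bar>d (n + Suc k)\<bar>)"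
      by (rule summable_comparison_test[OF _ sums_summable[OF s1]]) (use le in \<open>auto intro!: exI[of _ 0]\<close>)
    have "\<bar>\<Sum>n. d (n + Suc k)\<bar> \<le> (\<Sum>n. \<bar>d (n + Suc k)\<bar>)" by (rule summable_rabs[OF sabs])
    also have "\<dots> \<le> (\<Sum>n. (1/3)^Suc k * (1/3)^n)"
      by (rule suminf_le[OF le sabs sums_summable[OF s1]])
    also have "\<dots> = (1/3)^k / 2" using sums_unique[OF s1] by simp
    finally show ?thesis .
  qed
  ultimately have "\<bar>suminf d\<bar> \<ge> (1/3)^k / 2" unfolding split by linarith
  moreover have "(1/3 :: real)^m \<le> (1/3)^k" using km by (intro power_decreasing) auto
  ultimately show False using close unfolding eq by linarith
qed

text \<open>
  The digits of \<open>c x\<close> in base 3 record membership in countably many small balls; so \<open>c\<close> is not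
  continuous but has a uniformly continuous inverse. This transports Helly's selection theorem
  from the real line to \<open>X\<close>.
\<close>

lemma compact_borel_code:
  fixes X :: "'a::metric_space set"
  assumes X: "compact X" "X \<noteq> {}"
  obtains c :: "'a \<Rightarrow> real" where "c \<in> borel_measurable (borel_on X)" "\<And>x. 0 \<le> c x" "\<And>x. c x \<le> 3 / 2"
    "\<And>e. 0 < e \<Longrightarrow> \<exists>d>0. \<forall>x\<in>X. \<forall>y\<in>X. \<bar>c x - c y\<bar> < d \<longrightarrow> dist x y \<le> e"
proof -
  have "\<exists>T. finite T \<and> X \<subseteq> (\<Union>t\<in>T. ball t (1 / real (Suc k)))" for k
    using X(1) unfolding compact_eq_totally_bounded by simp
  then obtain T where T: "\<And>k. finite (T k)" "\<And>k. X \<subseteq> (\<Union>t\<in>T k. ball t (1 / real (Suc k)))"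
    by metis
  define S where "S k = (\<lambda>t. ball t (1 / real (Suc k))) ` T k" for k
  define SS where "SS = (\<Union>k. S k)"
  have "countable SS" unfolding SS_def S_def using T(1) by (auto intro: countable_finite)
  moreover have "SS \<noteq> {}"
  proof -
    have "T 0 \<noteq> {}" using T(2)[of 0] X(2) by auto
    then show ?thesis by (auto simp: SS_def S_def)
  qed
  ultimately have rng: "range (from_nat_into SS) = SS" by simp
  define B where "B = from_nat_into SS"
  have B: "B n \<in> SS" for n unfolding B_def using rng by blast
  have Bopen: "open (B n)" for n using B[of n] by (auto simp: SS_def S_def)
  define c where "c x = (\<Sum>n. indicator (B n) x * (1/3 :: real)^n)" for x
  have geo: "(\<lambda>n. (1/3 :: real)^n) sums (3/2)" using geometric_sums[of "1/3 :: real"] by simp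
  have sc: "summable (\<lambda>n. indicator (B n) x * (1/3 :: real)^n)" for x
    by (rule summable_comparison_test[OF _ sums_summable[OF geo]]) (auto intro!: exI[of _ 0] simp: indicator_def)
  show ?thesis
  proof (rule that[of c])
    have "(\<lambda>x. indicator (B n) x * (1/3 :: real)^n) \<in> borel_measurable (borel_on X)" for n
      unfolding borel_on_def
      by (intro measurable_restrict_space1 borel_measurable_times borel_measurable_indicator borel_measurable_const borel_open Bopen)
    then show "c \<in> borel_measurable (borel_on X)"
      unfolding c_def by (rule borel_measurable_suminf)
    show "0 \<le> c x" for x unfolding c_def by (rule suminf_nonneg[OF sc]) simp
    show "c x \<le> 3 / 2" for x
    proof -
      have "c x \<le> (\<Sum>n. (1/3)^n)" unfolding c_def
        by (rule suminf_le[OF _ sc sums_summable[OF geo]]) (auto simp: indicator_def)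
      then show ?thesis using sums_unique[OF geo] by simp
    qed
    fix e :: real assume "0 < e"
    then obtain k where k: "1 / real (Suc k) < e / 2" using nat_approx_posE[of "e/2"] by auto
    have "\<forall>b\<in>S k. \<exists>i. B i = b"
      using rng unfolding B_def SS_def by (metis UNIV_I UN_I imageE)
    then obtain idx where idx: "\<And>b. b \<in> S k \<Longrightarrow> B (idx b) = b" by metis
    \<comment> \<open>\<open>S k\<close> is finite, so finitely many digits decide membership in all
      of its balls; points sharing a ball of radius 1 / (k + 1) < e / 2 are less than e
      apart.\<close>
    define m where "m = Max (idx ` S k)"
    have m: "idx b \<le> m" if "b \<in> S k" for b
      unfolding m_def using that T(1) by (intro Max_ge) (auto simp: S_def)
    show "\<exists>d>0. \<forall>x\<in>X. \<forall>y\<in>X. \<bar>c x - c y\<bar> < d \<longrightarrow> dist x y \<le> e"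
    proof (intro exI[of _ "(1/3)^m / 2"] conjI ballI impI)
      fix x y assume x: "x \<in> X" and y: "y \<in> X" and d: "\<bar>c x - c y\<bar> < (1/3)^m / 2"
      from x T(2)[of k] obtain t where t: "t \<in> T k" "x \<in> ball t (1 / real (Suc k))" by blast
      define b where "b = ball t (1 / real (Suc k))"
      have bS: "b \<in> S k" using t by (simp add: b_def S_def)
      have "indicator (B (idx b)) x = (indicator (B (idx b)) y :: real)"
        by (rule base3_digits_eq[of "\<lambda>n. indicator (B n) x" "\<lambda>n. indicator (B n) y" m])
          (use d m[OF bS] in \<open>auto simp: c_def indicator_def\<close>)
      then have "y \<in> b" using idx[OF bS] t(2) unfolding b_def[symmetric] by (auto simp: indicator_def split: if_splits)
      then have "dist x y < 1 / real (Suc k) + 1 / real (Suc k)"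
        using t(2) unfolding b_def mem_ball by (metis dist_commute dist_triangle_less_add)
      then show "dist x y \<le> e" using k by simp
    qed simp
  qed
qed

text \<open>The images of the measures under \<open>c\<close> live on [0, 3/2], hence are tight, and
  a subsequence converges on the real line. The limit is pulled back along \<open>p\<close>, the
  continuous extension of the inverse of \<open>c\<close> to the closure of the image.\<close>

theorem probs_sequentially_compact:
  fixes X :: "'a::metric_space set" and M :: "nat \<Rightarrow> 'a measure"
  assumes X: "compact X" and M: "\<And>n. M n \<in> probs X"
  obtains r \<mu> where "strict_mono (r :: nat \<Rightarrow> nat)" "\<mu> \<in> probs X" "wk_conv X (M \<circ> r) \<mu>"
proof -
  interpret M: prob_space "M n" for n by (rule probsD[OF M])
  have "X \<noteq> {}" using M.not_empty[of 0] probsD(2)[OF M] by auto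
  then obtain x0 where x0: "x0 \<in> X" by auto
  obtain c :: "'a \<Rightarrow> real" where c: "c \<in> borel_measurable (borel_on X)" "\<And>x. 0 \<le> c x" "\<And>x. c x \<le> 3 / 2"
    "\<And>e. 0 < e \<Longrightarrow> \<exists>d>0. \<forall>x\<in>X. \<forall>y\<in>X. \<bar>c x - c y\<bar> < d \<longrightarrow> dist x y \<le> e"
    using compact_borel_code[OF X \<open>X \<noteq> {}\<close>] by metis
  define C where "C = closure (c ` X)"
  have Cne: "C \<noteq> {}" "closed C" using \<open>X \<noteq> {}\<close> by (auto simp: C_def)
  \<comment> \<open>Since \<open>c\<close> is not continuous, its image need not be closed; the
    values of \<open>p\<close> at the added points come from compactness of X.\<close>
  have "\<exists>x\<in>X. \<forall>e>0. \<exists>y\<in>X. \<bar>c y - t\<bar> < e \<and> dist y x < e" if "t \<in> C" for t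
  proof -
    obtain s where s: "\<And>n. s n \<in> c ` X" "s \<longlonglongrightarrow> t" using \<open>t \<in> C\<close> unfolding C_def closure_sequential by blast
    from s(1) have "\<forall>n. \<exists>y\<in>X. s n = c y" by blast
    then obtain y where y: "\<And>n. y n \<in> X" "\<And>n. s n = c (y n)" by metis
    obtain x r where x: "x \<in> X" "strict_mono (r :: nat \<Rightarrow> nat)" "(y \<circ> r) \<longlonglongrightarrow> x"
      using X y(1) unfolding compact_def by metis
    have "\<exists>y\<in>X. \<bar>c y - t\<bar> < e \<and> dist y x < e" if "0 < e" for e
    proof -
      have "eventually (\<lambda>n. dist ((y \<circ> r) n) x < e) sequentially" using x(3) that by (rule tendstoD)
      moreover have "eventually (\<lambda>n. dist ((s \<circ> r) n) t < e) sequentially"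
        using LIMSEQ_subseq_LIMSEQ[OF s(2) x(2)] that by (rule tendstoD)
      ultimately have "eventually (\<lambda>n. dist ((y \<circ> r) n) x < e \<and> dist ((s \<circ> r) n) t < e) sequentially"
        by (rule eventually_conj)
      then obtain n where "dist ((y \<circ> r) n) x < e" "dist ((s \<circ> r) n) t < e"
        using eventually_happens by force
      then show ?thesis using y by (intro bexI[of _ "y (r n)"]) (auto simp: dist_real_def)
    qed
    with x(1) show ?thesis by blast
  qed
  then obtain p where p: "\<And>t. t \<in> C \<Longrightarrow> p t \<in> X"
    "\<And>t e. t \<in> C \<Longrightarrow> 0 < e \<Longrightarrow> \<exists>y\<in>X. \<bar>c y - t\<bar> < e \<and> dist y (p t) < e" by metis
  have p_close: "\<exists>d>0. \<forall>t\<in>C. \<forall>t'\<in>C. \<bar>t - t'\<bar> < d \<longrightarrow> dist (p t) (p t') < e" if e: "0 < e" for e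
  proof -
    obtain d where d: "d > 0" "\<forall>x\<in>X. \<forall>y\<in>X. \<bar>c x - c y\<bar> < d \<longrightarrow> dist x y \<le> e / 3"
      using c(4)[of "e/3"] e by auto
    show ?thesis
    proof (intro exI[of _ "d/3"] conjI ballI impI)
      fix t t' assume t: "t \<in> C" "t' \<in> C" "\<bar>t - t'\<bar> < d / 3"
      obtain y where y: "y \<in> X" "\<bar>c y - t\<bar> < min (d/3) (e/3)" "dist y (p t) < min (d/3) (e/3)"
        using p(2)[OF t(1), of "min (d/3) (e/3)"] d e by auto
      obtain y' where y': "y' \<in> X" "\<bar>c y' - t'\<bar> < min (d/3) (e/3)" "dist y' (p t') < min (d/3) (e/3)"
        using p(2)[OF t(2), of "min (d/3) (e/3)"] d e by auto
      have "\<bar>c y - c y'\<bar> < d" using y y' t by linarith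
      then have "dist y y' \<le> e / 3" using d y y' by blast
      moreover have "dist (p t) (p t') \<le> dist y (p t) + dist y y' + dist y' (p t')"
        by metric
      ultimately show "dist (p t) (p t') < e" using y y' by linarith
    qed (use d in simp)
  qed
  have pcont: "continuous_on C p"
    unfolding continuous_on_iff
  proof (intro ballI allI impI)
    fix t and e :: real assume t: "t \<in> C" and e: "0 < e"
    obtain d where d: "d > 0" "\<forall>t\<in>C. \<forall>t'\<in>C. \<bar>t - t'\<bar> < d \<longrightarrow> dist (p t) (p t') < e"
      using p_close[OF e] by blast
    then show "\<exists>d>0. \<forall>t'\<in>C. dist t' t < d \<longrightarrow> dist (p t') (p t) < e"
      using t unfolding dist_real_def by (intro exI[of _ d]) blast
  qed
  have cC: "c x \<in> C" if "x \<in> X" for x using that closure_subset[of "c ` X"] by (auto simp: C_def)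
  have pc: "p (c x) = x" if x: "x \<in> X" for x
  proof -
    have "dist (p (c x)) x \<le> e" if e: "0 < e" for e
    proof -
      obtain d where d: "d > 0" "\<forall>x\<in>X. \<forall>y\<in>X. \<bar>c x - c y\<bar> < d \<longrightarrow> dist x y \<le> e / 2"
        using c(4)[of "e/2"] e by auto
      obtain y where y: "y \<in> X" "\<bar>c y - c x\<bar> < min d (e/2)" "dist y (p (c x)) < min d (e/2)"
        using p(2)[OF cC[OF x], of "min d (e/2)"] d e by auto
      then have "dist y x \<le> e / 2" using d x by auto
      moreover have "dist (p (c x)) x \<le> dist y (p (c x)) + dist y x" by metric
      ultimately show ?thesis using y by linarith
    qed
    then have "dist (p (c x)) x \<le> 0" by (rule field_le_epsilon) simp
    then show ?thesis by simp
  qed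
  have cM: "c \<in> borel_measurable (M n)" for n
    using c(1) probsD(3)[OF M[of n]] by (simp cong: measurable_cong_sets)
  define N where "N n = distr (M n) borel c" for n
  have rd: "real_distribution (N n)" for n
    unfolding N_def using cM by (rule M.real_distribution_distr)
  have "tight N" unfolding tight_def
  proof (intro conjI allI impI rd)
    fix e :: real assume "0 < e"
    have *: "1 - e < measure (N n) {-1<..2}" for n
    proof -
    have "measure (N n) {-1<..2} = measure (M n) (c -` {-1<..2} \<inter> space (M n))"
      unfolding N_def using cM by (intro measure_distr) auto
    also have "c -` {-1<..2} \<inter> space (M n) = space (M n)"
    proof -
      have "c x \<in> {-1<..2}" for x using c(2,3)[of x] by (simp only: greaterThanAtMost_iff) linarith
      then show ?thesis by auto
    qed
    finally show ?thesis using \<open>0 < e\<close> M.prob_space by simp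
    qed
    have "(-1::real) < 2 \<and> (\<forall>n. 1 - e < measure (N n) {-1<..2})" using * by simp
    then show "\<exists>a b. a < b \<and> (\<forall>n. 1 - e < measure (N n) {a<..b})" by blast
  qed
  then obtain r \<nu> where r: "strict_mono (r :: nat \<Rightarrow> nat)" and \<nu>: "real_distribution \<nu>"
    and wc: "weak_conv_m (N \<circ> (\<lambda>x. x) \<circ> r) \<nu>"
    using tight_imp_convergent_subsubsequence[of N "\<lambda>x. x"] by (auto simp: strict_mono_def)
  interpret \<nu>: real_distribution \<nu> by fact
  have conv: "(\<lambda>n. integral\<^sup>L (N (r n)) G) \<longlonglongrightarrow> integral\<^sup>L \<nu> G"
    if G: "continuous_on UNIV G" "\<And>x. \<bar>G x\<bar> \<le> K" for G :: "real \<Rightarrow> real" and K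
  proof -
    have "(\<lambda>n. integral\<^sup>L ((N \<circ> (\<lambda>x. x) \<circ> r) n) G) \<longlonglongrightarrow> integral\<^sup>L \<nu> G"
      by (rule weak_conv_imp_integral_bdd_continuous_conv[OF _ \<nu> wc, where B = K])
        (use rd G in \<open>auto simp: continuous_on_eq_continuous_at\<close>)
    then show ?thesis by simp
  qed
  have intN: "integral\<^sup>L (N n) G = (\<integral>x. G (c x) \<partial>M n)" if "continuous_on UNIV G" for G :: "real \<Rightarrow> real" and n
    unfolding N_def using cM that by (intro integral_distr borel_measurable_continuous_onI)
  \<comment> \<open>The limit must not charge the complement of \<open>C\<close>, where no inverse
    is available: the bounded continuous function min 1 (infdist t C) has integral 0 under every
    \<open>N n\<close>, hence under \<nu>.\<close>
  have AE_C: "AE t in \<nu>. t \<in> C"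
  proof -
    define G where "G t = min 1 (infdist t C)" for t
    have Gc: "continuous_on UNIV G" unfolding G_def by (intro continuous_intros)
    have Gb: "\<bar>G t\<bar> \<le> 1" for t by (auto simp: G_def infdist_nonneg)
    have "integral\<^sup>L (N n) G = 0" for n
    proof -
      have "(\<integral>x. G (c x) \<partial>M n) = (\<integral>x. 0 \<partial>M n)"
        by (rule Bochner_Integration.integral_cong) (auto simp: G_def cC probsD(2)[OF M])
      then show ?thesis by (simp add: intN[OF Gc])
    qed
    then have "integral\<^sup>L \<nu> G = 0" using conv[OF Gc Gb] by (simp add: LIMSEQ_const_iff)
    moreover have "integrable \<nu> G"
      using Gb borel_measurable_continuous_onI[OF Gc]
      by (intro \<nu>.integrable_const_bound[where B = 1]) (auto cong: measurable_cong_sets)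
    ultimately have "AE t in \<nu>. G t = 0"
      by (subst (asm) integral_nonneg_eq_0_iff_AE) (auto simp: G_def infdist_nonneg)
    then show ?thesis
    proof eventually_elim
      case (elim t)
      then have "infdist t C = 0" by (auto simp: G_def min_def split: if_splits)
      then show ?case using in_closed_iff_infdist_zero[OF Cne(2,1)] by simp
    qed
  qed
  define P where "P t = (if t \<in> C then p t else x0)" for t
  have "P \<in> borel_measurable borel" unfolding P_def
    by (intro borel_measurable_continuous_on_if pcont borel_closed Cne continuous_on_const)
  moreover have PX: "P t \<in> X" for t using p x0 by (auto simp: P_def)
  ultimately have Pm: "P \<in> measurable \<nu> (borel_on X)"
    unfolding borel_on_def by (intro measurable_restrict_space2) (auto cong: measurable_cong_sets)
  define \<mu> where "\<mu> = distr \<nu> (borel_on X) P"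
  have \<mu>: "\<mu> \<in> probs X" unfolding probs_def \<mu>_def using \<nu>.prob_space_distr[OF Pm] by simp
  have "wk_conv X (M \<circ> r) \<mu>" unfolding wk_conv_def
  proof (intro allI impI)
    fix g :: "'a \<Rightarrow> real" assume g: "continuous_on X g"
    obtain K where K: "\<And>x. x \<in> X \<Longrightarrow> \<bar>g x\<bar> \<le> K" "K > 0" using continuous_on_compact_bounded[OF X g] by metis
    have "continuous_on C (\<lambda>t. g (p t))"
      using p(1) by (intro continuous_on_compose2[OF g pcont]) auto
    \<comment> \<open>Convergence on the line is tested with bounded continuous functions on all
      reals, so g composed with \<open>p\<close> is extended from \<open>C\<close> by Tietze's
      theorem.\<close>
    then obtain G where G: "continuous_on UNIV G" "\<And>t. t \<in> C \<Longrightarrow> G t = g (p t)" "\<And>t. norm (G t) \<le> K"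
      using Tietze[of C "\<lambda>t. g (p t)" UNIV K] Cne K p(1) by (auto simp: closed_closedin[symmetric])
    have gm: "g \<in> borel_measurable (borel_on X)" by (rule continuous_measurable_borel_on[OF g])
    have "integral\<^sup>L \<mu> g = (\<integral>t. g (P t) \<partial>\<nu>)" unfolding \<mu>_def by (rule integral_distr[OF Pm gm])
    also have "\<dots> = integral\<^sup>L \<nu> G"
    proof (rule integral_cong_AE)
      show "(\<lambda>t. g (P t)) \<in> borel_measurable \<nu>" using measurable_comp[OF Pm gm] by (simp add: comp_def)
      show "G \<in> borel_measurable \<nu>" using borel_measurable_continuous_onI[OF G(1)] by (simp cong: measurable_cong_sets)
      show "AE t in \<nu>. g (P t) = G t" using AE_C by eventually_elim (simp add: P_def G)
    qed
    finally have 1: "integral\<^sup>L \<mu> g = integral\<^sup>L \<nu> G" .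
    have 2: "integral\<^sup>L (M n) g = integral\<^sup>L (N n) G" for n
      unfolding intN[OF G(1)] by (rule Bochner_Integration.integral_cong) (auto simp: probsD(2)[OF M] G cC pc)
    show "(\<lambda>n. integral\<^sup>L ((M \<circ> r) n) g) \<longlonglongrightarrow> integral\<^sup>L \<mu> g"
      using conv[OF G(1), of K] G(3) by (simp add: 1 2)
  qed
  with r \<mu> show ?thesis by (rule that)
qed

section \<open>Itineraries and entropy\<close>

text \<open>One construction for two uses: the empirical measure of a single orbit and weighted
  averages over the orbits of a separated set.\<close>

lemma finite_mixture_probs:
  fixes X :: "'a::metric_space set" and w :: "'i \<Rightarrow> real"
  assumes A: "finite A" and w: "\<And>a. a \<in> A \<Longrightarrow> 0 \<le> w a" "sum w A = 1" and h: "\<And>a. a \<in> A \<Longrightarrow> h a \<in> X"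
  obtains \<mu> where "\<mu> \<in> probs X"
    "\<And>g::'a \<Rightarrow> real. g \<in> borel_measurable (borel_on X) \<Longrightarrow> integral\<^sup>L \<mu> g = (\<Sum>a\<in>A. w a * g (h a))"
    "\<And>B. B \<in> sets (borel_on X) \<Longrightarrow> measure \<mu> B = (\<Sum>a\<in>A. w a * indicator B (h a))"
proof -
  define N where "N = point_measure A (\<lambda>a. ennreal (w a))"
  define \<mu> where "\<mu> = distr N (borel_on X) h"
  have hm: "h \<in> measurable N (borel_on X)"
    unfolding N_def using h by (auto simp: measurable_def space_point_measure sets_point_measure)
  have "emeasure N (space N) = (\<Sum>a\<in>A. ennreal (w a))"
    unfolding N_def using A by (simp add: space_point_measure emeasure_point_measure_finite)
  also have "\<dots> = 1" using w by (subst sum_ennreal) auto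
  finally interpret N: prob_space N by (rule prob_spaceI)
  have \<mu>: "\<mu> \<in> probs X" unfolding probs_def \<mu>_def using N.prob_space_distr[OF hm] by simp
  have int: "integral\<^sup>L \<mu> g = (\<Sum>a\<in>A. w a * g (h a))" if "g \<in> borel_measurable (borel_on X)" for g :: "'a \<Rightarrow> real"
    unfolding \<mu>_def integral_distr[OF hm that] unfolding N_def
    using A w by (simp add: lebesgue_integral_point_measure_finite)
  show ?thesis
  proof (rule that[OF \<mu> int])
    fix B assume B: "B \<in> sets (borel_on X)"
    then have "measure \<mu> B = integral\<^sup>L \<mu> (indicat_real B)"
      using sets.sets_into_space[OF B] probsD[OF \<mu>] by (simp add: Int_absorb2)
    also have "\<dots> = (\<Sum>a\<in>A. w a * indicator B (h a))" using B by (intro int) auto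
    finally show "measure \<mu> B = (\<Sum>a\<in>A. w a * indicator B (h a))" .
  qed
qed

lemma integral_finite_range:
  fixes F :: "'v \<Rightarrow> real"
  assumes \<mu>: "\<mu> \<in> probs X" and V: "finite V" "\<xi> ` X \<subseteq> V"
    and meas: "\<And>v. {x\<in>X. \<xi> x = v} \<in> sets (borel_on X)"
  shows "(\<integral>x. F (\<xi> x) \<partial>\<mu>) = (\<Sum>v\<in>V. measure \<mu> {x\<in>X. \<xi> x = v} * F v)"
proof -
  interpret prob_space \<mu> by (rule probsD[OF \<mu>])
  have m: "{x\<in>X. \<xi> x = v} \<in> sets \<mu>" for v using meas probsD[OF \<mu>] by simp
  have "(\<integral>x. F (\<xi> x) \<partial>\<mu>) = (\<integral>x. (\<Sum>v\<in>V. F v * indicator {x\<in>X. \<xi> x = v} x) \<partial>\<mu>)"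
  proof (rule Bochner_Integration.integral_cong[OF refl])
    fix x assume "x \<in> space \<mu>"
    then have x: "x \<in> X" by (simp add: probsD[OF \<mu>])
    have "(\<Sum>v\<in>V. F v * indicator {x\<in>X. \<xi> x = v} x) = (\<Sum>v\<in>V. if v = \<xi> x then F v else 0)"
      using x by (intro sum.cong) (auto simp: indicator_def)
    then show "F (\<xi> x) = (\<Sum>v\<in>V. F v * indicator {x\<in>X. \<xi> x = v} x)"
      using V x by (auto simp: sum.delta)
  qed
  also have "\<dots> = (\<Sum>v\<in>V. \<integral>x. F v * indicator {x\<in>X. \<xi> x = v} x \<partial>\<mu>)"
    using m by (intro Bochner_Integration.integral_sum integrable_mult_right)
      (simp add: integrable_indicator_iff less_top[symmetric])
  also have "\<dots> = (\<Sum>v\<in>V. measure \<mu> {x\<in>X. \<xi> x = v} * F v)"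
    using m sets.sets_into_space[OF m] by (intro sum.cong refl) (simp add: Int_absorb1)
  finally show ?thesis .
qed

lemma sum_measure_fibers:
  assumes \<mu>: "\<mu> \<in> probs X" and V: "finite V" "\<xi> ` X \<subseteq> V"
    and meas: "\<And>v. {x\<in>X. \<xi> x = v} \<in> sets (borel_on X)"
  shows "(\<Sum>v\<in>V. measure \<mu> {x\<in>X. \<xi> x = v}) = 1"
proof -
  interpret prob_space \<mu> by (rule probsD[OF \<mu>])
  show ?thesis using integral_finite_range[OF assms, of "\<lambda>_. 1"] by (simp add: prob_space)
qed

section \<open>Invariant measures and empirical measures\<close>

locale compact_system =
  fixes X :: "'a::metric_space set" and f :: "'a \<Rightarrow> 'a"
  assumes compact: "compact X" and cont: "continuous_on X f" and maps: "f ` X \<subseteq> X"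
begin

lemma iter_in: "x \<in> X \<Longrightarrow> (f ^^ n) x \<in> X"
  using maps by (induction n) auto

lemma iter_cont: "continuous_on X (f ^^ n)"
proof (induction n)
  case (Suc n)
  have "continuous_on X (\<lambda>x. f ((f ^^ n) x))"
    by (rule continuous_on_compose2[OF cont Suc]) (auto simp: iter_in)
  then show ?case by (simp add: comp_def)
qed (simp add: id_def)

lemma iter_measurable: "(f ^^ n) \<in> measurable (borel_on X) (borel_on X)"
proof -
  have "(f ^^ n) \<in> borel_measurable (borel_on X)" by (rule continuous_measurable_borel_on[OF iter_cont])
  then show ?thesis
    by (subst (2) borel_on_def, intro measurable_restrict_space2) (auto simp: iter_in)
qed

lemma iter_vimage_sets: "A \<in> sets (borel_on X) \<Longrightarrow> (f ^^ n) -` A \<inter> X \<in> sets (borel_on X)"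
  using measurable_sets[OF iter_measurable] by simp

lemma invariant_in_probs: "\<mu> \<in> invariant_probs X f \<Longrightarrow> \<mu> \<in> probs X"
  by (simp add: invariant_probs_def)

lemma invariant_measure_iter:
  assumes \<mu>: "\<mu> \<in> invariant_probs X f" and A: "A \<in> sets (borel_on X)"
  shows "measure \<mu> ((f ^^ n) -` A \<inter> X) = measure \<mu> A"
proof (induction n)
  case 0
  then show ?case using sets.sets_into_space[OF A] by (simp add: Int_absorb2)
next
  case (Suc n)
  have "(f ^^ Suc n) -` A \<inter> X = f -` ((f ^^ n) -` A \<inter> X) \<inter> X"
    using maps by (auto simp: funpow_swap1)
  moreover have "measure \<mu> (f -` ((f ^^ n) -` A \<inter> X) \<inter> X) = measure \<mu> ((f ^^ n) -` A \<inter> X)"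
    using \<mu> iter_vimage_sets[OF A, of n] probsD(3)[OF invariant_in_probs[OF \<mu>]]
    unfolding invariant_probs_def by blast
  ultimately show ?case using Suc by (simp only:)
qed

lemma distr_in_probs: "\<mu> \<in> probs X \<Longrightarrow> distr \<mu> (borel_on X) (f ^^ n) \<in> probs X"
proof -
  assume \<mu>: "\<mu> \<in> probs X"
  interpret prob_space \<mu> by (rule probsD[OF \<mu>])
  have "(f ^^ n) \<in> measurable \<mu> (borel_on X)"
    using iter_measurable by (simp add: probsD[OF \<mu>] cong: measurable_cong_sets)
  then show ?thesis by (auto simp: probs_def intro: prob_space_distr)
qed

lemma integral_distr_iter:
  fixes g :: "'a \<Rightarrow> real"
  assumes \<mu>: "\<mu> \<in> probs X" and g: "g \<in> borel_measurable (borel_on X)"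
  shows "integral\<^sup>L (distr \<mu> (borel_on X) (f ^^ n)) g = (\<integral>x. g ((f ^^ n) x) \<partial>\<mu>)"
proof (rule integral_distr[OF _ g])
  show "(f ^^ n) \<in> measurable \<mu> (borel_on X)"
    using iter_measurable by (simp add: probsD[OF \<mu>] cong: measurable_cong_sets)
qed

lemma invariant_distr:
  assumes \<mu>: "\<mu> \<in> invariant_probs X f"
  shows "distr \<mu> (borel_on X) (f ^^ n) = \<mu>"
proof (rule measure_eqI)
  have p: "\<mu> \<in> probs X" by (rule invariant_in_probs[OF \<mu>])
  interpret prob_space \<mu> by (rule probsD[OF p])
  have m: "(f ^^ n) \<in> measurable \<mu> (borel_on X)"
    using iter_measurable by (simp add: probsD[OF p] cong: measurable_cong_sets)
  show "sets (distr \<mu> (borel_on X) (f ^^ n)) = sets \<mu>" by (simp add: probsD[OF p])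
  fix A assume "A \<in> sets (distr \<mu> (borel_on X) (f ^^ n))"
  then have A: "A \<in> sets (borel_on X)" by simp
  show "emeasure (distr \<mu> (borel_on X) (f ^^ n)) A = emeasure \<mu> A"
    using invariant_measure_iter[OF \<mu> A, of n]
    by (simp add: emeasure_distr[OF m A] probsD[OF p] emeasure_eq_measure)
qed

lemma invariant_integral_iter:
  fixes g :: "'a \<Rightarrow> real"
  assumes \<mu>: "\<mu> \<in> invariant_probs X f" and g: "g \<in> borel_measurable (borel_on X)"
  shows "(\<integral>x. g ((f ^^ n) x) \<partial>\<mu>) = integral\<^sup>L \<mu> g"
  using integral_distr_iter[OF invariant_in_probs[OF \<mu>] g, of n] by (simp add: invariant_distr[OF \<mu>])

text \<open>Probability measures on X are determined by the integrals of continuous functions, so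
  the image of \<mu> under f is \<mu> itself. In this form invariance can be verified for weak
  limits.\<close>

lemma invariant_probsI:
  assumes \<mu>: "\<mu> \<in> probs X"
    and inv: "\<And>g::'a \<Rightarrow> real. continuous_on X g \<Longrightarrow> (\<integral>x. g (f x) \<partial>\<mu>) = integral\<^sup>L \<mu> g"
  shows "\<mu> \<in> invariant_probs X f"
proof -
  interpret prob_space \<mu> by (rule probsD[OF \<mu>])
  have eq: "distr \<mu> (borel_on X) (f ^^ 1) = \<mu>"
    by (rule probs_eqI[OF distr_in_probs[OF \<mu>] \<mu> compact])
      (simp add: integral_distr_iter[OF \<mu>, of _ 1, simplified] continuous_measurable_borel_on inv)
  have m: "f \<in> measurable \<mu> (borel_on X)"
    using iter_measurable[of 1] by (simp add: probsD[OF \<mu>] cong: measurable_cong_sets)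
  show ?thesis unfolding invariant_probs_def
  proof (intro CollectI conjI ballI \<mu>)
    fix A assume "A \<in> sets \<mu>"
    then have "A \<in> sets (borel_on X)" by (simp add: probsD[OF \<mu>])
    from measure_distr[OF m this] show "measure \<mu> (f -` A \<inter> X) = measure \<mu> A"
      using eq by (simp add: probsD[OF \<mu>])
  qed
qed

text \<open>\<open>measure_of\<close> takes the prescribed values only if these form a measure;
  comparison with a mixture of point masses settles this and yields the integrals at once.\<close>

lemma empirical_props:
  assumes n: "0 < n" and x: "x \<in> X"
  shows empirical_in_probs: "empirical X f n x \<in> probs X"
    and empirical_integral: "\<And>g::'a \<Rightarrow> real. g \<in> borel_measurable (borel_on X) \<Longrightarrow>
      integral\<^sup>L (empirical X f n x) g = (\<Sum>j<n. g ((f ^^ j) x)) / n"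
proof -
  obtain \<mu> where \<mu>: "\<mu> \<in> probs X"
    "\<And>g::'a \<Rightarrow> real. g \<in> borel_measurable (borel_on X) \<Longrightarrow> integral\<^sup>L \<mu> g = (\<Sum>a\<in>{..<n}. (1/n) * g ((f ^^ a) x))"
    "\<And>B. B \<in> sets (borel_on X) \<Longrightarrow> measure \<mu> B = (\<Sum>a\<in>{..<n}. (1/n) * indicator B ((f ^^ a) x))"
    by (rule finite_mixture_probs[of "{..<n}" "\<lambda>_. 1/n" "\<lambda>a. (f ^^ a) x" X]) (use n x in \<open>auto simp: iter_in\<close>)
  interpret prob_space \<mu> by (rule probsD[OF \<mu>(1)])
  have "empirical X f n x = measure_of (space \<mu>) (sets \<mu>) (emeasure \<mu>)"
    unfolding empirical_def probsD[OF \<mu>(1)]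
  proof (rule measure_of_eq)
    show "sets (borel_on X) \<subseteq> Pow X" using sets.space_closed[of "borel_on X"] by simp
    fix B assume "B \<in> sigma_sets X (sets (borel_on X))"
    then have B: "B \<in> sets (borel_on X)" using sets.sigma_sets_eq[of "borel_on X"] by simp
    have "(\<Sum>a\<in>{..<n}. (1/n) * indicator B ((f ^^ a) x)) = (\<Sum>a<n. indicator B ((f ^^ a) x)) / real n"
      by (simp add: sum_divide_distrib)
    also have "(\<Sum>a<n. indicator B ((f ^^ a) x)) = real (card {j\<in>{..<n}. (f ^^ j) x \<in> B})"
      by (simp add: indicator_def sum.If_cases Int_def)
    finally show "ennreal (real (card {j\<in>{..<n}. (f ^^ j) x \<in> B}) / real n) = emeasure \<mu> B"
      using \<mu>(3)[OF B] by (simp add: emeasure_eq_measure)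
  qed
  then have eq: "empirical X f n x = \<mu>" by (simp add: measure_of_of_measure)
  show "empirical X f n x \<in> probs X" by (simp add: eq \<mu>)
  show "integral\<^sup>L (empirical X f n x) g = (\<Sum>j<n. g ((f ^^ j) x)) / n"
    if "g \<in> borel_measurable (borel_on X)" for g :: "'a \<Rightarrow> real"
    unfolding eq \<mu>(2)[OF that] by (simp add: sum_divide_distrib)
qed

section \<open>Itineraries and word entropy\<close>

definition itin :: "('a \<Rightarrow> 'b) \<Rightarrow> nat \<Rightarrow> 'a \<Rightarrow> 'b list" where
  "itin l n x = map (\<lambda>i. l ((f ^^ i) x)) [0..<n]"

text \<open>A finite Borel partition presented by a labelling of points. The label type stays free,
  so that labels can be indices of balls or the cells of a given partition.\<close>

definition borel_label :: "('a \<Rightarrow> 'b) \<Rightarrow> bool" where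
  "borel_label l \<longleftrightarrow> finite (l ` X) \<and> (\<forall>v. {x\<in>X. l x = v} \<in> sets (borel_on X))"

text \<open>The entropy of the n-fold join of the partition into label classes: words name its
  cells, and words that do not occur contribute 0.\<close>

definition word_entropy :: "'a measure \<Rightarrow> ('a \<Rightarrow> 'b) \<Rightarrow> nat \<Rightarrow> real" where
  "word_entropy \<mu> l n = (\<Sum>w\<in>words (l ` X) n. - eta0 (measure \<mu> {x\<in>X. itin l n x = w}))"

lemma itin_in_words: "x \<in> X \<Longrightarrow> itin l n x \<in> words (l ` X) n"
  by (auto simp: words_def itin_def iter_in)

lemma length_itin [simp]: "length (itin l n x) = n"
  by (simp add: itin_def)

lemma itin_nth: "i < n \<Longrightarrow> itin l n x ! i = l ((f ^^ i) x)"
  by (simp add: itin_def)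

lemma itin_eq_iff: "itin l n x = itin l n y \<longleftrightarrow> (\<forall>i<n. l ((f ^^ i) x) = l ((f ^^ i) y))"
  by (auto simp: itin_def)

lemma take_drop_itin: "j + k \<le> n \<Longrightarrow> take k (drop j (itin l n x)) = itin l k ((f ^^ j) x)"
  by (rule nth_equalityI) (auto simp: itin_nth funpow_add add.commute)

lemma itin_fiber_sets:
  assumes "borel_label l"
  shows "{x\<in>X. itin l n x = w} \<in> sets (borel_on X)"
proof (cases "length w = n")
  case True
  have "{x\<in>X. itin l n x = w} = {x\<in>space (borel_on X). \<forall>i\<in>{..<n}. x \<in> (f ^^ i) -` {x\<in>X. l x = w ! i} \<inter> X}"
    using True by (auto simp: list_eq_iff_nth_eq itin_nth iter_in)
  also have "\<dots> \<in> sets (borel_on X)"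
  proof (rule sets.sets_Collect_finite_All)
    fix i
    have "{x\<in>space (borel_on X). x \<in> (f ^^ i) -` {x\<in>X. l x = w ! i} \<inter> X} = (f ^^ i) -` {x\<in>X. l x = w ! i} \<inter> X"
      by auto
    then show "{x\<in>space (borel_on X). x \<in> (f ^^ i) -` {x\<in>X. l x = w ! i} \<inter> X} \<in> sets (borel_on X)"
      using assms iter_vimage_sets[of "{x\<in>X. l x = w ! i}" i] by (simp add: borel_label_def)
  qed simp
  finally show ?thesis .
next
  case False
  then have "{x\<in>X. itin l n x = w} = {}" by auto
  then show ?thesis by (simp only: sets.empty_sets)
qed

lemma finite_words_label: "borel_label l \<Longrightarrow> finite (words (l ` X) n)"
  by (simp add: borel_label_def finite_words)

lemma integral_itin:
  fixes F :: "'b list \<Rightarrow> real"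
  assumes "\<mu> \<in> probs X" "borel_label l"
  shows "(\<integral>x. F (itin l n x) \<partial>\<mu>) = (\<Sum>w\<in>words (l ` X) n. measure \<mu> {x\<in>X. itin l n x = w} * F w)"
  by (rule integral_finite_range[OF assms(1) finite_words_label[OF assms(2)] _ itin_fiber_sets[OF assms(2)]])
    (auto simp: itin_in_words)

lemma sum_word_measures:
  assumes "\<mu> \<in> probs X" "borel_label l"
  shows "(\<Sum>w\<in>words (l ` X) n. measure \<mu> {x\<in>X. itin l n x = w}) = 1"
  by (rule sum_measure_fibers[OF assms(1) finite_words_label[OF assms(2)] _ itin_fiber_sets[OF assms(2)]])
    (auto simp: itin_in_words)

lemma itin_borel_measurable:
  fixes F :: "'b list \<Rightarrow> real"
  assumes "borel_label l"
  shows "(\<lambda>x. F (itin l n x)) \<in> borel_measurable (borel_on X)"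
proof (rule borel_measurableI)
  fix S :: "real set"
  have "(\<lambda>x. F (itin l n x)) -` S \<inter> space (borel_on X)
    = (\<Union>w\<in>{w\<in>words (l ` X) n. F w \<in> S}. {x\<in>X. itin l n x = w})"
    by (auto simp: itin_in_words)
  also have "\<dots> \<in> sets (borel_on X)"
    using finite_words_label[OF assms] by (intro sets.finite_UN itin_fiber_sets[OF assms]) auto
  finally show "(\<lambda>x. F (itin l n x)) -` S \<inter> space (borel_on X) \<in> sets (borel_on X)" .
qed

lemma word_entropy_nonneg:
  assumes "\<mu> \<in> probs X"
  shows "0 \<le> word_entropy \<mu> l n"
proof -
  interpret prob_space \<mu> by (rule probsD[OF assms])
  show ?thesis unfolding word_entropy_def eta0_eq
  proof (rule sum_nonneg)
    fix w
    show "0 \<le> - (measure \<mu> {x\<in>X. itin l n x = w} * ln (measure \<mu> {x\<in>X. itin l n x = w}))"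
      by (cases "measure \<mu> {x\<in>X. itin l n x = w} = 0")
        (auto simp: mult_le_0_iff measure_le_0_iff zero_less_measure_iff)
  qed
qed

text \<open>\<open>entropy_block_bound\<close> with Q the distribution of words of length k: by
  invariance each of the n - k + 1 positions contributes \<open>word_entropy \<mu> l k\<close>.
  Divided by k n, this is a quantitative substitute for subadditivity.\<close>

lemma word_entropy_block:
  assumes \<mu>: "\<mu> \<in> invariant_probs X f" and l: "borel_label l" and k: "0 < k" "k \<le> n"
  shows "k * word_entropy \<mu> l n \<le> 2 * real k * real k * ln (card (l ` X)) + n * word_entropy \<mu> l k"
proof -
  have p: "\<mu> \<in> probs X" by (rule invariant_in_probs[OF \<mu>])
  interpret prob_space \<mu> by (rule probsD[OF p])
  define m where "m n w = measure \<mu> {x\<in>X. itin l n x = w}" for n w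
  define I where "I = {w\<in>words (l ` X) n. 0 < m n w}"
  have V: "finite (l ` X)" "l ` X \<noteq> {}" using l not_empty probsD[OF p] by (auto simp: borel_label_def)
  have fin: "finite (words (l ` X) n)" by (rule finite_words_label[OF l])
  have "k * (\<Sum>w\<in>I. - eta0 (m n w)) \<le> 2 * real k * real k * ln (card (l ` X))
    + (\<Sum>w\<in>I. m n w * (\<Sum>j<Suc n - k. - ln (m k (take k (drop j (id w))))))"
  proof (rule entropy_block_bound[where V = "l ` X" and n = n])
    show "finite I" using fin by (simp add: I_def)
    have "sum (m n) I = sum (m n) (words (l ` X) n)"
      by (rule sum.mono_neutral_left[OF fin]) (auto simp: I_def m_def zero_less_measure_iff)
    then show "sum (m n) I = 1" using sum_word_measures[OF p l] by (simp add: m_def)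
    show "(\<Sum>v\<in>words (l ` X) k. m k v) \<le> 1" using sum_word_measures[OF p l] by (simp add: m_def)
    fix w j assume w: "w \<in> I" and j: "j + k \<le> n"
    have "0 < m n w" using w by (simp add: I_def)
    also have "m n w \<le> measure \<mu> ((f ^^ j) -` {x\<in>X. itin l k x = take k (drop j w)} \<inter> X)"
      unfolding m_def using iter_vimage_sets[OF itin_fiber_sets[OF l]]
      by (intro finite_measure_mono) (auto simp: probsD[OF p] iter_in take_drop_itin[OF j])
    also have "\<dots> = m k (take k (drop j w))"
      unfolding m_def by (rule invariant_measure_iter[OF \<mu> itin_fiber_sets[OF l]])
    finally show "0 < m k (take k (drop j (id w)))" by simp
  qed (use V k in \<open>auto simp: I_def m_def\<close>)
  also have "(\<Sum>w\<in>I. - eta0 (m n w)) = word_entropy \<mu> l n"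
    unfolding word_entropy_def m_def[symmetric]
    by (rule sum.mono_neutral_left[OF fin]) (auto simp: I_def m_def zero_less_measure_iff eta0_def)
  also have "(\<Sum>w\<in>I. m n w * (\<Sum>j<Suc n - k. - ln (m k (take k (drop j (id w))))))
     = (\<Sum>w\<in>words (l ` X) n. m n w * (\<Sum>j<Suc n - k. - ln (m k (take k (drop j (id w))))))"
    by (rule sum.mono_neutral_left[OF fin]) (auto simp: I_def m_def zero_less_measure_iff)
  also have "\<dots> = (\<Sum>j<Suc n - k. \<Sum>w\<in>words (l ` X) n. m n w * - ln (m k (take k (drop j w))))"
    by (subst sum.swap) (simp add: sum_distrib_left)
  also have "\<dots> = (\<Sum>j<Suc n - k. word_entropy \<mu> l k)"
  proof (intro sum.cong refl)
    fix j assume "j \<in> {..<Suc n - k}"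
    then have j: "j + k \<le> n" by auto
    have "(\<Sum>w\<in>words (l ` X) n. m n w * - ln (m k (take k (drop j w))))
        = (\<integral>x. - ln (m k (take k (drop j (itin l n x)))) \<partial>\<mu>)"
      unfolding integral_itin[OF p l, of "\<lambda>w. - ln (m k (take k (drop j w)))"] by (simp add: m_def)
    also have "\<dots> = (\<integral>x. - ln (m k (itin l k ((f ^^ j) x))) \<partial>\<mu>)"
      by (simp add: take_drop_itin[OF j])
    also have "\<dots> = (\<integral>x. - ln (m k (itin l k x)) \<partial>\<mu>)"
      by (rule invariant_integral_iter[OF \<mu> itin_borel_measurable[OF l, of "\<lambda>w. - ln (m k w)"]])
    also have "\<dots> = (\<Sum>w\<in>words (l ` X) k. m k w * - ln (m k w))"
      unfolding integral_itin[OF p l, of "\<lambda>w. - ln (m k w)"] by (simp add: m_def)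
    also have "\<dots> = word_entropy \<mu> l k" by (simp add: word_entropy_def m_def eta0_eq)
    finally show "(\<Sum>w\<in>words (l ` X) n. m n w * - ln (m k (take k (drop j w)))) = word_entropy \<mu> l k" .
  qed
  also have "\<dots> = real (Suc n - k) * word_entropy \<mu> l k" by simp
  also have "\<dots> \<le> n * word_entropy \<mu> l k"
    using k word_entropy_nonneg[OF p] by (intro mult_right_mono) auto
  finally show ?thesis by simp
qed

text \<open>The rate at n exceeds the rate at k by at most 2 k c / n, so the rates converge to their
  infimum. Convergence matters because \<open>part_entropy_rate\<close> is defined by
  \<open>lim\<close>, which is unspecified for divergent sequences.\<close>

lemma word_entropy_rate_convergent:
  assumes \<mu>: "\<mu> \<in> invariant_probs X f" and l: "borel_label l"
  shows "convergent (\<lambda>n. word_entropy \<mu> l n / n)"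
proof -
  have p: "\<mu> \<in> probs X" by (rule invariant_in_probs[OF \<mu>])
  define a where "a n = word_entropy \<mu> l n / n" for n
  define c where "c = ln (card (l ` X))"
  define L where "L = Inf (a ` {1..})"
  have a0: "0 \<le> a n" for n by (simp add: a_def word_entropy_nonneg[OF p])
  have bdd: "bdd_below (a ` {1..})" by (rule bdd_belowI[of _ 0]) (auto simp: a0)
  have low: "L \<le> a n" if "1 \<le> n" for n unfolding L_def using that by (intro cInf_lower bdd) auto
  have le: "a n \<le> a k + 2 * k * c / n" if "1 \<le> k" "k \<le> n" for k n
  proof -
    have "k * word_entropy \<mu> l n \<le> 2 * real k * real k * c + n * word_entropy \<mu> l k"
      unfolding c_def using that by (intro word_entropy_block[OF \<mu> l]) auto
    then show ?thesis using that by (simp add: a_def field_simps)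
  qed
  have "a \<longlonglongrightarrow> L"
  proof (rule order_tendstoI)
    fix b assume "b < L"
    then show "eventually (\<lambda>n. b < a n) sequentially"
      using low by (intro eventually_sequentiallyI[of 1]) force
  next
    fix b assume b: "L < b"
    then obtain k where k: "1 \<le> k" "a k < b"
      using cInf_lessD[of "a ` {1..}" b] by (auto simp: L_def)
    have "(\<lambda>n. a k + 2 * k * c / real n) \<longlonglongrightarrow> a k + 0"
      by (intro tendsto_add tendsto_const lim_const_over_n)
    then have "eventually (\<lambda>n. a k + 2 * k * c / real n < b) sequentially"
      using k by (intro order_tendstoD(2)[of _ "a k + 0"]) auto
    moreover have "eventually (\<lambda>n. k \<le> n) sequentially" by (rule eventually_ge_at_top)
    ultimately show "eventually (\<lambda>n. a n < b) sequentially"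
    proof eventually_elim
      case (elim n)
      then show ?case using le[OF k(1), of n] by linarith
    qed
  qed
  then show ?thesis unfolding convergent_def a_def by blast
qed

section \<open>Partition entropy as a rate of word entropies\<close>

text \<open>The empty set is set apart because it may itself belong to a partition and also arises
  as an empty intersection. Every other cell contains a point, whose itinerary dictates all the sets
  that were intersected.\<close>

lemma iter_join_cells:
  assumes P: "\<And>A. A \<in> P \<Longrightarrow> A \<noteq> {} \<Longrightarrow> \<exists>x\<in>X. A = {y\<in>X. l y = l x}"
    "\<And>x. x \<in> X \<Longrightarrow> {y\<in>X. l y = l x} \<in> P"
  shows "iter_join X f P n - {{}} = (\<lambda>x. {y\<in>X. itin l n y = itin l n x}) ` X"
proof (intro equalityI subsetI)
  fix B assume B: "B \<in> iter_join X f P n - {{}}"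
  then obtain A where A: "\<And>i. i < n \<Longrightarrow> A i \<in> P" "B = (\<Inter>i<n. (f ^^ i) -` (A i) \<inter> X) \<inter> X"
    by (auto simp: iter_join_def)
  from B obtain x where x: "x \<in> B" by auto
  then have xX: "x \<in> X" using A by auto
  have "A i = {y\<in>X. l y = l ((f ^^ i) x)}" if i: "i < n" for i
  proof -
    have "(f ^^ i) x \<in> A i" using x i unfolding A(2) by blast
    moreover then obtain z where "A i = {y\<in>X. l y = l z}" using P(1)[OF A(1)[OF i]] by auto
    ultimately show ?thesis by auto
  qed
  then have "B = {y\<in>X. itin l n y = itin l n x}"
    unfolding A(2) itin_eq_iff using iter_in by (auto simp del: INT_simps)
  with xX show "B \<in> (\<lambda>x. {y\<in>X. itin l n y = itin l n x}) ` X" by blast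
next
  fix B assume "B \<in> (\<lambda>x. {y\<in>X. itin l n y = itin l n x}) ` X"
  then obtain x where x: "x \<in> X" "B = {y\<in>X. itin l n y = itin l n x}" by auto
  define A where "A i = {y\<in>X. l y = l ((f ^^ i) x)}" for i
  have "B = (\<Inter>i<n. (f ^^ i) -` (A i) \<inter> X) \<inter> X"
    unfolding x(2) itin_eq_iff A_def using iter_in by (auto simp del: INT_simps)
  moreover have "\<forall>i<n. A i \<in> P" using P(2) x(1) iter_in by (auto simp: A_def)
  ultimately show "B \<in> iter_join X f P n - {{}}" using x unfolding iter_join_def by blast
qed

lemma word_entropy_iter_join:
  assumes l: "borel_label l" and P: "\<And>A. A \<in> P \<Longrightarrow> A \<noteq> {} \<Longrightarrow> \<exists>x\<in>X. A = {y\<in>X. l y = l x}"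
    "\<And>x. x \<in> X \<Longrightarrow> {y\<in>X. l y = l x} \<in> P"
  shows "(\<Sum>A\<in>iter_join X f P n. - eta0 (measure \<mu> A)) = word_entropy \<mu> l n"
proof -
  have fin: "finite (itin l n ` X)"
    by (rule finite_subset[OF _ finite_words_label[OF l, of n]]) (auto simp: itin_in_words)
  define cell where "cell w = {y\<in>X. itin l n y = w}" for w
  have eq: "iter_join X f P n - {{}} = cell ` (itin l n ` X)"
    using iter_join_cells[where l = l and P = P and n = n, OF P] by (simp add: cell_def image_image)
  have "finite (iter_join X f P n - {{}})" unfolding eq using fin by simp
  then have fj: "finite (iter_join X f P n)" by simp
  have "(\<Sum>A\<in>iter_join X f P n. - eta0 (measure \<mu> A)) = (\<Sum>A\<in>cell ` (itin l n ` X). - eta0 (measure \<mu> A))"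
    unfolding eq[symmetric] by (rule sum.mono_neutral_right[OF fj]) (auto simp: eta0_def)
  also have "\<dots> = (\<Sum>w\<in>itin l n ` X. - eta0 (measure \<mu> (cell w)))"
    by (subst sum.reindex) (auto simp: inj_on_def cell_def)
  also have "\<dots> = (\<Sum>w\<in>words (l ` X) n. - eta0 (measure \<mu> (cell w)))"
  proof (rule sum.mono_neutral_left[OF finite_words_label[OF l]])
    show "\<forall>w\<in>words (l ` X) n - itin l n ` X. - eta0 (measure \<mu> (cell w)) = 0"
    proof
      fix w assume "w \<in> words (l ` X) n - itin l n ` X"
      then have "cell w = {}" by (auto simp: cell_def)
      then show "- eta0 (measure \<mu> (cell w)) = 0" by (simp add: eta0_def)
    qed
  qed (auto simp: itin_in_words)
  finally show ?thesis by (simp add: word_entropy_def cell_def)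
qed

lemma partition_label:
  assumes P: "P \<in> fin_partitions X"
  obtains l :: "'a \<Rightarrow> 'a set" where "borel_label l" "l ` X \<subseteq> P" "\<And>x. x \<in> X \<Longrightarrow> x \<in> l x"
    "\<And>n \<mu>. (\<Sum>A\<in>iter_join X f P n. - eta0 (measure \<mu> A)) = word_entropy \<mu> l n"
proof -
  have P': "finite P" "P \<subseteq> sets (borel_on X)" "\<Union>P = X" "disjoint P" using P by (auto simp: fin_partitions_def)
  have "\<forall>x\<in>X. \<exists>A. A \<in> P \<and> x \<in> A" using P'(3) by blast
  then obtain l where l: "\<And>x. x \<in> X \<Longrightarrow> l x \<in> P" "\<And>x. x \<in> X \<Longrightarrow> x \<in> l x" by metis
  have cell: "{y\<in>X. l y = A} = A" if A: "A \<in> P" for A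
  proof -
    have "l y = A" if "y \<in> A" for y
    proof -
      have "y \<in> X" using that A P'(3) by blast
      then have "y \<in> l y \<inter> A" "l y \<in> P" using l that by auto
      then show ?thesis using P'(4) A unfolding disjoint_def by blast
    qed
    moreover have "y \<in> A" if "y \<in> X" "l y = A" for y using l(2)[OF that(1)] that(2) by simp
    ultimately show ?thesis using A P'(3) by blast
  qed
  have bl: "borel_label l" unfolding borel_label_def
  proof (intro conjI allI)
    show "finite (l ` X)" by (rule finite_subset[OF _ P'(1)]) (auto simp: l)
    fix A
    show "{x\<in>X. l x = A} \<in> sets (borel_on X)"
    proof (cases "A \<in> P")
      case True
      then show ?thesis using cell P'(2) by auto
    next
      case False
      then have "{x\<in>X. l x = A} = {}" using l(1) by auto
      then show ?thesis by (simp only: sets.empty_sets)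
    qed
  qed
  show ?thesis
  proof (rule that[OF bl _ l(2)])
    show "l ` X \<subseteq> P" using l by auto
    show "(\<Sum>A\<in>iter_join X f P n. - eta0 (measure \<mu> A)) = word_entropy \<mu> l n" for n \<mu>
    proof (rule word_entropy_iter_join[OF bl])
      fix A assume A: "A \<in> P" "A \<noteq> {}"
      then obtain x where x: "x \<in> A" by auto
      then have "x \<in> X" using A P'(3) by blast
      moreover have "l x = A" using cell[OF A(1)] x by blast
      ultimately show "\<exists>x\<in>X. A = {y\<in>X. l y = l x}" using cell[OF A(1)] by blast
    next
      fix x assume "x \<in> X"
      then show "{y\<in>X. l y = l x} \<in> P" using cell[OF l(1)] l(1) by simp
    qed
  qed
qed

lemma part_entropy_rate_lim:
  assumes \<mu>: "\<mu> \<in> invariant_probs X f" and P: "P \<in> fin_partitions X"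
  obtains l :: "'a \<Rightarrow> 'a set" where "borel_label l" "l ` X \<subseteq> P" "\<And>x. x \<in> X \<Longrightarrow> x \<in> l x"
    "(\<lambda>n. word_entropy \<mu> l n / n) \<longlonglongrightarrow> part_entropy_rate X f \<mu> P"
proof -
  obtain l :: "'a \<Rightarrow> 'a set" where l: "borel_label l" "l ` X \<subseteq> P" "\<And>x. x \<in> X \<Longrightarrow> x \<in> l x"
    "\<And>n \<mu>. (\<Sum>A\<in>iter_join X f P n. - eta0 (measure \<mu> A)) = word_entropy \<mu> l n"
    using partition_label[OF P] by metis
  have "(\<lambda>n. word_entropy \<mu> l n / n) \<longlonglongrightarrow> part_entropy_rate X f \<mu> P"
    unfolding part_entropy_rate_def l(4) using word_entropy_rate_convergent[OF \<mu> l(1)]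
    by (simp add: convergent_LIMSEQ_iff)
  with l show ?thesis by (intro that[of l])
qed

lemma label_rate_le_ks_entropy:
  assumes \<mu>: "\<mu> \<in> invariant_probs X f" and l: "borel_label l"
    and b: "\<And>k. 0 < k \<Longrightarrow> b \<le> word_entropy \<mu> l k / k"
  shows "ereal b \<le> ks_entropy X f \<mu>"
proof -
  define P where "P = (\<lambda>v. {x\<in>X. l x = v}) ` (l ` X)"
  have P: "P \<in> fin_partitions X" using l
    by (auto simp: fin_partitions_def P_def borel_label_def disjoint_def)
  have "(\<lambda>n. word_entropy \<mu> l n / n) \<longlonglongrightarrow> part_entropy_rate X f \<mu> P"
  proof -
    have "(\<Sum>A\<in>iter_join X f P n. - eta0 (measure \<mu> A)) = word_entropy \<mu> l n" for n
      by (rule word_entropy_iter_join[OF l]) (auto simp: P_def)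
    then show ?thesis unfolding part_entropy_rate_def
      using word_entropy_rate_convergent[OF \<mu> l] by (simp add: convergent_LIMSEQ_iff)
  qed
  then have "b \<le> part_entropy_rate X f \<mu> P"
    by (rule tendsto_lowerbound) (use b in \<open>auto intro!: eventually_sequentiallyI[of 1]\<close>)
  then show ?thesis unfolding ks_entropy_def by (intro SUP_upper2[OF P]) simp
qed

end

section \<open>Upper bound\<close>

lemma closed_metric_sphere: "closed (sphere (t :: 'a::metric_space) r)"
proof -
  have "sphere t r = cball t r - ball t r" by auto
  then show ?thesis by (simp add: closed_Diff)
qed

context compact_system begin

section \<open>Labels with null boundaries\<close>

text \<open>The distribution of the distance to \<open>t\<close> has only countably many atoms,
  while an open interval is uncountable.\<close>

lemma null_sphere_radius:
  assumes \<mu>: "\<mu> \<in> probs X" and ab: "a < b"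
  obtains r where "a < r" "r < b" "measure \<mu> {x\<in>X. dist t x = r} = 0"
proof -
  interpret prob_space \<mu> by (rule probsD[OF \<mu>])
  have "(\<lambda>x. dist t x) \<in> borel_measurable (borel_on X)"
    by (intro continuous_measurable_borel_on continuous_intros)
  then have m: "(\<lambda>x. dist t x) \<in> borel_measurable \<mu>" by (simp add: probsD[OF \<mu>] cong: measurable_cong_sets)
  interpret D: prob_space "distr \<mu> borel (\<lambda>x. dist t x)" by (rule prob_space_distr[OF m])
  have "countable {r. measure (distr \<mu> borel (\<lambda>x. dist t x)) {r} \<noteq> 0}" by (rule D.countable_support)
  then have "\<not> {a<..<b} \<subseteq> {r. measure (distr \<mu> borel (\<lambda>x. dist t x)) {r} \<noteq> 0}"
    using uncountable_open_interval[of a b] ab countable_subset by blast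
  then obtain r where r: "a < r" "r < b" "measure (distr \<mu> borel (\<lambda>x. dist t x)) {r} = 0" by auto
  moreover have "measure (distr \<mu> borel (\<lambda>x. dist t x)) {r} = measure \<mu> {x\<in>X. dist t x = r}"
  proof -
    have "(\<lambda>x. dist t x) -` {r} \<inter> space \<mu> = {x\<in>X. dist t x = r}" by (auto simp: probsD[OF \<mu>])
    then show ?thesis using measure_distr[OF m, of "{r}"] by simp
  qed
  ultimately show ?thesis using that by simp
qed

text \<open>A finite cover by balls of radius below e / 2 is made disjoint by labelling a point with
  the first ball that contains it. The radii are chosen so that all bounding spheres are null, and
  \<open>D\<close> is the part of these spheres lying in X.\<close>

lemma small_label:
  assumes \<mu>: "\<mu> \<in> probs X" and e: "0 < e"
  obtains l :: "'a \<Rightarrow> nat" and D where "borel_label l"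
    "\<And>x y. x \<in> X \<Longrightarrow> y \<in> X \<Longrightarrow> l x = l y \<Longrightarrow> dist x y \<le> e"
    "closedin (top_of_set X) D" "measure \<mu> D = 0"
    "\<And>v. closedin (top_of_set X) ({x\<in>X. l x = v} \<union> D)"
    "\<And>v. closedin (top_of_set X) ({x\<in>X. l x \<noteq> v} \<union> D)"
proof -
  interpret prob_space \<mu> by (rule probsD[OF \<mu>])
  have "\<exists>r. e / 4 < r \<and> r < e / 2 \<and> measure \<mu> {x\<in>X. dist t x = r} = 0" for t
    using null_sphere_radius[OF \<mu>, of "e/4" "e/2" t] e by auto
  then obtain r where r: "\<And>t. e / 4 < r t" "\<And>t. r t < e / 2" "\<And>t. measure \<mu> {x\<in>X. dist t x = r t} = 0" by metis
  have rpos: "0 < r t" for t using r(1)[of t] e by linarith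
  have cover: "X \<subseteq> (\<Union>t\<in>X. ball t (r t))"
  proof
    fix x assume "x \<in> X"
    then show "x \<in> (\<Union>t\<in>X. ball t (r t))" using rpos by (intro UN_I[of x]) simp_all
  qed
  obtain T where T: "T \<subseteq> X" "finite T" "X \<subseteq> (\<Union>t\<in>T. ball t (r t))"
    by (rule compactE_image[OF compact _ cover]) auto
  obtain ts where ts: "set ts = T" using T(2) finite_list by blast
  define n where "n = length ts"
  define U where "U i = ball (ts ! i) (r (ts ! i))" for i
  define K where "K i = cball (ts ! i) (r (ts ! i))" for i
  define Sp where "Sp = (\<Union>i<n. sphere (ts ! i) (r (ts ! i)))"
  define l where "l x = (LEAST i. i < n \<and> x \<in> U i)" for x
  have cov: "\<exists>i. i < n \<and> x \<in> U i" if "x \<in> X" for x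
  proof -
    from that T(3) obtain t where "t \<in> set ts" "x \<in> ball t (r t)" unfolding ts by blast
    then show ?thesis by (auto simp: in_set_conv_nth U_def n_def)
  qed
  have l: "l x < n" "x \<in> U (l x)" if "x \<in> X" for x
    using LeastI_ex[OF cov[OF that]] by (auto simp: l_def)
  have lmin: "x \<notin> U j" if "x \<in> X" "j < l x" for x j
    using not_less_Least[of j "\<lambda>i. i < n \<and> x \<in> U i"] that l(1)[OF that(1)] by (auto simp: l_def)
  have leq: "l x = i" if "i < n" "x \<in> U i" "\<And>j. j < i \<Longrightarrow> x \<notin> U j" for x i
    unfolding l_def using that by (intro Least_equality) (auto simp: not_less[symmetric])
  have fiber: "{x\<in>X. l x = v} = (if v < n then (U v - (\<Union>j<v. U j)) \<inter> X else {})" for v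
    using l lmin leq by auto
  have bl: "borel_label l" unfolding borel_label_def
  proof (intro conjI allI)
    show "finite (l ` X)" by (rule finite_subset[of _ "{..<n}"]) (auto simp: l)
    fix v
    have "(U v - (\<Union>j<v. U j)) \<in> sets borel" unfolding U_def by (intro sets.Diff sets.finite_UN) auto
    then show "{x\<in>X. l x = v} \<in> sets (borel_on X)" unfolding fiber borel_on_iff by (cases "v < n") auto
  qed
  \<comment> \<open>Off the spheres, open and closed balls have the same points, so the open set
    \<open>O1 i\<close> agrees with the label class i outside \<open>D\<close>; both closedness
    claims follow by taking complements in X.\<close>
  define O1 where "O1 i = U i \<inter> (\<Inter>j<i. - K j) \<inter> - Sp" for i
  have "closed Sp" unfolding Sp_def by (intro closed_UN closed_metric_sphere ballI) simp
  then have Oo: "open (O1 i)" for i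
    unfolding O1_def U_def K_def by (intro open_Int open_INT) auto
  have Ol: "l x = i" if "x \<in> O1 i" "i < n" for x i
  proof (rule leq)
    have "U j \<subseteq> K j" for j by (auto simp: U_def K_def)
    then show "x \<notin> U j" if "j < i" for j using that \<open>x \<in> O1 i\<close> unfolding O1_def by blast
  qed (use that in \<open>auto simp: O1_def\<close>)
  have lO: "x \<in> O1 (l x)" if x: "x \<in> X" "x \<notin> Sp" for x
  proof -
    have "x \<notin> K j" if "j < l x" for j
    proof -
      have "j < n" using that l(1)[OF x(1)] by simp
      then have "x \<notin> sphere (ts ! j) (r (ts ! j))" using x(2) by (auto simp: Sp_def)
      then show ?thesis using lmin[OF x(1) that] by (auto simp: K_def U_def)
    qed
    then show ?thesis using l(2)[OF x(1)] x(2) by (auto simp: O1_def)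
  qed
  have key: "x \<in> O1 i \<longleftrightarrow> x \<notin> Sp \<and> l x = i" if "x \<in> X" "i < n" for x i
  proof
    assume "x \<in> O1 i"
    then show "x \<notin> Sp \<and> l x = i" using Ol[of x i] that by (simp add: O1_def)
  qed (use lO[OF that(1)] in auto)
  define D where "D = X \<inter> Sp"
  have cl: "closedin (top_of_set X) D" unfolding D_def using \<open>closed Sp\<close> by (intro closedin_closed_Int)
  have compl_open: "closedin (top_of_set X) (X - W)" if "open W" for W
  proof -
    have "X - W = X \<inter> - W" by auto
    then show ?thesis using that closedin_closed_Int[of "- W" X] by (simp add: closed_Compl)
  qed
  show ?thesis
  proof (rule that[OF bl _ cl])
    fix x y assume xy: "x \<in> X" "y \<in> X" "l x = l y"
    have "x \<in> U (l x)" "y \<in> U (l x)" using l(2)[OF xy(1)] l(2)[OF xy(2)] xy(3) by simp_all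
    then have "dist (ts ! l x) x < e / 2" "dist (ts ! l x) y < e / 2"
      using r(2)[of "ts ! l x"] by (auto simp: U_def)
    then show "dist x y \<le> e" using dist_triangle3[of x y "ts ! l x"] by linarith
  next
    have "measure \<mu> D \<le> measure \<mu> (\<Union>i<n. {x\<in>X. dist (ts ! i) x = r (ts ! i)})"
    proof (rule finite_measure_mono)
      show "D \<subseteq> (\<Union>i<n. {x\<in>X. dist (ts ! i) x = r (ts ! i)})" by (auto simp: D_def Sp_def)
      have "{x\<in>X. dist t x = r t} = X \<inter> sphere t (r t)" for t by auto
      then have "{x\<in>X. dist t x = r t} \<in> sets \<mu>" for t
        unfolding probsD[OF \<mu>] by (simp only:) (intro closedin_borel_on closedin_closed_Int closed_metric_sphere)
      then show "(\<Union>i<n. {x\<in>X. dist (ts ! i) x = r (ts ! i)}) \<in> sets \<mu>" by (intro sets.finite_UN) auto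
    qed
    also have "\<dots> \<le> (\<Sum>i<n. measure \<mu> {x\<in>X. dist (ts ! i) x = r (ts ! i)})"
    proof (rule finite_measure_subadditive_finite)
      have "{x\<in>X. dist t x = r t} = X \<inter> sphere t (r t)" for t by auto
      then have "{x\<in>X. dist t x = r t} \<in> sets \<mu>" for t
        unfolding probsD[OF \<mu>] by (simp only:) (intro closedin_borel_on closedin_closed_Int closed_metric_sphere)
      then show "(\<lambda>i. {x\<in>X. dist (ts ! i) x = r (ts ! i)}) ` {..<n} \<subseteq> sets \<mu>" by auto
    qed simp
    also have "\<dots> = 0" by (simp add: r(3))
    finally show "measure \<mu> D = 0" by (simp add: measure_le_0_iff)
  next
    fix v
    have "{x\<in>X. l x = v} \<union> D = X - (\<Union>i\<in>{..<n} - {v}. O1 i)"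
    proof (intro set_eqI iffI)
      fix x assume x: "x \<in> {x\<in>X. l x = v} \<union> D"
      then have xX: "x \<in> X" by (auto simp: D_def)
      then show "x \<in> X - (\<Union>i\<in>{..<n} - {v}. O1 i)" using x by (auto simp: D_def key[OF xX])
    next
      fix x assume x: "x \<in> X - (\<Union>i\<in>{..<n} - {v}. O1 i)"
      then have xX: "x \<in> X" by simp
      then show "x \<in> {x\<in>X. l x = v} \<union> D"
        using x l(1)[OF xX] key[OF xX l(1)[OF xX]] by (cases "l x = v") (auto simp: D_def)
    qed
    then show "closedin (top_of_set X) ({x\<in>X. l x = v} \<union> D)"
      using Oo by (auto intro!: compl_open)
    have "{x\<in>X. l x \<noteq> v} \<union> D = X - (if v < n then O1 v else {})"
    proof (intro set_eqI iffI)
      fix x assume x: "x \<in> {x\<in>X. l x \<noteq> v} \<union> D"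
      then have xX: "x \<in> X" by (auto simp: D_def)
      then show "x \<in> X - (if v < n then O1 v else {})" using x by (auto simp: D_def key[OF xX])
    next
      fix x assume x: "x \<in> X - (if v < n then O1 v else {})"
      then have xX: "x \<in> X" by simp
      then show "x \<in> {x\<in>X. l x \<noteq> v} \<union> D"
        using x l(1)[OF xX] key[OF xX l(1)[OF xX]] by (cases "l x = v") (auto simp: D_def)
    qed
    then show "closedin (top_of_set X) ({x\<in>X. l x \<noteq> v} \<union> D)"
      using Oo by (auto intro!: compl_open)
  qed
qed

lemma iter_preimage_closedin:
  "closedin (top_of_set X) C \<Longrightarrow> closedin (top_of_set X) ((f ^^ i) -` C \<inter> X)"
  using continuous_closedin_preimage_gen[OF iter_cont[of i], of X C] iter_in
  by (auto simp: Int_commute image_subset_iff)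

text \<open>An itinerary can jump only where one of the first k iterates meets \<open>D\<close>. By
  invariance of the limit measure the set of such points is null, so it serves as the boundary in
  \<open>wk_conv_null_boundary\<close>.\<close>

lemma word_measure_tendsto:
  assumes M: "\<And>n. M n \<in> probs X" and \<mu>: "\<mu> \<in> invariant_probs X f" and conv: "wk_conv X M \<mu>"
    and l: "borel_label l" and D: "closedin (top_of_set X) D" "measure \<mu> D = 0"
    "\<And>v. closedin (top_of_set X) ({x\<in>X. l x = v} \<union> D)"
    "\<And>v. closedin (top_of_set X) ({x\<in>X. l x \<noteq> v} \<union> D)"
    and w: "length w = k"
  shows "(\<lambda>n. measure (M n) {x\<in>X. itin l k x = w}) \<longlonglongrightarrow> measure \<mu> {x\<in>X. itin l k x = w}"
proof -
  have p: "\<mu> \<in> probs X" by (rule invariant_in_probs[OF \<mu>])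
  interpret prob_space \<mu> by (rule probsD[OF p])
  define E where "E = (\<Union>i<k. (f ^^ i) -` D \<inter> X)"
  have Ecl: "closedin (top_of_set X) E" unfolding E_def
    using iter_preimage_closedin[OF D(1)] by (intro closedin_Union) auto
  have Dm: "D \<in> sets (borel_on X)" by (rule closedin_borel_on[OF D(1)])
  have "measure \<mu> E \<le> (\<Sum>i<k. measure \<mu> ((f ^^ i) -` D \<inter> X))" unfolding E_def
    using iter_vimage_sets[OF Dm] by (intro finite_measure_subadditive_finite) (auto simp: probsD[OF p])
  also have "\<dots> = 0" by (simp add: invariant_measure_iter[OF \<mu> Dm] D(2))
  finally have E0: "measure \<mu> E = 0" by (simp add: measure_le_0_iff)
  define A where "A = {x\<in>X. itin l k x = w}"
  have Aeq: "A = {x\<in>X. \<forall>i<k. l ((f ^^ i) x) = w ! i}"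
    unfolding A_def using w by (auto simp: list_eq_iff_nth_eq itin_nth)
  have eq1: "A \<union> E = (X \<inter> (\<Inter>i\<in>{..<k}. (f ^^ i) -` ({x\<in>X. l x = w ! i} \<union> D) \<inter> X)) \<union> E"
  proof (intro equalityI subsetI)
    fix x assume x: "x \<in> A \<union> E"
    show "x \<in> (X \<inter> (\<Inter>i\<in>{..<k}. (f ^^ i) -` ({x\<in>X. l x = w ! i} \<union> D) \<inter> X)) \<union> E"
    proof (cases "x \<in> E")
      case False
      then have xX: "x \<in> X" and a: "\<And>i. i < k \<Longrightarrow> l ((f ^^ i) x) = w ! i" using x unfolding Aeq by auto
      have "(f ^^ i) x \<in> {x\<in>X. l x = w ! i} \<union> D" if "i < k" for i using a[OF that] iter_in[OF xX] by simp
      then show ?thesis using xX by (intro UnI1 IntI INT_I) auto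
    qed simp
  next
    fix x assume x: "x \<in> (X \<inter> (\<Inter>i\<in>{..<k}. (f ^^ i) -` ({x\<in>X. l x = w ! i} \<union> D) \<inter> X)) \<union> E"
    show "x \<in> A \<union> E"
    proof (rule ccontr)
      assume c: "x \<notin> A \<union> E"
      with x have xX: "x \<in> X" and a: "\<And>i. i < k \<Longrightarrow> (f ^^ i) x \<in> {x\<in>X. l x = w ! i} \<union> D" by blast+
      have "(f ^^ i) x \<notin> D" if "i < k" for i using c that xX by (auto simp: E_def)
      with a have "x \<in> A" unfolding Aeq using xX by blast
      with c show False by simp
    qed
  qed
  have c1: "closedin (top_of_set X) (X \<inter> (\<Inter>i\<in>{..<k}. (f ^^ i) -` ({x\<in>X. l x = w ! i} \<union> D) \<inter> X))"
  proof (cases "k = 0")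
    case True then show ?thesis by simp
  next
    case False
    have "closedin (top_of_set X) (\<Inter>i\<in>{..<k}. (f ^^ i) -` ({x\<in>X. l x = w ! i} \<union> D) \<inter> X)"
      using False by (intro closedin_INT iter_preimage_closedin D(3)) auto
    then show ?thesis by (intro closedin_Int) auto
  qed
  have cl1: "closedin (top_of_set X) (A \<union> E)" unfolding eq1 by (rule closedin_Un[OF c1 Ecl])
  have eq2: "(X - A) \<union> E = (\<Union>i\<in>{..<k}. (f ^^ i) -` ({x\<in>X. l x \<noteq> w ! i} \<union> D) \<inter> X) \<union> E"
  proof (intro equalityI subsetI)
    fix x assume x: "x \<in> (X - A) \<union> E"
    show "x \<in> (\<Union>i\<in>{..<k}. (f ^^ i) -` ({x\<in>X. l x \<noteq> w ! i} \<union> D) \<inter> X) \<union> E"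
    proof (cases "x \<in> E")
      case False
      then have xX: "x \<in> X" using x by auto
      obtain i where i: "i < k" "l ((f ^^ i) x) \<noteq> w ! i" using x False unfolding Aeq by auto
      then show ?thesis using xX iter_in[OF xX] by (intro UnI1 UN_I[of i]) auto
    qed simp
  next
    fix x assume "x \<in> (\<Union>i\<in>{..<k}. (f ^^ i) -` ({x\<in>X. l x \<noteq> w ! i} \<union> D) \<inter> X) \<union> E"
    then show "x \<in> (X - A) \<union> E" unfolding Aeq E_def by blast
  qed
  have c2: "closedin (top_of_set X) (\<Union>i\<in>{..<k}. (f ^^ i) -` ({x\<in>X. l x \<noteq> w ! i} \<union> D) \<inter> X)"
    using iter_preimage_closedin[OF D(4)] by (intro closedin_Union) auto
  have cl2: "closedin (top_of_set X) ((X - A) \<union> E)" unfolding eq2 by (rule closedin_Un[OF c2 Ecl])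
  show ?thesis unfolding A_def[symmetric]
    by (rule wk_conv_null_boundary[OF compact M p conv _ closedin_borel_on[OF Ecl] E0 cl1 cl2])
      (simp add: A_def itin_fiber_sets[OF l])
qed

section \<open>Separated sets and their partition sums\<close>

text \<open>The strict inequality is the exact negation of the one in \<open>bowen_ball\<close>, so
  maximal separated sets span at the same scale e.\<close>

definition separated :: "nat \<Rightarrow> real \<Rightarrow> 'a set \<Rightarrow> bool" where
  "separated n e E \<longleftrightarrow> (\<forall>x\<in>E. \<forall>y\<in>E. x \<noteq> y \<longrightarrow> (\<exists>j<n. e < dist ((f ^^ j) x) ((f ^^ j) y)))"

lemma separated_itin_inj:
  assumes E: "E \<subseteq> X" "separated n e E"
    and l: "\<And>x y. x \<in> X \<Longrightarrow> y \<in> X \<Longrightarrow> l x = l y \<Longrightarrow> dist x y \<le> e"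
  shows "inj_on (itin l n) E"
proof (rule inj_onI, rule ccontr)
  fix x y assume xy: "x \<in> E" "y \<in> E" "itin l n x = itin l n y" "x \<noteq> y"
  then obtain j where "j < n" "e < dist ((f ^^ j) x) ((f ^^ j) y)" using E(2) by (auto simp: separated_def)
  moreover have "dist ((f ^^ j) x) ((f ^^ j) y) \<le> e"
    using xy \<open>j < n\<close> E(1) by (intro l iter_in) (auto simp: itin_eq_iff)
  ultimately show False by simp
qed

text \<open>Labels with classes of diameter at most e tell separated points apart, so a separated
  set has at most as many points as there are words of length n. One of largest size exists, and it
  spans because no point can be added.\<close>

lemma maximal_separated:
  assumes m: "m \<in> probs X" and e: "0 < e" and S: "S \<subseteq> X"
  obtains E where "E \<subseteq> S" "finite E" "separated n e E"
    "\<And>x. x \<in> S \<Longrightarrow> \<exists>y\<in>E. \<forall>j<n. dist ((f ^^ j) y) ((f ^^ j) x) \<le> e"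
proof -
  obtain l :: "'a \<Rightarrow> nat" where l: "borel_label l"
    "\<And>x y. x \<in> X \<Longrightarrow> y \<in> X \<Longrightarrow> l x = l y \<Longrightarrow> dist x y \<le> e"
    using small_label[OF m e] by metis
  define N where "N = card (words (l ` X) n)"
  have bound: "finite E \<and> card E \<le> N" if "E \<subseteq> S" "separated n e E" for E
  proof -
    have inj: "inj_on (itin l n) E" using that S by (intro separated_itin_inj[OF _ _ l(2)]) auto
    have sub: "itin l n ` E \<subseteq> words (l ` X) n" using that S itin_in_words by blast
    have "finite (itin l n ` E)" by (rule finite_subset[OF sub finite_words_label[OF l(1)]])
    then have "finite E" using inj by (rule finite_imageD)
    moreover have "card E \<le> N" unfolding N_def
      by (rule card_inj_on_le[OF inj sub finite_words_label[OF l(1)]])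
    ultimately show ?thesis by simp
  qed
  define Q where "Q E \<longleftrightarrow> E \<subseteq> S \<and> separated n e E" for E
  have "Q {}" by (simp add: Q_def separated_def)
  then obtain E where E: "Q E" "\<And>E'. Q E' \<Longrightarrow> card E' \<le> card E"
    using ex_has_greatest_nat[of Q "{}" card "Suc N"] bound unfolding Q_def by (metis less_Suc_eq_le)
  have fin: "finite E" using bound E by (auto simp: Q_def)
  show ?thesis
  proof (rule that[of E])
    fix x assume x: "x \<in> S"
    show "\<exists>y\<in>E. \<forall>j<n. dist ((f ^^ j) y) ((f ^^ j) x) \<le> e"
    proof (rule ccontr)
      assume c: "\<not> ?thesis"
      then have s: "\<exists>j<n. e < dist ((f ^^ j) y) ((f ^^ j) x)" if "y \<in> E" for y using that by (auto simp: not_le)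
      have "Q (insert x E)" using E(1) x s unfolding Q_def separated_def by (auto simp: dist_commute)
      moreover have "x \<notin> E" using s[of x] e by auto
      ultimately show False using E(2)[of "insert x E"] fin by simp
    qed
  qed (use E fin in \<open>auto simp: Q_def\<close>)
qed

lemma bowen_ball_sets: "bowen_ball X f n x e \<in> sets (borel_on X)"
proof -
  have "bowen_ball X f n x e = {y\<in>space (borel_on X). \<forall>j\<in>{..<n}. y \<in> (f ^^ j) -` (X \<inter> cball ((f ^^ j) x) e) \<inter> X}"
    by (auto simp: bowen_ball_def iter_in)
  also have "\<dots> \<in> sets (borel_on X)"
  proof (rule sets.sets_Collect_finite_All)
    fix j
    have "{y\<in>space (borel_on X). y \<in> (f ^^ j) -` (X \<inter> cball ((f ^^ j) x) e) \<inter> X} = (f ^^ j) -` (X \<inter> cball ((f ^^ j) x) e) \<inter> X"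
      by auto
    moreover have "X \<inter> cball ((f ^^ j) x) e \<in> sets (borel_on X)"
      by (intro closedin_borel_on closedin_closed_Int) auto
    ultimately show "{y\<in>space (borel_on X). y \<in> (f ^^ j) -` (X \<inter> cball ((f ^^ j) x) e) \<inter> X} \<in> sets (borel_on X)"
      using iter_vimage_sets by (simp only:)
  qed simp
  finally show ?thesis .
qed

text \<open>The Birkhoff sum of g over n steps, left unnormalised as it enters the exponential
  weights.\<close>

definition bsum :: "('a \<Rightarrow> real) \<Rightarrow> nat \<Rightarrow> 'a \<Rightarrow> real" where
  "bsum g n x = (\<Sum>j<n. g ((f ^^ j) x))"

text \<open>The entropy estimate in Misiurewicz's argument. The weights p x, proportional to exp (-
  bsum \<phi> n x), have entropy exactly ln Z plus n times the integral of \<phi>. As itineraries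
  are injective on \<open>E\<close>, this entropy is also bounded by
  \<open>entropy_block_bound\<close>, with Q the word distribution of the orbit average
  \<mu>.\<close>

lemma separated_entropy_bound:
  assumes E: "finite E" "E \<noteq> {}" "E \<subseteq> X" "separated n e E" and k: "0 < k" "k \<le> n"
    and l: "borel_label l" "\<And>x y. x \<in> X \<Longrightarrow> y \<in> X \<Longrightarrow> l x = l y \<Longrightarrow> dist x y \<le> e"
    and Z: "Z = (\<Sum>x\<in>E. exp (- bsum \<phi> n x))" "exp (n * b) \<le> Z"
    and \<phi>: "\<phi> \<in> borel_measurable (borel_on X)"
    and \<mu>: "\<mu> \<in> probs X" "\<And>g::'a \<Rightarrow> real. g \<in> borel_measurable (borel_on X) \<Longrightarrow>
      integral\<^sup>L \<mu> g = (\<Sum>x\<in>E. exp (- bsum \<phi> n x) / Z * (bsum g n x / n))"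
  shows "k * (b + integral\<^sup>L \<mu> \<phi>) \<le> 2 * real k * real k * ln (card (l ` X)) / n + word_entropy \<mu> l k"
proof -
  interpret prob_space \<mu> by (rule probsD[OF \<mu>(1)])
  define p where "p x = exp (- bsum \<phi> n x) / Z" for x
  have Zpos: "0 < Z" using Z(2) by (rule less_le_trans[OF exp_gt_zero])
  have n: "0 < n" using k by simp
  have ppos: "0 < p x" for x using Zpos by (simp add: p_def)
  have psum: "sum p E = 1" using Zpos unfolding p_def sum_divide_distrib[symmetric] Z(1)[symmetric] by simp
  define Q where "Q w = measure \<mu> {x\<in>X. itin l k x = w}" for w
  have Q1: "Q w \<le> 1" "0 \<le> Q w" for w by (auto simp: Q_def)
  \<comment> \<open>Gibbs' inequality requires positive reference weights on all blocks that occur;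
    \<mu> gives each orbit point at time j < n weight at least p x / n.\<close>
  have Qpos: "0 < Q (itin l k ((f ^^ j) x))" if x: "x \<in> E" and j: "j < n" for x j
  proof -
    define w where "w = itin l k ((f ^^ j) x)"
    have m: "{x\<in>X. itin l k x = w} \<in> sets (borel_on X)" by (rule itin_fiber_sets[OF l(1)])
    have "Q w = integral\<^sup>L \<mu> (indicat_real {x\<in>X. itin l k x = w})"
      using m by (simp add: Q_def probsD[OF \<mu>(1)] Int_absorb2)
    also have "\<dots> = (\<Sum>y\<in>E. p y * (bsum (indicat_real {x\<in>X. itin l k x = w}) n y / n))"
      unfolding p_def using m by (intro \<mu>(2)) simp
    also have "\<dots> \<ge> p x * (bsum (indicat_real {x\<in>X. itin l k x = w}) n x / n)"
      using x E(1) by (intro member_le_sum mult_nonneg_nonneg divide_nonneg_nonneg)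
        (auto simp: bsum_def less_imp_le[OF ppos] intro: sum_nonneg)
    moreover have "bsum (indicat_real {x\<in>X. itin l k x = w}) n x \<ge> indicat_real {x\<in>X. itin l k x = w} ((f ^^ j) x)"
      unfolding bsum_def using j by (intro member_le_sum) auto
    moreover have "indicat_real {x\<in>X. itin l k x = w} ((f ^^ j) x) = 1" using x E(3) by (auto simp: w_def iter_in)
    ultimately have "p x * (1 / n) \<le> Q w"
      using ppos[of x] by (smt (verit, best) divide_right_mono mult_left_mono of_nat_0_le_iff)
    then show ?thesis using ppos[of x] n unfolding w_def[symmetric]
      by (smt (verit, best) divide_pos_pos mult_pos_pos of_nat_0_less_iff zero_less_one)
  qed
  have "k * (\<Sum>x\<in>E. - eta0 (p x)) \<le> 2 * real k * real k * ln (card (l ` X))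
    + (\<Sum>x\<in>E. p x * (\<Sum>j<Suc n - k. - ln (Q (take k (drop j (itin l n x))))))"
  proof (rule entropy_block_bound[where V = "l ` X" and n = n])
    show "finite (l ` X)" "l ` X \<noteq> {}" using l(1) E(2,3) by (auto simp: borel_label_def)
    show "inj_on (itin l n) E" by (rule separated_itin_inj[OF E(3,4) l(2)])
    show "itin l n x \<in> words (l ` X) n" if "x \<in> E" for x using that E(3) itin_in_words by blast
    show "(\<Sum>v\<in>words (l ` X) k. Q v) \<le> 1" unfolding Q_def using sum_word_measures[OF \<mu>(1) l(1)] by simp
    show "0 < Q (take k (drop j (itin l n x)))" if "x \<in> E" "j + k \<le> n" for x j
      using Qpos[OF that(1), of j] that(2) k by (simp add: take_drop_itin)
  qed (use E ppos psum Q1 k in auto)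
  also have "(\<Sum>x\<in>E. p x * (\<Sum>j<Suc n - k. - ln (Q (take k (drop j (itin l n x))))))
     \<le> (\<Sum>x\<in>E. p x * (\<Sum>j<n. - ln (Q (itin l k ((f ^^ j) x)))))"
  proof (intro sum_mono mult_left_mono less_imp_le[OF ppos])
    fix x assume x: "x \<in> E"
    have "(\<Sum>j<Suc n - k. - ln (Q (take k (drop j (itin l n x))))) = (\<Sum>j<Suc n - k. - ln (Q (itin l k ((f ^^ j) x))))"
      by (intro sum.cong refl) (auto simp: take_drop_itin)
    \<comment> \<open>The last k - 1 positions are added because \<mu> integrates full Birkhoff sums
      over n steps; the added terms are nonnegative since Q is at most 1.\<close>
    also have "\<dots> \<le> (\<Sum>j<n. - ln (Q (itin l k ((f ^^ j) x))))"
      using k Q1 Qpos[OF x] by (intro sum_mono2) auto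
    finally show "(\<Sum>j<Suc n - k. - ln (Q (take k (drop j (itin l n x))))) \<le> (\<Sum>j<n. - ln (Q (itin l k ((f ^^ j) x))))" .
  qed
  also have "(\<Sum>x\<in>E. p x * (\<Sum>j<n. - ln (Q (itin l k ((f ^^ j) x))))) = n * word_entropy \<mu> l k"
  proof -
    have "integral\<^sup>L \<mu> (\<lambda>x. - ln (Q (itin l k x))) = (\<Sum>x\<in>E. p x * (bsum (\<lambda>x. - ln (Q (itin l k x))) n x / n))"
      unfolding p_def by (rule \<mu>(2)) (rule itin_borel_measurable[OF l(1), of "\<lambda>w. - ln (Q w)"])
    moreover have "integral\<^sup>L \<mu> (\<lambda>x. - ln (Q (itin l k x))) = word_entropy \<mu> l k"
      unfolding integral_itin[OF \<mu>(1) l(1), of "\<lambda>w. - ln (Q w)"]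
      by (simp add: word_entropy_def Q_def eta0_eq)
    ultimately have "n * word_entropy \<mu> l k = n * (\<Sum>x\<in>E. p x * (bsum (\<lambda>x. - ln (Q (itin l k x))) n x / n))" by simp
    also have "\<dots> = (\<Sum>x\<in>E. p x * (\<Sum>j<n. - ln (Q (itin l k ((f ^^ j) x)))))"
      using n unfolding sum_distrib_left[of "real n"] by (intro sum.cong refl) (simp add: bsum_def)
    finally show ?thesis by simp
  qed
  finally have 1: "k * (\<Sum>x\<in>E. - eta0 (p x)) \<le> 2 * real k * real k * ln (card (l ` X)) + n * word_entropy \<mu> l k" by simp
  have "(\<Sum>x\<in>E. - eta0 (p x)) = (\<Sum>x\<in>E. p x * ln Z + p x * bsum \<phi> n x)"
  proof (intro sum.cong refl)
    fix x
    have "ln (p x) = - bsum \<phi> n x - ln Z" using Zpos by (simp add: p_def ln_div)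
    then show "- eta0 (p x) = p x * ln Z + p x * bsum \<phi> n x"
      unfolding eta0_eq by (simp only:) (simp add: algebra_simps)
  qed
  also have "\<dots> = ln Z + n * integral\<^sup>L \<mu> \<phi>"
  proof -
    have "n * integral\<^sup>L \<mu> \<phi> = (\<Sum>x\<in>E. p x * bsum \<phi> n x)"
      unfolding \<mu>(2)[OF \<phi>] p_def[symmetric] sum_distrib_left using n by (intro sum.cong refl) simp
    then show ?thesis by (simp add: sum.distrib sum_distrib_right[symmetric] psum)
  qed
  finally have H: "(\<Sum>x\<in>E. - eta0 (p x)) = ln Z + n * integral\<^sup>L \<mu> \<phi>" .
  have "n * b \<le> ln Z" using Z(2) Zpos by (simp add: ln_ge_iff)
  then have "k * (n * b + n * integral\<^sup>L \<mu> \<phi>) \<le> k * (ln Z + n * integral\<^sup>L \<mu> \<phi>)"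
    by (intro mult_left_mono) auto
  also have "\<dots> \<le> 2 * real k * real k * ln (card (l ` X)) + n * word_entropy \<mu> l k" using 1 H by simp
  finally have "n * (k * (b + integral\<^sup>L \<mu> \<phi>)) \<le> 2 * real k * real k * ln (card (l ` X)) + n * word_entropy \<mu> l k"
    by (simp add: algebra_simps)
  then have "k * (b + integral\<^sup>L \<mu> \<phi>) \<le> (2 * real k * real k * ln (card (l ` X)) + n * word_entropy \<mu> l k) / n"
    using n by (simp add: pos_le_divide_eq mult.commute)
  then show ?thesis using n by (simp add: add_divide_distrib)
qed

text \<open>
  Orbit segments with nearly equal visit frequencies to the cells of a fine partition have nearly
  equal Birkhoff averages, for all continuous functions at once. This makes the space of measures
  totally bounded in the form needed to pass from \<open>F\<close> to small, almost convex pieces.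
\<close>

lemma bsum_osc_pieces:
  fixes g :: "'a \<Rightarrow> real"
  assumes l: "borel_label l" "\<And>x y. x \<in> X \<Longrightarrow> y \<in> X \<Longrightarrow> l x = l y \<Longrightarrow> dist x y \<le> d" and n: "0 < n"
    and xy: "x \<in> X" "y \<in> X"
    and fr: "\<And>v. v \<in> l ` X \<Longrightarrow>
      \<bar>bsum (indicat_real {x\<in>X. l x = v}) n x / n - bsum (indicat_real {x\<in>X. l x = v}) n y / n\<bar> \<le> c / card (l ` X)"
    and g: "\<And>x. x \<in> X \<Longrightarrow> \<bar>g x\<bar> \<le> B" "\<And>x y. x \<in> X \<Longrightarrow> y \<in> X \<Longrightarrow> dist x y \<le> d \<Longrightarrow> \<bar>g x - g y\<bar> \<le> \<omega>"
  shows "\<bar>bsum g n x / n - bsum g n y / n\<bar> \<le> 2 * \<omega> + B * c"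
proof -
  define V where "V = l ` X"
  have V: "finite V" "V \<noteq> {}" using l(1) xy by (auto simp: borel_label_def V_def)
  define z where "z v = (SOME x. x \<in> X \<and> l x = v)" for v
  have z: "z v \<in> X" "l (z v) = v" if "v \<in> V" for v
    using someI_ex[of "\<lambda>x. x \<in> X \<and> l x = v"] that by (auto simp: z_def V_def)
  define fr where "fr v x = bsum (indicat_real {x\<in>X. l x = v}) n x / n" for v x
  \<comment> \<open>With g replaced by its value at one representative of each cell, the Birkhoff
    average depends on the visit frequencies alone. This costs \<omega> at x and again at y; the
    frequencies cost B * (c / card V) for each of the card V cells.\<close>
  define G where "G x = (\<Sum>v\<in>V. g (z v) * fr v x)" for x
  have close: "\<bar>bsum g n x / n - G x\<bar> \<le> \<omega>" if x: "x \<in> X" for x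
  proof -
    have "n * G x = (\<Sum>v\<in>V. g (z v) * bsum (indicat_real {x\<in>X. l x = v}) n x)"
      unfolding G_def fr_def sum_distrib_left using n by (intro sum.cong) auto
    also have "\<dots> = (\<Sum>j<n. \<Sum>v\<in>V. g (z v) * indicat_real {x\<in>X. l x = v} ((f ^^ j) x))"
      unfolding bsum_def sum_distrib_left by (rule sum.swap)
    also have "\<dots> = (\<Sum>j<n. g (z (l ((f ^^ j) x))))"
    proof (intro sum.cong refl)
      fix j
      have "(\<Sum>v\<in>V. g (z v) * indicat_real {x\<in>X. l x = v} ((f ^^ j) x)) = (\<Sum>v\<in>V. if v = l ((f ^^ j) x) then g (z v) else 0)"
        using iter_in[OF x] by (intro sum.cong) (auto simp: indicator_def)
      then show "(\<Sum>v\<in>V. g (z v) * indicat_real {x\<in>X. l x = v} ((f ^^ j) x)) = g (z (l ((f ^^ j) x)))"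
        using V(1) iter_in[OF x] by (simp add: V_def)
    qed
    finally have eq: "n * G x = (\<Sum>j<n. g (z (l ((f ^^ j) x))))" .
    have "\<bar>bsum g n x - n * G x\<bar> \<le> (\<Sum>j<n. \<bar>g ((f ^^ j) x) - g (z (l ((f ^^ j) x)))\<bar>)"
      unfolding eq bsum_def sum_subtractf[symmetric] by (rule sum_abs)
    also have "\<dots> \<le> (\<Sum>j<n. \<omega>)"
    proof (rule sum_mono)
      fix j
      have i: "(f ^^ j) x \<in> X" by (rule iter_in[OF x])
      then have "l ((f ^^ j) x) \<in> V" by (simp add: V_def)
      from z[OF this] i show "\<bar>g ((f ^^ j) x) - g (z (l ((f ^^ j) x)))\<bar> \<le> \<omega>"
        by (intro g(2) l(2)) auto
    qed
    finally have "\<bar>bsum g n x - n * G x\<bar> \<le> n * \<omega>" by simp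
    moreover have "bsum g n x / n - G x = (bsum g n x - n * G x) / n" using n by (simp add: field_simps)
    ultimately show ?thesis using n by (simp add: abs_divide pos_divide_le_eq mult.commute)
  qed
  have "\<bar>G x - G y\<bar> \<le> (\<Sum>v\<in>V. \<bar>g (z v) * fr v x - g (z v) * fr v y\<bar>)"
    unfolding G_def sum_subtractf[symmetric] by (rule sum_abs)
  also have "\<dots> \<le> (\<Sum>v\<in>V. B * (c / card V))"
  proof (rule sum_mono)
    fix v assume v: "v \<in> V"
    have "\<bar>g (z v) * fr v x - g (z v) * fr v y\<bar> = \<bar>g (z v)\<bar> * \<bar>fr v x - fr v y\<bar>"
      by (simp add: abs_mult[symmetric] right_diff_distrib)
    also have "\<dots> \<le> B * (c / card V)"
    proof (rule mult_mono)
      show "\<bar>g (z v)\<bar> \<le> B" using z[OF v] g(1) by auto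
      then show "0 \<le> B" by linarith
      show "\<bar>fr v x - fr v y\<bar> \<le> c / card V"
        using assms(6) v unfolding fr_def V_def by auto
    qed simp
    finally show "\<bar>g (z v) * fr v x - g (z v) * fr v y\<bar> \<le> B * (c / card V)" .
  qed
  also have "\<dots> = B * c" using V by simp
  finally show ?thesis using close[OF xy(1)] close[OF xy(2)] by linarith
qed

section \<open>Splitting the event and extracting a limit measure\<close>

text \<open>Points are classed by their visit frequencies rounded to a grid. The number of classes
  is independent of n, hence at most exp (n * \<delta>) for large n; another factor exp (n *
  \<delta>) is lost in the volume bound for Bowen balls, whence b - 2 * \<delta>. If all classes had
  smaller partition sums, the balls around their maximal separated sets could not carry the measure
  of the event.\<close>

lemma separated_pieces:
  fixes b \<delta> e :: real
  assumes m: "m \<in> probs X" and e: "0 < e" and \<delta>: "0 < \<delta>"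
    and freq: "\<exists>\<^sub>F n in sequentially. exp (n * b) < measure m {x\<in>X. P n x}"
    and balls: "\<forall>\<^sub>F n in sequentially. \<forall>x\<in>X. measure m (bowen_ball X f n x e) \<le> exp (- bsum \<phi> n x + n * \<delta>)"
  shows "\<exists>n E. k < n \<and> finite E \<and> E \<noteq> {} \<and> E \<subseteq> {x\<in>X. P n x} \<and> separated n e E
    \<and> exp (n * (b - 2 * \<delta>)) \<le> (\<Sum>x\<in>E. exp (- bsum \<phi> n x)) \<and>
    (\<forall>(g::'a \<Rightarrow> real) B \<omega> x y. (\<forall>x. x \<in> X \<longrightarrow> \<bar>g x\<bar> \<le> B) \<longrightarrow>
      (\<forall>x y. x \<in> X \<longrightarrow> y \<in> X \<longrightarrow> dist x y \<le> 1 / Suc k \<longrightarrow> \<bar>g x - g y\<bar> \<le> \<omega>) \<longrightarrow> x \<in> E \<longrightarrow> y \<in> E \<longrightarrow>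
      \<bar>bsum g n x / n - bsum g n y / n\<bar> \<le> 2 * \<omega> + B / Suc k)"
proof -
  interpret prob_space m by (rule probsD[OF m])
  have d0: "0 < 1 / real (Suc k)" by simp
  obtain l :: "'a \<Rightarrow> nat" where l: "borel_label l"
    "\<And>x y. x \<in> X \<Longrightarrow> y \<in> X \<Longrightarrow> l x = l y \<Longrightarrow> dist x y \<le> 1 / Suc k"
    using small_label[OF m d0] by metis
  define V where "V = l ` X"
  have V: "finite V" "V \<noteq> {}" using l(1) not_empty probsD(2)[OF m] by (auto simp: borel_label_def V_def)
  then have cV: "0 < card V" by (simp add: card_gt_0_iff)
  \<comment> \<open>A grid of width 1 / L makes the frequencies within one class agree up to 1 / (k
    + 1) / card V, which is the hypothesis of \<open>bsum_osc_pieces\<close> with c = 1 / (k +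
    1).\<close>
  define L where "L = Suc k * card V"
  have L: "0 < L" using cV by (simp add: L_def)
  define fr where "fr n v x = bsum (indicat_real {x\<in>X. l x = v}) n x / n" for n v x
  define cl where "cl n x = (\<lambda>v\<in>V. nat \<lfloor>L * fr n v x\<rfloor>)" for n x
  define T where "T = V \<rightarrow>\<^sub>E {..L}"
  have T: "finite T" using V by (simp add: T_def finite_PiE)
  have fr1: "0 \<le> fr n v x" "fr n v x \<le> 1" for n v x
  proof -
    have "bsum (indicat_real {x\<in>X. l x = v}) n x \<le> (\<Sum>j<n. 1)"
      unfolding bsum_def by (rule sum_mono) (simp add: indicator_def)
    then show "fr n v x \<le> 1" unfolding fr_def by (cases "n = 0") (auto simp: field_simps)
    show "0 \<le> fr n v x" unfolding fr_def bsum_def by (intro divide_nonneg_nonneg sum_nonneg) auto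
  qed
  have clT: "cl n x \<in> T" for n x
  proof -
    have "nat \<lfloor>L * fr n v x\<rfloor> \<le> L" for v
    proof -
      have "L * fr n v x \<le> L" using fr1(2)[of n v x] by (simp add: mult_left_le)
      then have "\<lfloor>L * fr n v x\<rfloor> \<le> int L" by linarith
      then show ?thesis by linarith
    qed
    then show ?thesis by (auto simp: T_def cl_def)
  qed
  define J where "J = real (card T)"
  have "0 < card T" using clT T by (auto simp: card_gt_0_iff)
  then have J: "1 \<le> J" by (simp add: J_def)
  have "\<forall>\<^sub>F n in sequentially. nat \<lceil>ln J / \<delta>\<rceil> \<le> n \<and> k < n"
    by (intro eventually_conj eventually_ge_at_top eventually_gt_at_top)
  with balls have "\<forall>\<^sub>F n in sequentially. (\<forall>x\<in>X. measure m (bowen_ball X f n x e) \<le> exp (- bsum \<phi> n x + n * \<delta>))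
     \<and> nat \<lceil>ln J / \<delta>\<rceil> \<le> n \<and> k < n" by (rule eventually_conj)
  from frequently_eventually_conj[OF freq this] obtain n where
    n: "exp (n * b) < measure m {x\<in>X. P n x}" "nat \<lceil>ln J / \<delta>\<rceil> \<le> n" "k < n"
    and ball: "\<And>x. x \<in> X \<Longrightarrow> measure m (bowen_ball X f n x e) \<le> exp (- bsum \<phi> n x + n * \<delta>)"
    using frequently_ex by blast
  have Jn: "J \<le> exp (n * \<delta>)"
  proof -
    have "ln J / \<delta> \<le> n" using n(2) by linarith
    then have "ln J \<le> n * \<delta>" using \<delta> by (simp add: pos_divide_le_eq)
    then have "exp (ln J) \<le> exp (n * \<delta>)" by simp
    then show ?thesis using J by simp
  qed
  define R where "R c E \<longleftrightarrow> E \<subseteq> {x\<in>X. P n x \<and> cl n x = c} \<and> finite E \<and> separated n e E \<and>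
    (\<forall>x. x \<in> {x\<in>X. P n x \<and> cl n x = c} \<longrightarrow> (\<exists>y\<in>E. \<forall>j<n. dist ((f ^^ j) y) ((f ^^ j) x) \<le> e))" for c E
  have "\<exists>E. R c E" for c
  proof -
    have sub: "{x\<in>X. P n x \<and> cl n x = c} \<subseteq> X" by auto
    obtain E where E: "E \<subseteq> {x\<in>X. P n x \<and> cl n x = c}" "finite E" "separated n e E"
      "\<And>x. x \<in> {x\<in>X. P n x \<and> cl n x = c} \<Longrightarrow> \<exists>y\<in>E. \<forall>j<n. dist ((f ^^ j) y) ((f ^^ j) x) \<le> e"
      by (rule maximal_separated[OF m e sub, of n]) (rule that)
    show ?thesis unfolding R_def by (intro exI[of _ E] conjI allI impI E)
  qed
  then obtain E where E: "\<And>c. R c (E c)" by metis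
  have EX: "E c \<subseteq> {x\<in>X. P n x \<and> cl n x = c}" and Efin: "finite (E c)" and Esep: "separated n e (E c)" for c
    using E[of c] by (auto simp: R_def)
  have "\<exists>c\<in>T. exp (n * (b - 2 * \<delta>)) \<le> (\<Sum>x\<in>E c. exp (- bsum \<phi> n x))"
  proof (rule ccontr)
    assume "\<not> ?thesis"
    then have lt: "(\<Sum>x\<in>E c. exp (- bsum \<phi> n x)) \<le> exp (n * (b - 2 * \<delta>))" if "c \<in> T" for c
      using that by force
    have ms: "bowen_ball X f n x e \<in> sets m" for x using bowen_ball_sets probsD(3)[OF m] by simp
    have "measure m {x\<in>X. P n x} \<le> measure m (\<Union>c\<in>T. \<Union>y\<in>E c. bowen_ball X f n y e)"
    proof (rule finite_measure_mono)
      show "{x\<in>X. P n x} \<subseteq> (\<Union>c\<in>T. \<Union>y\<in>E c. bowen_ball X f n y e)"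
      proof
        fix x assume x: "x \<in> {x\<in>X. P n x}"
        then obtain y where "y \<in> E (cl n x)" "\<forall>j<n. dist ((f ^^ j) y) ((f ^^ j) x) \<le> e"
          using E[of "cl n x"] unfolding R_def by blast
        then show "x \<in> (\<Union>c\<in>T. \<Union>y\<in>E c. bowen_ball X f n y e)"
          using x clT by (auto simp: bowen_ball_def)
      qed
      show "(\<Union>c\<in>T. \<Union>y\<in>E c. bowen_ball X f n y e) \<in> sets m"
        using T Efin ms by (intro sets.finite_UN) auto
    qed
    also have "\<dots> \<le> (\<Sum>c\<in>T. measure m (\<Union>y\<in>E c. bowen_ball X f n y e))"
      using T Efin ms by (intro finite_measure_subadditive_finite) (auto intro!: sets.finite_UN)
    also have "\<dots> \<le> (\<Sum>c\<in>T. \<Sum>y\<in>E c. measure m (bowen_ball X f n y e))"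
      using Efin ms by (intro sum_mono finite_measure_subadditive_finite) auto
    also have "\<dots> \<le> (\<Sum>c\<in>T. \<Sum>y\<in>E c. exp (- bsum \<phi> n y + n * \<delta>))"
      using EX by (intro sum_mono ball) auto
    also have "\<dots> = (\<Sum>c\<in>T. exp (n * \<delta>) * (\<Sum>y\<in>E c. exp (- bsum \<phi> n y)))"
      by (simp only: sum_distrib_left exp_add mult.commute)
    also have "\<dots> \<le> (\<Sum>c\<in>T. exp (n * \<delta>) * exp (n * (b - 2 * \<delta>)))"
      using lt by (intro sum_mono mult_left_mono) auto
    also have "\<dots> = J * exp (n * \<delta>) * exp (n * (b - 2 * \<delta>))" by (simp add: J_def)
    also have "\<dots> \<le> exp (n * \<delta>) * exp (n * \<delta>) * exp (n * (b - 2 * \<delta>))"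
      using Jn by (intro mult_right_mono) auto
    also have "\<dots> = exp (n * b)" by (simp add: exp_add[symmetric] algebra_simps)
    finally show False using n(1) by simp
  qed
  then obtain c where c: "c \<in> T" "exp (n * (b - 2 * \<delta>)) \<le> (\<Sum>x\<in>E c. exp (- bsum \<phi> n x))" by blast
  have "0 < (\<Sum>x\<in>E c. exp (- bsum \<phi> n x))" by (rule less_le_trans[OF exp_gt_zero c(2)])
  then have "E c \<noteq> {}" by auto
  show ?thesis
  proof (intro exI[of _ n] exI[of _ "E c"] conjI allI impI n(3) Efin \<open>E c \<noteq> {}\<close> Esep c(2))
    show "E c \<subseteq> {x\<in>X. P n x}" using EX by auto
    fix g :: "'a \<Rightarrow> real" and B \<omega> x y
    assume g: "\<forall>x. x \<in> X \<longrightarrow> \<bar>g x\<bar> \<le> B"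
      "\<forall>x y. x \<in> X \<longrightarrow> y \<in> X \<longrightarrow> dist x y \<le> 1 / Suc k \<longrightarrow> \<bar>g x - g y\<bar> \<le> \<omega>" and xy: "x \<in> E c" "y \<in> E c"
    have xyX: "x \<in> X" "y \<in> X" "cl n x = cl n y" using xy EX by auto
    have "\<bar>bsum g n x / n - bsum g n y / n\<bar> \<le> 2 * \<omega> + B * (1 / Suc k)"
    proof (rule bsum_osc_pieces[OF l _ xyX(1,2) _ g[rule_format]])
      show "0 < n" using n(3) by simp
      fix v assume v: "v \<in> l ` X"
      have "nat \<lfloor>L * fr n v x\<rfloor> = nat \<lfloor>L * fr n v y\<rfloor>"
        using fun_cong[OF xyX(3), of v] v by (simp add: cl_def V_def)
      moreover have "0 \<le> L * fr n v x" "0 \<le> L * fr n v y" using fr1 by auto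
      ultimately have "\<lfloor>L * fr n v x\<rfloor> = \<lfloor>L * fr n v y\<rfloor>" by (metis nat_eq_iff zero_le_floor int_nat_eq)
      then have "\<bar>L * fr n v x - L * fr n v y\<bar> \<le> 1" by linarith
      then have "L * \<bar>fr n v x - fr n v y\<bar> \<le> 1" by (simp add: right_diff_distrib[symmetric] abs_mult)
      then have "\<bar>fr n v x - fr n v y\<bar> \<le> 1 / L" using L by (simp add: pos_le_divide_eq mult.commute)
      then show "\<bar>bsum (indicat_real {x\<in>X. l x = v}) n x / n - bsum (indicat_real {x\<in>X. l x = v}) n y / n\<bar>
        \<le> 1 / Suc k / card (l ` X)"
        unfolding fr_def L_def V_def by (simp only: of_nat_mult divide_divide_eq_left)
    qed auto
    then show "\<bar>bsum g n x / n - bsum g n y / n\<bar> \<le> 2 * \<omega> + B / Suc k" by simp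
  qed
qed

text \<open>The event is assumed large only for infinitely many n, which is what a violated bound on
  the upper limit provides. It still allows times n k > k for every k, so errors of order 1 / n k
  vanish in the limit.\<close>

lemma free_energy_upper:
  fixes b \<delta> e :: real
  assumes m: "m \<in> probs X" and e: "0 < e" and \<delta>: "0 < \<delta>" and \<phi>: "continuous_on X \<phi>"
    and F: "wk_closed X F"
    and freq: "\<exists>\<^sub>F n in sequentially. exp (n * b) < measure m {x\<in>X. empirical X f n x \<in> F}"
    and balls: "\<forall>\<^sub>F n in sequentially. \<forall>x\<in>X. measure m (bowen_ball X f n x e) \<le> exp (- bsum \<phi> n x + n * \<delta>)"
  shows "\<exists>\<mu>\<in>F. ereal (b - 2 * \<delta>) \<le> free_energy X f \<phi> \<mu>"
proof -
  have \<phi>m: "\<phi> \<in> borel_measurable (borel_on X)" by (rule continuous_measurable_borel_on[OF \<phi>])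
  define G where "G k n E \<longleftrightarrow> k < n \<and> finite E \<and> E \<noteq> {} \<and> E \<subseteq> {x\<in>X. empirical X f n x \<in> F} \<and> separated n e E
    \<and> exp (n * (b - 2 * \<delta>)) \<le> (\<Sum>x\<in>E. exp (- bsum \<phi> n x)) \<and>
    (\<forall>(g::'a \<Rightarrow> real) B \<omega> x y. (\<forall>x. x \<in> X \<longrightarrow> \<bar>g x\<bar> \<le> B) \<longrightarrow>
      (\<forall>x y. x \<in> X \<longrightarrow> y \<in> X \<longrightarrow> dist x y \<le> 1 / Suc k \<longrightarrow> \<bar>g x - g y\<bar> \<le> \<omega>) \<longrightarrow> x \<in> E \<longrightarrow> y \<in> E \<longrightarrow>
      \<bar>bsum g n x / n - bsum g n y / n\<bar> \<le> 2 * \<omega> + B / Suc k)" for k n E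
  have "\<exists>n E. G k n E" for k
    unfolding G_def by (rule separated_pieces[OF m e \<delta> freq balls])
  then obtain n E where GE: "\<And>k. G k (n k) (E k)" by metis
  have nk: "k < n k" and Efin: "finite (E k)" and Ene: "E k \<noteq> {}" and EF: "E k \<subseteq> {x\<in>X. empirical X f (n k) x \<in> F}"
    and Esep: "separated (n k) e (E k)" and EZ: "exp (n k * (b - 2 * \<delta>)) \<le> (\<Sum>x\<in>E k. exp (- bsum \<phi> (n k) x))" for k
    using GE[of k] by (auto simp: G_def)
  have osc: "\<bar>bsum g (n k) x / n k - bsum g (n k) y / n k\<bar> \<le> 2 * \<omega> + B / Suc k"
    if "\<And>x. x \<in> X \<Longrightarrow> \<bar>g x\<bar> \<le> B" "\<And>x y. x \<in> X \<Longrightarrow> y \<in> X \<Longrightarrow> dist x y \<le> 1 / Suc k \<Longrightarrow> \<bar>g x - g y\<bar> \<le> \<omega>"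
      "x \<in> E k" "y \<in> E k" for g :: "'a \<Rightarrow> real" and B \<omega> x y k
    using GE[of k, unfolded G_def] that by blast
  have n0: "0 < n k" for k using nk[of k] by simp
  have EX: "x \<in> X" if "x \<in> E k" for x k using EF that by auto
  define Z where "Z k = (\<Sum>x\<in>E k. exp (- bsum \<phi> (n k) x))" for k
  define p where "p k x = exp (- bsum \<phi> (n k) x) / Z k" for k x
  have Zpos: "0 < Z k" for k unfolding Z_def by (rule less_le_trans[OF exp_gt_zero EZ])
  have psum: "sum (p k) (E k) = 1" for k
    using Zpos[of k] unfolding p_def sum_divide_distrib[symmetric] Z_def[symmetric] by simp
  have p0: "0 \<le> p k x" for k x using Zpos[of k] by (simp add: p_def)
  define Mk where "Mk k \<mu> \<longleftrightarrow> \<mu> \<in> probs X \<and> (\<forall>g::'a \<Rightarrow> real. g \<in> borel_measurable (borel_on X) \<longrightarrow>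
      integral\<^sup>L \<mu> g = (\<Sum>x\<in>E k. p k x * (bsum g (n k) x / n k)))" for k \<mu>
  have "\<exists>\<mu>. Mk k \<mu>" for k
  proof -
    obtain \<mu> where \<mu>: "\<mu> \<in> probs X" "\<And>g::'a \<Rightarrow> real. g \<in> borel_measurable (borel_on X) \<Longrightarrow>
      integral\<^sup>L \<mu> g = (\<Sum>a\<in>E k \<times> {..<n k}. (p k (fst a) / n k) * g ((f ^^ snd a) (fst a)))"
    proof (rule finite_mixture_probs[of "E k \<times> {..<n k}" "\<lambda>a. p k (fst a) / n k" "\<lambda>a. (f ^^ snd a) (fst a)" X])
      have "(\<Sum>a\<in>E k \<times> {..<n k}. p k (fst a) / n k) = (\<Sum>x\<in>E k. \<Sum>j<n k. p k x / n k)"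
        by (simp only: sum.cartesian_product case_prod_unfold)
      also have "\<dots> = 1" using n0[of k] psum by simp
      finally show "(\<Sum>a\<in>E k \<times> {..<n k}. p k (fst a) / n k) = 1" .
    qed (use Efin p0 EX iter_in that in auto)
    have "integral\<^sup>L \<mu> g = (\<Sum>x\<in>E k. p k x * (bsum g (n k) x / n k))" if "g \<in> borel_measurable (borel_on X)" for g :: "'a \<Rightarrow> real"
    proof -
      have "integral\<^sup>L \<mu> g = (\<Sum>x\<in>E k. \<Sum>j<n k. (p k x / n k) * g ((f ^^ j) x))"
        unfolding \<mu>(2)[OF that] by (simp add: sum.cartesian_product case_prod_unfold)
      then show ?thesis by (simp add: bsum_def sum_distrib_left sum_divide_distrib)
    qed
    then show ?thesis using \<mu>(1) by (auto simp: Mk_def)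
  qed
  then obtain M where M: "\<And>k. Mk k (M k)" by metis
  have Mp: "M k \<in> probs X" and Mint: "g \<in> borel_measurable (borel_on X) \<Longrightarrow>
      integral\<^sup>L (M k) g = (\<Sum>x\<in>E k. p k x * (bsum g (n k) x / n k))" for k and g :: "'a \<Rightarrow> real"
    using M[of k] by (auto simp: Mk_def)
  obtain r \<mu> where r: "strict_mono (r :: nat \<Rightarrow> nat)" and \<mu>: "\<mu> \<in> probs X" and conv: "wk_conv X (M \<circ> r) \<mu>"
    by (rule probs_sequentially_compact[OF compact Mp])
  have rk: "k \<le> r k" for k using r by (rule seq_suble)
  have conv': "(\<lambda>k. integral\<^sup>L (M (r k)) g) \<longlonglongrightarrow> integral\<^sup>L \<mu> g" if "continuous_on X g" for g :: "'a \<Rightarrow> real"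
    using conv that by (simp add: wk_conv_def comp_def)

  have inv: "\<mu> \<in> invariant_probs X f"
  proof (rule invariant_probsI[OF \<mu>])
    fix g :: "'a \<Rightarrow> real" assume g: "continuous_on X g"
    obtain B where B: "0 < B" "\<And>x. x \<in> X \<Longrightarrow> \<bar>g x\<bar> \<le> B" using continuous_on_compact_bounded[OF compact g] by metis
    have gf: "continuous_on X (\<lambda>x. g (f x))"
      by (rule continuous_on_compose2[OF g cont maps])
    have gm: "g \<in> borel_measurable (borel_on X)" "(\<lambda>x. g (f x)) \<in> borel_measurable (borel_on X)"
      using g gf by (auto intro: continuous_measurable_borel_on)
    have "\<bar>integral\<^sup>L (M k) (\<lambda>x. g (f x)) - integral\<^sup>L (M k) g\<bar> \<le> 2 * B / n k" for k
    proof -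
      \<comment> \<open>Composition with f changes a Birkhoff sum by two boundary terms only; hence
        \<open>M k\<close> is invariant up to 2 * B / n k, and the limit is invariant.\<close>
      have tel: "bsum (\<lambda>x. g (f x)) N x - bsum g N x = g ((f ^^ N) x) - g x" for N x
        unfolding bsum_def by (induction N) auto
      have "integral\<^sup>L (M k) (\<lambda>x. g (f x)) - integral\<^sup>L (M k) g
          = (\<Sum>x\<in>E k. p k x * ((bsum (\<lambda>x. g (f x)) (n k) x - bsum g (n k) x) / n k))"
        unfolding Mint[OF gm(1)] Mint[OF gm(2)] sum_subtractf[symmetric]
        by (intro sum.cong refl) (simp add: diff_divide_distrib right_diff_distrib)
      also have "\<bar>\<dots>\<bar> \<le> (\<Sum>x\<in>E k. \<bar>p k x * ((bsum (\<lambda>x. g (f x)) (n k) x - bsum g (n k) x) / n k)\<bar>)"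
        by (rule sum_abs)
      also have "\<dots> \<le> (\<Sum>x\<in>E k. p k x * (2 * B / n k))"
      proof (rule sum_mono)
        fix x assume x: "x \<in> E k"
        have "\<bar>g ((f ^^ n k) x) - g x\<bar> \<le> 2 * B"
          using B(2)[OF iter_in[OF EX[OF x], of "n k"]] B(2)[OF EX[OF x]] by linarith
        then show "\<bar>p k x * ((bsum (\<lambda>x. g (f x)) (n k) x - bsum g (n k) x) / n k)\<bar> \<le> p k x * (2 * B / n k)"
          unfolding tel abs_mult using p0[of k x] by (auto simp: abs_divide intro!: mult_left_mono divide_right_mono)
      qed
      also have "\<dots> = 2 * B / n k" by (simp only: sum_distrib_right[symmetric] psum mult_1)
      finally show ?thesis .
    qed
    then have le: "\<bar>integral\<^sup>L (M (r k)) (\<lambda>x. g (f x)) - integral\<^sup>L (M (r k)) g\<bar> \<le> 2 * B / real (Suc k)" for k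
    proof -
      have "2 * B / n (r k) \<le> 2 * B / real (Suc k)"
        using nk[of "r k"] rk[of k] B(1) by (intro divide_left_mono) auto
      then show ?thesis using \<open>\<And>k. \<bar>integral\<^sup>L (M k) (\<lambda>x. g (f x)) - integral\<^sup>L (M k) g\<bar> \<le> 2 * B / n k\<close>[of "r k"] by linarith
    qed
    have "(\<lambda>k. 2 * B / real (Suc k)) \<longlonglongrightarrow> 0"
      using LIMSEQ_Suc[OF lim_const_over_n[of "2 * B"]] by simp
    then have "(\<lambda>k. integral\<^sup>L (M (r k)) (\<lambda>x. g (f x)) - integral\<^sup>L (M (r k)) g) \<longlonglongrightarrow> 0"
      by (rule Lim_null_comparison[rotated]) (use le in auto)
    moreover have "(\<lambda>k. integral\<^sup>L (M (r k)) (\<lambda>x. g (f x)) - integral\<^sup>L (M (r k)) g) \<longlonglongrightarrow> (\<integral>x. g (f x) \<partial>\<mu>) - integral\<^sup>L \<mu> g"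
      by (intro tendsto_diff conv' g gf)
    ultimately show "(\<integral>x. g (f x) \<partial>\<mu>) = integral\<^sup>L \<mu> g" using LIMSEQ_unique by fastforce
  qed

  \<comment> \<open>\<open>F\<close> need not be convex, so the averages \<open>M k\<close> may
    leave it. But the empirical measures of the points in \<open>E k\<close> nearly agree; those of
    arbitrarily chosen points \<open>y k\<close> lie in \<open>F\<close> and have the same weak
    limit as the averages.\<close>
  have \<mu>F: "\<mu> \<in> F"
  proof -
    from Ene have "\<exists>x. x \<in> E k" for k by blast
    then obtain y where y: "\<And>k. y k \<in> E k" by metis
    show ?thesis
    proof (rule wk_closed_limit[OF F _ \<mu>])
      show "empirical X f (n (r k)) (y (r k)) \<in> F" for k using y[of "r k"] EF by auto
      show "wk_conv X (\<lambda>k. empirical X f (n (r k)) (y (r k))) \<mu>" unfolding wk_conv_def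
      proof (intro allI impI)
        fix g :: "'a \<Rightarrow> real" assume g: "continuous_on X g"
        have gm: "g \<in> borel_measurable (borel_on X)" by (rule continuous_measurable_borel_on[OF g])
        obtain B where B: "0 < B" "\<And>x. x \<in> X \<Longrightarrow> \<bar>g x\<bar> \<le> B" using continuous_on_compact_bounded[OF compact g] by metis
        have uc: "uniformly_continuous_on X g" by (rule compact_uniformly_continuous[OF g compact])
        have ei: "integral\<^sup>L (empirical X f (n k) (y k)) g = bsum g (n k) (y k) / n k" for k
          unfolding bsum_def using empirical_integral[OF n0 EX[OF y] gm] .
        have "(\<lambda>k. bsum g (n (r k)) (y (r k)) / n (r k) - integral\<^sup>L (M (r k)) g) \<longlonglongrightarrow> 0"
        proof (rule LIMSEQ_I)
          fix \<eta> :: real assume \<eta>: "0 < \<eta>"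
          obtain d where d: "d > 0" "\<And>x y. x \<in> X \<Longrightarrow> y \<in> X \<Longrightarrow> dist x y < d \<Longrightarrow> \<bar>g x - g y\<bar> < \<eta> / 4"
            using uc \<eta> unfolding uniformly_continuous_on_def dist_real_def
            by (metis abs_minus_commute dist_commute divide_pos_pos zero_less_numeral)
          obtain N1 where N1: "1 / real (Suc N1) < d" using nat_approx_posE[OF d(1)] by blast
          obtain N2 where N2: "1 / real (Suc N2) < \<eta> / (4 * B)" using nat_approx_posE[of "\<eta> / (4 * B)"] \<eta> B(1) by auto
          show "\<exists>N0. \<forall>k\<ge>N0. norm (bsum g (n (r k)) (y (r k)) / n (r k) - integral\<^sup>L (M (r k)) g - 0) < \<eta>"
          proof (intro exI[of _ "max N1 N2"] allI impI)
            fix k assume k: "max N1 N2 \<le> k"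
            define i where "i = r k"
            have ik: "N1 \<le> i" "N2 \<le> i" using k rk[of k] by (auto simp: i_def)
            have "1 / real (Suc i) \<le> 1 / real (Suc N1)" "1 / real (Suc i) \<le> 1 / real (Suc N2)"
              using ik by (auto intro!: divide_left_mono)
            then have s1: "1 / real (Suc i) < d" and "1 / real (Suc i) < \<eta> / (4 * B)"
              using N1 N2 by linarith+
            then have s2: "B / real (Suc i) < \<eta> / 4" using B(1) by (simp add: field_simps)
            have o: "\<bar>bsum g (n i) (y i) / n i - bsum g (n i) x / n i\<bar> \<le> 2 * (\<eta> / 4) + B / Suc i" if "x \<in> E i" for x
            proof (rule osc[OF B(2) _ y that])
              show "\<bar>g x - g y\<bar> \<le> \<eta> / 4" if "x \<in> X" "y \<in> X" "dist x y \<le> 1 / Suc i" for x y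
                using d(2)[OF that(1,2)] that(3) s1 by linarith
            qed
            have "bsum g (n i) (y i) / n i - integral\<^sup>L (M i) g
              = (\<Sum>x\<in>E i. p i x * (bsum g (n i) (y i) / n i)) - (\<Sum>x\<in>E i. p i x * (bsum g (n i) x / n i))"
              unfolding Mint[OF gm] by (simp only: sum_distrib_right[symmetric] psum mult_1)
            also have "\<dots> = (\<Sum>x\<in>E i. p i x * (bsum g (n i) (y i) / n i - bsum g (n i) x / n i))"
              by (simp only: sum_subtractf[symmetric] right_diff_distrib)
            also have "\<bar>\<dots>\<bar> \<le> (\<Sum>x\<in>E i. \<bar>p i x * (bsum g (n i) (y i) / n i - bsum g (n i) x / n i)\<bar>)" by (rule sum_abs)
            also have "\<dots> \<le> (\<Sum>x\<in>E i. p i x * (2 * (\<eta> / 4) + B / Suc i))"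
              using o p0 by (intro sum_mono) (simp only: abs_mult abs_of_nonneg[OF p0], auto intro!: mult_left_mono)
            also have "\<dots> = 2 * (\<eta> / 4) + B / Suc i" by (simp only: sum_distrib_right[symmetric] psum mult_1)
            also have "\<dots> < \<eta>" using s2 \<eta> by linarith
            finally show "norm (bsum g (n (r k)) (y (r k)) / n (r k) - integral\<^sup>L (M (r k)) g - 0) < \<eta>"
              by (simp add: i_def)
          qed
        qed
        from tendsto_add[OF this conv'[OF g]]
        show "(\<lambda>k. integral\<^sup>L (empirical X f (n (r k)) (y (r k))) g) \<longlonglongrightarrow> integral\<^sup>L \<mu> g"
          by (simp add: ei)
      qed
    qed
  qed

  \<comment> \<open>The labelling comes only after the limit: its classes must have diameter at most
    the separation scale e and boundaries that are null for \<mu>.\<close>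
  obtain l :: "'a \<Rightarrow> nat" and D where l: "borel_label l"
    "\<And>x y. x \<in> X \<Longrightarrow> y \<in> X \<Longrightarrow> l x = l y \<Longrightarrow> dist x y \<le> e"
    and D: "closedin (top_of_set X) D" "measure \<mu> D = 0"
    "\<And>v. closedin (top_of_set X) ({x\<in>X. l x = v} \<union> D)"
    "\<And>v. closedin (top_of_set X) ({x\<in>X. l x \<noteq> v} \<union> D)"
    by (rule small_label[OF \<mu> e]) (rule that)
  have "b - 2 * \<delta> + integral\<^sup>L \<mu> \<phi> \<le> word_entropy \<mu> l k / k" if k: "0 < k" for k
  proof -
    have ineq: "k * (b - 2 * \<delta> + integral\<^sup>L (M i) \<phi>) \<le> 2 * real k * real k * ln (card (l ` X)) / n i + word_entropy (M i) l k"
      if "k \<le> n i" for i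
      by (rule separated_entropy_bound[OF Efin Ene _ Esep k that l Z_def _ \<phi>m Mp])
        (use EX EZ Mint in \<open>auto simp: Z_def p_def\<close>)
    \<comment> \<open>The block length k stays fixed while i tends to infinity; this removes the
      error of order k * k / n before the rate in k is considered.\<close>
    have "(\<lambda>i. k * (b - 2 * \<delta> + integral\<^sup>L (M (r i)) \<phi>)) \<longlonglongrightarrow> k * (b - 2 * \<delta> + integral\<^sup>L \<mu> \<phi>)"
      by (intro tendsto_intros conv' \<phi>)
    moreover have "(\<lambda>i. 2 * real k * real k * ln (card (l ` X)) / n (r i) + word_entropy (M (r i)) l k)
        \<longlonglongrightarrow> 0 + word_entropy \<mu> l k"
    proof (rule tendsto_add)
      have "filterlim (\<lambda>i. n (r i)) sequentially sequentially"
        by (rule filterlim_at_top_mono[OF filterlim_ident]) (use nk rk in \<open>auto intro!: always_eventually le_trans[OF rk less_imp_le]\<close>)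
      from filterlim_compose[OF lim_const_over_n this]
      show "(\<lambda>i. 2 * real k * real k * ln (card (l ` X)) / n (r i)) \<longlonglongrightarrow> 0" .
      show "(\<lambda>i. word_entropy (M (r i)) l k) \<longlonglongrightarrow> word_entropy \<mu> l k"
        unfolding word_entropy_def
      proof (intro tendsto_sum tendsto_minus tendsto_eta0 measure_nonneg)
        fix w assume "w \<in> words (l ` X) k"
        then have w: "length w = k" by (simp add: words_def)
        have "(\<lambda>i. measure ((M \<circ> r) i) {x\<in>X. itin l k x = w}) \<longlonglongrightarrow> measure \<mu> {x\<in>X. itin l k x = w}"
          by (rule word_measure_tendsto[OF _ inv conv l(1) D w]) (simp add: Mp)
        then show "(\<lambda>i. measure (M (r i)) {x\<in>X. itin l k x = w}) \<longlonglongrightarrow> measure \<mu> {x\<in>X. itin l k x = w}" by simp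
      qed
    qed
    moreover have "\<forall>\<^sub>F i in sequentially. k * (b - 2 * \<delta> + integral\<^sup>L (M (r i)) \<phi>)
        \<le> 2 * real k * real k * ln (card (l ` X)) / n (r i) + word_entropy (M (r i)) l k"
    proof (rule eventually_sequentiallyI[of k])
      fix i assume "k \<le> i"
      then have "k \<le> n (r i)" using rk[of i] nk[of "r i"] by simp
      then show "k * (b - 2 * \<delta> + integral\<^sup>L (M (r i)) \<phi>)
        \<le> 2 * real k * real k * ln (card (l ` X)) / n (r i) + word_entropy (M (r i)) l k" by (rule ineq)
    qed
    ultimately have "k * (b - 2 * \<delta> + integral\<^sup>L \<mu> \<phi>) \<le> 0 + word_entropy \<mu> l k"
      by (intro tendsto_le[OF sequentially_bot])
    then show ?thesis using k by (simp add: pos_le_divide_eq mult.commute)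
  qed
  from label_rate_le_ks_entropy[OF inv l(1) this]
  have "ereal (b - 2 * \<delta> + integral\<^sup>L \<mu> \<phi>) \<le> ks_entropy X f \<mu>" .
  then have "ereal (b - 2 * \<delta>) \<le> free_energy X f \<phi> \<mu>"
    unfolding free_energy_def using inv by (cases "ks_entropy X f \<mu>") auto
  with \<mu>F show ?thesis by blast
qed

end

section \<open>Counting and coding\<close>

text \<open>Induction with n ln ((n + 1) / n) \<le> 1, an instance of ln t \<le> t - 1.\<close>

lemma ln_fact_lower: "real n * ln n - n \<le> ln (fact n)"
proof (induction n)
  case (Suc n)
  have "real n * ln (real (Suc n)) \<le> real n * ln n + 1"
  proof (cases "n = 0")
    case False
    have "ln (real (Suc n) / n) \<le> real (Suc n) / n - 1" using False by (intro ln_le_minus_one) simp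
    then have "n * ln (real (Suc n) / n) \<le> n * (real (Suc n) / n - 1)" by (intro mult_left_mono) auto
    also have "\<dots> = 1" using False by (simp add: field_simps)
    finally show ?thesis using False by (simp add: ln_div right_diff_distrib del: of_nat_Suc)
  qed simp
  moreover have "ln (fact (Suc n) :: real) = ln (real (Suc n)) + ln (fact n)"
    by (simp add: ln_mult del: of_nat_Suc)
  ultimately show ?case using Suc by (simp add: algebra_simps)
qed simp

text \<open>Induction from 1 with (n + 1) ln (n / (n + 1)) \<le> - 1. The term
  \<open>ln (real (Suc n))\<close> in place of ln n makes the bound hold for n = 0 too.\<close>

lemma ln_fact_upper: "ln (fact n) \<le> real n * ln n - n + ln (real (Suc n)) + 1"
proof -
  have main: "ln (fact n) \<le> real n * ln n - n + ln n + 1" if "1 \<le> n" for n :: nat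
    using that
  proof (induction n rule: dec_induct)
    case base
    show ?case by simp
  next
    case (step n)
    have n: "0 < real n" using step by simp
    have "ln (real n / real (Suc n)) \<le> real n / real (Suc n) - 1" using n by (intro ln_le_minus_one) simp
    then have "real (Suc n) * ln (real n / real (Suc n)) \<le> real (Suc n) * (real n / real (Suc n) - 1)"
      by (intro mult_left_mono) auto
    also have "\<dots> = - 1" by (simp add: field_simps)
    finally have "real (Suc n) * ln n - real (Suc n) * ln (real (Suc n)) \<le> -1"
      using n by (simp add: ln_div right_diff_distrib del: of_nat_Suc)
    moreover have "ln (fact (Suc n) :: real) = ln (real (Suc n)) + ln (fact n)"
      by (simp add: ln_mult del: of_nat_Suc)
    ultimately show ?case using step by (simp add: algebra_simps)
  qed
  show ?thesis
  proof (cases "n = 0")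
    case False
    then have "ln (real n) \<le> ln (real (Suc n))" by simp
    then show ?thesis using main[of n] False by linarith
  qed simp
qed

text \<open>The common type of a class of words, as in the method of types. Rounding down loses less
  than one occurrence per letter, so for a probability vector p the size lies between K - L and
  K.\<close>

definition type_mset :: "(nat \<Rightarrow> real) \<Rightarrow> nat \<Rightarrow> nat \<Rightarrow> nat multiset" where
  "type_mset p L K = (\<Sum>i<L. replicate_mset (nat \<lfloor>K * p i\<rfloor>) i)"

lemma count_type_mset: "count (type_mset p L K) i = (if i < L then nat \<lfloor>K * p i\<rfloor> else 0)"
  by (simp add: type_mset_def count_sum sum.delta)

lemma size_type_mset: "size (type_mset p L K) = (\<Sum>i<L. nat \<lfloor>K * p i\<rfloor>)"
  unfolding type_mset_def by (induction L) auto

lemma sum_type_mset: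
  fixes h :: "nat \<Rightarrow> real"
  shows "sum_mset (image_mset h (type_mset p L K)) = (\<Sum>i<L. real (nat \<lfloor>K * p i\<rfloor>) * h i)"
  unfolding type_mset_def by (induction L) auto

lemma ln_card_permutations_type:
  "ln (card (permutations_of_multiset (type_mset p L K)))
     = ln (fact (\<Sum>i<L. nat \<lfloor>K * p i\<rfloor>)) - (\<Sum>i<L. ln (fact (nat \<lfloor>K * p i\<rfloor>)))"
proof -
  define A where "A = type_mset p L K"
  have sub: "set_mset A \<subseteq> {..<L}"
    unfolding set_mset_def A_def count_type_mset by (auto split: if_splits)
  have "card (permutations_of_multiset A) * (\<Prod>x\<in>set_mset A. fact (count A x)) = fact (size A)"
    unfolding card_permutations_of_multiset(1) by (rule dvd_div_mult_self[OF card_permutations_of_multiset(2)])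
  also have "(\<Prod>x\<in>set_mset A. fact (count A x)) = (\<Prod>x<L. fact (count A x) :: nat)"
    by (rule prod.mono_neutral_left) (use sub in \<open>auto simp: not_in_iff\<close>)
  also have "\<dots> = (\<Prod>i<L. fact (nat \<lfloor>K * p i\<rfloor>))" by (simp add: A_def count_type_mset)
  finally have "real (card (permutations_of_multiset A) * (\<Prod>i<L. fact (nat \<lfloor>K * p i\<rfloor>))) = real (fact (size A))"
    by (simp only:)
  then have eq: "real (card (permutations_of_multiset A)) * (\<Prod>i<L. fact (nat \<lfloor>K * p i\<rfloor>)) = fact (\<Sum>i<L. nat \<lfloor>K * p i\<rfloor>)"
    by (simp add: A_def size_type_mset)
  have pos: "0 < (\<Prod>i<L. fact (nat \<lfloor>K * p i\<rfloor>) :: real)" by (intro prod_pos) auto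
  have c: "0 < real (card (permutations_of_multiset A))"
    by (simp add: card_gt_0_iff permutations_of_multiset_nonempty)
  have "ln (fact (\<Sum>i<L. nat \<lfloor>K * p i\<rfloor>)) = ln (card (permutations_of_multiset A)) + ln (\<Prod>i<L. fact (nat \<lfloor>K * p i\<rfloor>) :: real)"
    unfolding eq[symmetric] by (rule ln_mult_pos[OF c pos])
  also have "ln (\<Prod>i<L. fact (nat \<lfloor>K * p i\<rfloor>) :: real) = (\<Sum>i<L. ln (fact (nat \<lfloor>K * p i\<rfloor>)))"
    by (rule ln_prod) auto
  finally show ?thesis by (simp add: A_def)
qed

lemma tendsto_floor_ratio:
  assumes "0 \<le> (p::real)"
  shows "(\<lambda>K. real (nat \<lfloor>real K * p\<rfloor>) / real K) \<longlonglongrightarrow> p"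
proof (rule tendsto_sandwich)
  show "\<forall>\<^sub>F K in sequentially. p - 1 / real K \<le> real (nat \<lfloor>real K * p\<rfloor>) / real K"
  proof (rule eventually_sequentiallyI[of 1])
    fix K :: nat assume K: "1 \<le> K"
    have "real K * p - 1 \<le> real (nat \<lfloor>real K * p\<rfloor>)" by linarith
    then have "(real K * p - 1) / real K \<le> real (nat \<lfloor>real K * p\<rfloor>) / real K" by (intro divide_right_mono) auto
    then show "p - 1 / real K \<le> real (nat \<lfloor>real K * p\<rfloor>) / real K" using K by (simp add: diff_divide_distrib)
  qed
  show "\<forall>\<^sub>F K in sequentially. real (nat \<lfloor>real K * p\<rfloor>) / real K \<le> p"
  proof (rule eventually_sequentiallyI[of 1])
    fix K :: nat assume K: "1 \<le> K"
    have "0 \<le> real K * p" using assms by simp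
    then have "real (nat \<lfloor>real K * p\<rfloor>) \<le> real K * p" by linarith
    then show "real (nat \<lfloor>real K * p\<rfloor>) / real K \<le> p" using K by (simp add: pos_divide_le_eq mult.commute)
  qed
  have "(\<lambda>K. p - 1 / real K) \<longlonglongrightarrow> p - 0" by (intro tendsto_diff tendsto_const lim_const_over_n)
  then show "(\<lambda>K. p - 1 / real K) \<longlonglongrightarrow> p" by simp
qed simp

text \<open>Stirling's bounds inserted into the multinomial coefficient. The linear terms and the
  terms with ln K cancel because the letter counts add up to the length; what remains is K times the
  entropy and an error of order ln K for each letter.\<close>

lemma permutations_type_growth:
  fixes p :: "nat \<Rightarrow> real"
  assumes p: "\<And>i. i < L \<Longrightarrow> 0 \<le> p i" "(\<Sum>i<L. p i) = 1" and \<delta>: "0 < \<delta>"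
  shows "\<forall>\<^sub>F K in sequentially. exp (real K * ((\<Sum>i<L. - eta0 (p i)) - \<delta>))
    \<le> real (card (permutations_of_multiset (type_mset p L K)))"
proof -
  define n where "n K i = nat \<lfloor>real K * p i\<rfloor>" for K i
  define a where "a K i = real (n K i) / real K" for K i
  define s where "s K = (\<Sum>i<L. a K i)" for K
  \<comment> \<open>\<open>g K\<close> is the resulting lower bound divided by K; the rounded
    frequencies add up to \<open>s K\<close>, which tends to 1, so eta0 (s K) disappears in the
    limit.\<close>
  define g where "g K = eta0 (s K) - (\<Sum>i<L. eta0 (a K i)) - (\<Sum>i<L. ln (real K + 1) / real K + 1 / real K)" for K
  have lim_a: "(\<lambda>K. a K i) \<longlonglongrightarrow> p i" if "i < L" for i
    unfolding a_def n_def using p(1)[OF that] by (rule tendsto_floor_ratio)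
  have a0: "0 \<le> a K i" for K i by (simp add: a_def)
  have s: "s \<longlonglongrightarrow> 1" unfolding s_def p(2)[symmetric] using lim_a by (intro tendsto_sum) auto
  have lnK: "(\<lambda>K. ln (real K + 1) / real K) \<longlonglongrightarrow> 0"
  proof (rule tendsto_sandwich[of "\<lambda>_. 0" _ _ "\<lambda>K. ln 2 / real K + ln (real K) / real K"])
    have "(\<lambda>K. ln 2 / real K + ln (real K) / real K) \<longlonglongrightarrow> 0 + 0"
      by (intro tendsto_add lim_const_over_n lim_ln_over_n)
    then show "(\<lambda>K. ln 2 / real K + ln (real K) / real K) \<longlonglongrightarrow> 0" by simp
    show "\<forall>\<^sub>F K in sequentially. ln (real K + 1) / real K \<le> ln 2 / real K + ln (real K) / real K"
    proof (rule eventually_sequentiallyI[of 1])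
      fix K :: nat assume K: "1 \<le> K"
      then have "ln (real K + 1) \<le> ln (2 * real K)" by (intro ln_mono) auto
      also have "\<dots> = ln 2 + ln (real K)" using K by (intro ln_mult_pos) auto
      finally show "ln (real K + 1) / real K \<le> ln 2 / real K + ln (real K) / real K"
        unfolding add_divide_distrib[symmetric] by (intro divide_right_mono) auto
    qed
    show "\<forall>\<^sub>F K in sequentially. 0 \<le> ln (real K + 1) / real K" by (rule always_eventually) simp
  qed simp
  have "g \<longlonglongrightarrow> eta0 1 - (\<Sum>i<L. eta0 (p i)) - (\<Sum>i<L. 0 + 0)"
    unfolding g_def
    by (intro tendsto_diff tendsto_sum tendsto_add tendsto_eta0 lnK lim_const_over_n s lim_a p(1))
      (auto simp: s_def intro!: sum_nonneg a0)
  then have g: "g \<longlonglongrightarrow> (\<Sum>i<L. - eta0 (p i))" by (simp add: eta0_def sum_negf)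
  have "\<forall>\<^sub>F K in sequentially. (\<Sum>i<L. - eta0 (p i)) - \<delta> < g K"
    using g by (rule order_tendstoD) (use \<delta> in simp)
  moreover have "\<forall>\<^sub>F K in sequentially. 0 < K" by (rule eventually_gt_at_top)
  ultimately show ?thesis
  proof eventually_elim
    case (elim K)
    have K: "0 < real K" using elim by simp
    have nKa: "real (n K i) = K * a K i" for i using K by (simp add: a_def)
    define S where "S = (\<Sum>i<L. n K i)"
    have Ss: "real S = K * s K" by (simp add: S_def s_def sum_distrib_left nKa)
    have xlnx: "(K * t) * ln (K * t) = K * eta0 t + K * t * ln K" if "0 \<le> t" for t :: real
      using that K by (cases "t = 0") (auto simp: eta0_eq ln_mult algebra_simps)
    have s0: "0 \<le> s K" by (auto simp: s_def intro!: sum_nonneg a0)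
    have nle: "real (Suc (n K i)) \<le> real K + 1" if "i < L" for i
    proof -
      have "p i \<le> (\<Sum>i<L. p i)" using that p(1) by (intro member_le_sum) auto
      then have "K * p i \<le> K" using p(2) K by simp
      then have "\<lfloor>K * p i\<rfloor> \<le> int K" by linarith
      then show ?thesis unfolding n_def by linarith
    qed
    have "K * ((\<Sum>i<L. - eta0 (p i)) - \<delta>) \<le> K * g K" using elim K by (intro mult_left_mono) auto
    also have "\<dots> = K * eta0 (s K) - (\<Sum>i<L. K * eta0 (a K i)) - (\<Sum>i<L. ln (real K + 1) + 1)"
      using K unfolding g_def right_diff_distrib sum_distrib_left by (simp add: distrib_left)
    also have "\<dots> = real S * ln S - (\<Sum>i<L. real (n K i) * ln (n K i)) - (\<Sum>i<L. ln (real K + 1) + 1)"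
      unfolding Ss nKa xlnx[OF s0] xlnx[OF a0] by (simp add: sum.distrib s_def sum_distrib_left sum_distrib_right)
    also have "\<dots> = (real S * ln S - S) - (\<Sum>i<L. real (n K i) * ln (n K i) - n K i + ln (real K + 1) + 1)"
      by (simp add: S_def sum.distrib sum_subtractf algebra_simps)
    also have "\<dots> \<le> ln (fact S) - (\<Sum>i<L. ln (fact (n K i)))"
    proof (rule diff_mono[OF ln_fact_lower], rule sum_mono)
      fix i assume "i \<in> {..<L}"
      then have "ln (real (Suc (n K i))) \<le> ln (real K + 1)" using nle[of i] by (intro ln_mono) auto
      then show "ln (fact (n K i)) \<le> real (n K i) * ln (n K i) - n K i + ln (real K + 1) + 1"
        using ln_fact_upper[of "n K i"] by linarith
    qed
    also have "\<dots> = ln (card (permutations_of_multiset (type_mset p L K)))"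
      by (simp add: ln_card_permutations_type S_def n_def)
    finally have "K * ((\<Sum>i<L. - eta0 (p i)) - \<delta>) \<le> ln (card (permutations_of_multiset (type_mset p L K)))" .
    moreover have "0 < real (card (permutations_of_multiset (type_mset p L K)))"
      by (simp add: card_gt_0_iff permutations_of_multiset_nonempty)
    ultimately show ?case by (simp add: ln_ge_iff)
  qed
qed

section \<open>Recovering words from partial information\<close>

lemma filter_classes_inject:
  assumes "map c xs = map c ys" "\<And>k. filter (\<lambda>x. c x = k) xs = filter (\<lambda>x. c x = k) ys"
  shows "xs = ys"
  using assms
proof (induction xs arbitrary: ys)
  case (Cons x xs)
  then obtain y ys' where ys: "ys = y # ys'" by (cases ys) auto
  have c: "c x = c y" "map c xs = map c ys'" using Cons.prems(1) ys by auto
  have "x = y" using Cons.prems(2)[of "c x"] ys c by simp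
  moreover have "filter (\<lambda>x. c x = k) xs = filter (\<lambda>x. c x = k) ys'" for k
    using Cons.prems(2)[of k] ys c by (auto split: if_splits)
  ultimately show ?case using Cons.IH[OF c(2)] ys by simp
qed simp

text \<open>Sorting by \<open>c\<close> is stable, so it leaves the subsequence of each class
  unchanged; these subsequences together with the sequence of classes determine the word.\<close>

lemma sort_key_class_inject:
  assumes "map c xs = map c ys" "sort_key c xs = sort_key c ys"
  shows "xs = ys"
proof (rule filter_classes_inject[OF assms(1)])
  show "filter (\<lambda>x. c x = k) xs = filter (\<lambda>x. c x = k) ys" for k
    using sort_key_stable[of c k xs] sort_key_stable[of c k ys] assms(2) by simp
qed

lemma map_sort_key: "map c (sort_key c xs) = sort (map c xs)"
  by (rule properties_for_sort[symmetric]) simp_all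

lemma sum_words_prod_le_1:
  fixes h :: "nat \<Rightarrow> 'b \<Rightarrow> real"
  assumes "finite V" "\<And>j a. 0 \<le> h j a" "\<And>j. (\<Sum>a\<in>V. h j a) \<le> 1"
  shows "(\<Sum>w\<in>words V n. \<Prod>j<n. h j (w ! j)) \<le> 1"
proof (induction n)
  case 0
  have "words V 0 = {[]}" by (auto simp: words_def)
  then show ?case by simp
next
  case (Suc n)
  have w1: "words V 1 = (\<lambda>a. [a]) ` V" by (auto simp: words_def length_Suc_conv)
  have "(\<Sum>w\<in>words V (n + 1). \<Prod>j<Suc n. h j (w ! j))
      = (\<Sum>u\<in>words V n. \<Sum>v\<in>words V 1. \<Prod>j<Suc n. h j ((u @ v) ! j))" by (rule sum_words_add)
  also have "\<dots> = (\<Sum>u\<in>words V n. \<Sum>a\<in>V. (\<Prod>j<n. h j (u ! j)) * h n a)"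
  proof (intro sum.cong refl)
    fix u assume "u \<in> words V n"
    then have u: "length u = n" by (simp add: words_def)
    have "(\<Sum>v\<in>words V 1. \<Prod>j<Suc n. h j ((u @ v) ! j)) = (\<Sum>a\<in>V. \<Prod>j<Suc n. h j ((u @ [a]) ! j))"
      unfolding w1 by (subst sum.reindex) (auto simp: inj_on_def)
    also have "\<dots> = (\<Sum>a\<in>V. (\<Prod>j<n. h j (u ! j)) * h n a)"
      using u by (intro sum.cong refl) (simp add: nth_append)
    finally show "(\<Sum>v\<in>words V 1. \<Prod>j<Suc n. h j ((u @ v) ! j)) = (\<Sum>a\<in>V. (\<Prod>j<n. h j (u ! j)) * h n a)" .
  qed
  also have "\<dots> = (\<Sum>u\<in>words V n. \<Prod>j<n. h j (u ! j)) * (\<Sum>a\<in>V. h n a)" by (simp add: sum_product)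
  also have "\<dots> \<le> 1 * 1" using Suc assms by (intro mult_mono) (auto intro!: sum_nonneg prod_nonneg)
  finally show ?case by simp
qed

context compact_system begin

text \<open>
  A Fano-type inequality, obtained from Gibbs' inequality with the reference weights
  \<open>q(w) = \<Sum>u. p(u) \<cdot> \<kappa>(w|u)\<close>, where \<open>\<kappa>\<close> draws the letters independently, each equal to the
  guess with probability \<open>1 - \<beta>\<close>.
\<close>

lemma word_entropy_le_code:
  fixes \<zeta> :: "'a \<Rightarrow> nat" and l :: "'a \<Rightarrow> 'b" and G :: "nat \<Rightarrow> nat \<Rightarrow> 'b"
  assumes \<mu>: "\<mu> \<in> probs X" and l: "borel_label l"
    and \<zeta>: "\<zeta> ` X \<subseteq> {..<L}" "\<And>u. {x\<in>X. \<zeta> x = u} \<in> sets (borel_on X)"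
    and \<beta>: "0 < \<beta>" "\<beta> < 1"
    and err: "\<And>j. j < N \<Longrightarrow> measure \<mu> {x\<in>X. l ((f ^^ j) x) \<noteq> G j (\<zeta> x)} \<le> \<beta>"
  shows "word_entropy \<mu> l N \<le> (\<Sum>u<L. - eta0 (measure \<mu> {x\<in>X. \<zeta> x = u}))
    + N * (- ln (1 - \<beta>) + \<beta> * ln (card (l ` X) / \<beta>))"
proof -
  interpret prob_space \<mu> by (rule probsD[OF \<mu>])
  define V where "V = l ` X"
  have V: "finite V" "V \<noteq> {}" using l not_empty probsD(2)[OF \<mu>] by (auto simp: borel_label_def V_def)
  then have cV: "1 \<le> card V" by (simp add: Suc_leI card_gt_0_iff)
  define p where "p u = measure \<mu> {x\<in>X. \<zeta> x = u}" for u
  \<comment> \<open>The error probability \<beta> is spread evenly over card V letters, so a wrong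
    letter costs ln (card V / \<beta>), a correct one - ln (1 - \<beta>), and the weights add up to
    at most 1.\<close>
  define \<kappa> where "\<kappa> g a = (if a = g then 1 - \<beta> else \<beta> / card V)" for g a :: 'b
  have \<kappa>pos: "0 < \<kappa> g a" for g a using \<beta> cV by (auto simp: \<kappa>_def)
  have \<kappa>sum: "(\<Sum>a\<in>V. \<kappa> g a) \<le> 1" for g
  proof -
    have "(\<Sum>a\<in>V. \<kappa> g a) \<le> (\<Sum>a\<in>V. (if a = g then 1 - \<beta> else 0) + \<beta> / card V)"
      using \<beta> by (intro sum_mono) (auto simp: \<kappa>_def)
    also have "\<dots> \<le> (1 - \<beta>) + \<beta>" using V cV \<beta> by (simp add: sum.distrib sum.delta)
    finally show ?thesis by simp
  qed
  define KK where "KK u w = (\<Prod>j<N. \<kappa> (G j u) (w ! j))" for u w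
  have Kpos: "0 < KK u w" for u w unfolding KK_def by (intro prod_pos) (auto simp: \<kappa>pos)
  define q where "q w = (\<Sum>u<L. p u * KK u w)" for w
  define \<xi> where "\<xi> x = (\<zeta> x, itin l N x)" for x
  define W where "W = {..<L} \<times> words V N"
  define P where "P v = measure \<mu> {x\<in>X. \<xi> x = v}" for v
  have xm: "{x\<in>X. \<xi> x = v} \<in> sets (borel_on X)" for v
  proof -
    have "{x\<in>X. \<xi> x = v} = {x\<in>X. \<zeta> x = fst v} \<inter> {x\<in>X. itin l N x = snd v}" by (auto simp: \<xi>_def)
    then show ?thesis using \<zeta>(2) itin_fiber_sets[OF l] by (simp add: sets.Int)
  qed
  have W: "finite W" "\<xi> ` X \<subseteq> W" using \<zeta>(1) V by (auto simp: W_def \<xi>_def finite_words V_def itin_in_words)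
  have int: "(\<integral>x. F (\<xi> x) \<partial>\<mu>) = (\<Sum>v\<in>W. P v * F v)" for F
    unfolding P_def by (rule integral_finite_range[OF \<mu> W xm])
  have Psum: "(\<Sum>v\<in>W. P v) = 1" unfolding P_def by (rule sum_measure_fibers[OF \<mu> W xm])
  have P0: "0 \<le> P v" for v by (simp add: P_def)
  have psum: "(\<Sum>u<L. p u) = 1" unfolding p_def by (rule sum_measure_fibers[OF \<mu> _ \<zeta>]) simp
  have ppos: "0 < p (fst v)" if "P v \<noteq> 0" for v
  proof -
    have "P v \<le> p (fst v)" unfolding P_def p_def using \<zeta>(2)[of "fst v"]
      by (intro finite_measure_mono) (auto simp: \<xi>_def probsD[OF \<mu>])
    then show ?thesis using that P0[of v] by linarith
  qed
  have qge: "p u * KK u w \<le> q w" if "u < L" for u w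
    unfolding q_def using that less_imp_le[OF Kpos] by (intro member_le_sum) (auto simp: p_def)
  have "word_entropy \<mu> l N \<le> (\<Sum>w\<in>words V N. - (measure \<mu> {x\<in>X. itin l N x = w} * ln (q w)))"
    unfolding word_entropy_def V_def[symmetric]
  proof (rule gibbs_inequality)
    show "0 \<le> q w" for w unfolding q_def using less_imp_le[OF Kpos] by (intro sum_nonneg) (auto simp: p_def)
    show "0 < q w" if w: "0 < measure \<mu> {x\<in>X. itin l N x = w}" for w
    proof -
      obtain u where u: "u < L" "0 < p u"
      proof -
        have "\<exists>u\<in>{..<L}. 0 < p u"
        proof (rule ccontr)
          assume "\<not> ?thesis"
          then have "(\<Sum>u<L. p u) \<le> 0" by (intro sum_nonpos) (auto simp: not_less)
          then show False using psum by simp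
        qed
        then show ?thesis using that by auto
      qed
      then show ?thesis using qge[OF u(1), of w] mult_pos_pos[OF u(2) Kpos[of u w]] by linarith
    qed
    have "(\<Sum>w\<in>words V N. q w) = (\<Sum>u<L. p u * (\<Sum>w\<in>words V N. KK u w))"
      unfolding q_def by (subst sum.swap) (simp add: sum_distrib_left)
    also have "\<dots> \<le> (\<Sum>u<L. p u * 1)"
      unfolding KK_def using \<kappa>pos V(1) \<kappa>sum
      by (intro sum_mono mult_left_mono sum_words_prod_le_1) (auto simp: p_def less_imp_le)
    finally show "(\<Sum>w\<in>words V N. q w) \<le> (\<Sum>w\<in>words V N. measure \<mu> {x\<in>X. itin l N x = w})"
      using sum_word_measures[OF \<mu> l] psum by (simp add: V_def)
  qed simp
  also have "\<dots> = (\<integral>x. - ln (q (itin l N x)) \<partial>\<mu>)"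
    unfolding integral_itin[OF \<mu> l, of "\<lambda>w. - ln (q w)"] by (simp add: V_def)
  also have "\<dots> = (\<Sum>v\<in>W. P v * - ln (q (snd v)))"
    using int[of "\<lambda>v. - ln (q (snd v))"] by (simp add: \<xi>_def)
  \<comment> \<open>The mixture \<open>q\<close> is at least its summand with u =
    \<open>fst v\<close>, whose logarithm splits into the contribution of \<zeta> and one term for
    each letter.\<close>
  also have "\<dots> \<le> (\<Sum>v\<in>W. P v * - ln (p (fst v)) + (\<Sum>j<N. P v * - ln (\<kappa> (G j (fst v)) (snd v ! j))))"
  proof (rule sum_mono)
    fix v assume v: "v \<in> W"
    show "P v * - ln (q (snd v)) \<le> P v * - ln (p (fst v)) + (\<Sum>j<N. P v * - ln (\<kappa> (G j (fst v)) (snd v ! j)))"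
    proof (cases "P v = 0")
      case False
      have pp: "0 < p (fst v)" by (rule ppos[OF False])
      have "fst v < L" using v by (auto simp: W_def)
      from qge[OF this, of "snd v"] have "ln (p (fst v) * KK (fst v) (snd v)) \<le> ln (q (snd v))"
        using pp Kpos[of "fst v" "snd v"] by (intro ln_mono) auto
      also have "ln (p (fst v) * KK (fst v) (snd v)) = ln (p (fst v)) + (\<Sum>j<N. ln (\<kappa> (G j (fst v)) (snd v ! j)))"
        unfolding ln_mult_pos[OF pp Kpos] unfolding KK_def
        by (simp add: ln_prod less_imp_neq[OF \<kappa>pos, symmetric])
      finally have "- ln (q (snd v)) \<le> - ln (p (fst v)) + (\<Sum>j<N. - ln (\<kappa> (G j (fst v)) (snd v ! j)))"
        by (simp add: sum_negf)
      then have "P v * - ln (q (snd v)) \<le> P v * (- ln (p (fst v)) + (\<Sum>j<N. - ln (\<kappa> (G j (fst v)) (snd v ! j))))"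
        using P0 by (intro mult_left_mono) auto
      then show ?thesis by (simp only: distrib_left sum_distrib_left)
    qed simp
  qed
  also have "\<dots> = (\<Sum>v\<in>W. P v * - ln (p (fst v))) + (\<Sum>j<N. \<Sum>v\<in>W. P v * - ln (\<kappa> (G j (fst v)) (snd v ! j)))"
    by (simp only: sum.distrib) (subst (2) sum.swap, rule refl)
  also have "(\<Sum>v\<in>W. P v * - ln (p (fst v))) = (\<Sum>u<L. - eta0 (p u))"
  proof -
    have "(\<Sum>v\<in>W. P v * - ln (p (fst v))) = (\<integral>x. - ln (p (\<zeta> x)) \<partial>\<mu>)"
      using int[of "\<lambda>v. - ln (p (fst v))"] by (simp add: \<xi>_def)
    also have "\<dots> = (\<Sum>u<L. p u * - ln (p u))"
      unfolding p_def by (rule integral_finite_range[OF \<mu> _ \<zeta>]) simp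
    finally show ?thesis by (simp add: eta0_eq)
  qed
  also have "(\<Sum>j<N. \<Sum>v\<in>W. P v * - ln (\<kappa> (G j (fst v)) (snd v ! j)))
      \<le> (\<Sum>j<N. - ln (1 - \<beta>) + \<beta> * ln (card V / \<beta>))"
  proof (rule sum_mono)
    fix j assume "j \<in> {..<N}"
    then have j: "j < N" by simp
    define B where "B v = (if snd v ! j = G j (fst v) then 0 else 1 :: real)" for v
    have lnge: "0 \<le> ln (card V / \<beta>)" using \<beta> cV by (intro ln_ge_zero) (simp add: field_simps)
    have ln1: "0 \<le> - ln (1 - \<beta>)" using \<beta> by simp
    have "(\<Sum>v\<in>W. P v * - ln (\<kappa> (G j (fst v)) (snd v ! j))) \<le> (\<Sum>v\<in>W. P v * (- ln (1 - \<beta>)) + P v * B v * ln (card V / \<beta>))"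
    proof (rule sum_mono)
      fix v
      have "- ln (\<kappa> (G j (fst v)) (snd v ! j)) \<le> - ln (1 - \<beta>) + B v * ln (card V / \<beta>)"
        using \<beta> cV ln1 by (auto simp: \<kappa>_def B_def ln_div)
      then have "P v * - ln (\<kappa> (G j (fst v)) (snd v ! j)) \<le> P v * (- ln (1 - \<beta>) + B v * ln (card V / \<beta>))"
        using P0 by (intro mult_left_mono) auto
      then show "P v * - ln (\<kappa> (G j (fst v)) (snd v ! j)) \<le> P v * (- ln (1 - \<beta>)) + P v * B v * ln (card V / \<beta>)"
        by (simp only: distrib_left mult.assoc)
    qed
    also have "\<dots> = - ln (1 - \<beta>) + (\<Sum>v\<in>W. P v * B v) * ln (card V / \<beta>)"
      by (simp only: sum.distrib sum_distrib_right[symmetric] Psum mult_1)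
    also have "(\<Sum>v\<in>W. P v * B v) = measure \<mu> {x\<in>X. l ((f ^^ j) x) \<noteq> G j (\<zeta> x)}"
    proof -
      have e: "{x\<in>X. l ((f ^^ j) x) \<noteq> G j (\<zeta> x)} = (\<Union>v\<in>{v\<in>W. B v = 1}. {x\<in>X. \<xi> x = v})"
        using W(2) j by (auto simp: B_def \<xi>_def itin_nth split: if_splits)
      have m: "{x\<in>X. l ((f ^^ j) x) \<noteq> G j (\<zeta> x)} \<in> sets \<mu>" unfolding e
        using W(1) xm by (intro sets.finite_UN) (auto simp: probsD[OF \<mu>])
      have "(\<Sum>v\<in>W. P v * B v) = (\<integral>x. B (\<xi> x) \<partial>\<mu>)" by (rule int[symmetric])
      also have "\<dots> = (\<integral>x. indicator {x\<in>X. l ((f ^^ j) x) \<noteq> G j (\<zeta> x)} x \<partial>\<mu>)"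
        using j by (intro Bochner_Integration.integral_cong refl) (auto simp: B_def \<xi>_def itin_nth indicator_def probsD[OF \<mu>])
      also have "\<dots> = measure \<mu> {x\<in>X. l ((f ^^ j) x) \<noteq> G j (\<zeta> x)}"
        using m sets.sets_into_space[OF m] by (simp add: Int_absorb2)
      finally show ?thesis .
    qed
    also have "- ln (1 - \<beta>) + measure \<mu> {x\<in>X. l ((f ^^ j) x) \<noteq> G j (\<zeta> x)} * ln (card V / \<beta>)
        \<le> - ln (1 - \<beta>) + \<beta> * ln (card V / \<beta>)"
      using err[OF j] lnge by (intro add_left_mono mult_right_mono) auto
    finally show "(\<Sum>v\<in>W. P v * - ln (\<kappa> (G j (fst v)) (snd v ! j))) \<le> - ln (1 - \<beta>) + \<beta> * ln (card V / \<beta>)" .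
  qed
  finally show ?thesis by (simp add: p_def V_def)
qed

section \<open>Recurrence\<close>

text \<open>Poincare's argument: the preimages of a wandering set are pairwise disjoint and have
  equal measure.\<close>

lemma wandering_null:
  assumes \<mu>: "\<mu> \<in> invariant_probs X f" and U: "U \<in> sets (borel_on X)"
    and w: "\<And>n. 0 < n \<Longrightarrow> U \<inter> (f ^^ n) -` U = {}"
  shows "measure \<mu> U = 0"
proof -
  have p: "\<mu> \<in> probs X" by (rule invariant_in_probs[OF \<mu>])
  interpret prob_space \<mu> by (rule probsD[OF p])
  define A where "A n = (f ^^ n) -` U \<inter> X" for n
  have A: "A n \<in> sets \<mu>" for n using iter_vimage_sets[OF U] by (simp add: A_def probsD[OF p])
  have disj: "A i \<inter> A j = {}" if "i < j" for i j
  proof -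
    have False if x: "x \<in> A i" "x \<in> A j" for x
    proof -
      have "(f ^^ j) x = (f ^^ (j - i)) ((f ^^ i) x)"
        using \<open>i < j\<close> by (metis add_diff_inverse_nat comp_apply funpow_add less_imp_not_less add.commute)
      then have "(f ^^ i) x \<in> U \<inter> (f ^^ (j - i)) -` U" using x by (auto simp: A_def)
      then show False using w[of "j - i"] \<open>i < j\<close> by auto
    qed
    then show ?thesis by blast
  qed
  have le: "real K * measure \<mu> U \<le> 1" for K
  proof -
    have "disjoint_family_on A {..<K}" unfolding disjoint_family_on_def
      using disj by (metis Int_commute nat_neq_iff)
    then have "measure \<mu> (\<Union>n<K. A n) = (\<Sum>n<K. measure \<mu> (A n))"
      using A by (intro finite_measure_finite_Union) auto
    also have "\<dots> = K * measure \<mu> U" unfolding A_def by (simp add: invariant_measure_iter[OF \<mu> U])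
    finally show ?thesis using prob_le_1[of "\<Union>n<K. A n"] by simp
  qed
  show ?thesis
  proof (rule ccontr)
    assume "measure \<mu> U \<noteq> 0"
    then have pos: "0 < measure \<mu> U" by (simp add: zero_less_measure_iff)
    obtain K where "1 / measure \<mu> U < real K" using reals_Archimedean2 by blast
    then have "1 < real K * measure \<mu> U" using pos by (simp add: field_simps)
    then show False using le[of K] by simp
  qed
qed

text \<open>Up to arbitrarily small measure the complement is a compact set, covered by finitely
  many wandering open sets. The result is needed because specification speaks only of points in the
  sets \<open>Xs i\<close>, whose union is the nonwandering set.\<close>

lemma nonwandering_full:
  assumes \<mu>: "\<mu> \<in> invariant_probs X f" and m: "nonwandering X f \<in> sets (borel_on X)"
  shows "measure \<mu> (X - nonwandering X f) = 0"
proof -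
  have p: "\<mu> \<in> probs X" by (rule invariant_in_probs[OF \<mu>])
  interpret prob_space \<mu> by (rule probsD[OF p])
  define A where "A = X - nonwandering X f"
  have A: "A \<in> sets (borel_on X)" using sets.compl_sets[OF m] by (simp add: A_def)
  have "measure \<mu> A \<le> 0 + e" if e: "0 < e" for e
  proof -
    obtain C where C: "closedin (top_of_set X) C" "C \<subseteq> A" "measure \<mu> (A - C) < e"
      by (rule borel_on_inner_regular[OF p A e]) (rule that)
    have cC: "compact C" using C(1) compact closedin_compact by blast
    have "\<exists>S. open S \<and> x \<in> S \<and> (\<forall>n>0. (X \<inter> S) \<inter> (f ^^ n) -` (X \<inter> S) = {})" if "x \<in> C" for x
    proof -
      have "x \<in> X" "x \<notin> nonwandering X f" using that C(2) by (auto simp: A_def)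
      then obtain U where U: "openin (top_of_set X) U" "x \<in> U" "\<forall>n>0. U \<inter> (f ^^ n) -` U = {}"
        unfolding nonwandering_def by blast
      then obtain S where "open S" "U = X \<inter> S" by (auto simp: openin_open)
      with U show ?thesis by blast
    qed
    then obtain S where S: "\<And>x. x \<in> C \<Longrightarrow> open (S x)" "\<And>x. x \<in> C \<Longrightarrow> x \<in> S x"
      "\<And>x n. x \<in> C \<Longrightarrow> 0 < n \<Longrightarrow> (X \<inter> S x) \<inter> (f ^^ n) -` (X \<inter> S x) = {}" by metis
    have cov: "C \<subseteq> (\<Union>x\<in>C. S x)" using S(2) by blast
    obtain T where T: "T \<subseteq> C" "finite T" "C \<subseteq> (\<Union>x\<in>T. S x)"
      by (rule compactE_image[OF cC S(1) cov])
    have Sm: "X \<inter> S x \<in> sets (borel_on X)" if "x \<in> C" for x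
      using S(1)[OF that] by (intro openin_borel_on openin_open_Int)
    have Cm: "C \<in> sets \<mu>" using closedin_borel_on[OF C(1)] by (simp add: probsD[OF p])
    have "measure \<mu> C \<le> measure \<mu> (\<Union>x\<in>T. X \<inter> S x)"
    proof (rule finite_measure_mono)
      show "C \<subseteq> (\<Union>x\<in>T. X \<inter> S x)" using T(3) closedin_imp_subset[OF C(1)] by blast
      show "(\<Union>x\<in>T. X \<inter> S x) \<in> sets \<mu>"
        unfolding probsD(3)[OF p] using T Sm by (intro sets.finite_UN) blast+
    qed
    also have "\<dots> \<le> (\<Sum>x\<in>T. measure \<mu> (X \<inter> S x))"
      using T Sm by (intro finite_measure_subadditive_finite) (auto simp: probsD[OF p])
    also have "\<dots> = 0" using wandering_null[OF \<mu> Sm S(3)] T(1) by (intro sum.neutral) blast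
    finally have "measure \<mu> C = 0" by (simp add: measure_le_0_iff)
    moreover have "measure \<mu> (A - C) = measure \<mu> A - measure \<mu> C"
      using A Cm C(2) by (intro finite_measure_Diff) (auto simp: probsD[OF p])
    ultimately show ?thesis using C(3) by simp
  qed
  then have "measure \<mu> A \<le> 0" by (rule field_le_epsilon)
  then show ?thesis by (simp add: A_def measure_le_0_iff)
qed

end

section \<open>Gluing orbits\<close>

lemma separate_compacts:
  fixes S T :: "'a::metric_space set"
  assumes "compact S" "compact T" "S \<inter> T = {}"
  obtains d where "0 < d" "\<And>x y. x \<in> S \<Longrightarrow> y \<in> T \<Longrightarrow> d \<le> dist x y"
proof (cases "S = {} \<or> T = {}")
  case True
  then show ?thesis by (intro that[of 1]) auto
next
  case False
  have "continuous_on S (\<lambda>x. infdist x T)" by (intro continuous_intros)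
  then obtain x0 where x0: "x0 \<in> S" "\<And>x. x \<in> S \<Longrightarrow> infdist x0 T \<le> infdist x T"
    using continuous_attains_inf[OF assms(1), of "\<lambda>x. infdist x T"] False by blast
  have "x0 \<notin> T" using x0 assms(3) by auto
  then have "infdist x0 T \<noteq> 0"
    using in_closed_iff_infdist_zero[OF compact_imp_closed[OF assms(2)]] False by auto
  then have "0 < infdist x0 T" using infdist_nonneg[of x0 T] by linarith
  moreover have "infdist x0 T \<le> dist x y" if "x \<in> S" "y \<in> T" for x y
    using x0(2)[OF that(1)] infdist_le[OF that(2), of x] by linarith
  ultimately show ?thesis by (rule that)
qed

lemma finite_positive_lower_bound:
  fixes P :: "'i \<Rightarrow> real \<Rightarrow> bool"
  assumes "finite I" "\<And>i. i \<in> I \<Longrightarrow> \<exists>d>0. P i d" "\<And>i d d'. P i d \<Longrightarrow> 0 < d' \<Longrightarrow> d' \<le> d \<Longrightarrow> P i d'"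
  shows "\<exists>d>0. \<forall>i\<in>I. P i d"
  using assms(1,2)
proof (induction I)
  case empty
  show ?case by (intro exI[of _ 1]) simp
next
  case (insert i I)
  then obtain d where d: "0 < d" "\<forall>i\<in>I. P i d" by auto
  obtain d' where d': "0 < d'" "P i d'" using insert.prems by auto
  have "P i (min d d')" "\<forall>i\<in>I. P i (min d d')"
    using assms(3)[OF d'(2), of "min d d'"] assms(3)[of _ d "min d d'"] d d' by auto
  then show ?case using d d' by (intro exI[of _ "min d d'"]) auto
qed

lemma pigeonhole_fiber:
  assumes "finite A" "finite W" "h ` A \<subseteq> W"
  shows "\<exists>v. card A \<le> card W * card {a\<in>A. h a = v}"
proof (cases "A = {}")
  case False
  then have W: "W \<noteq> {}" using assms by auto
  show ?thesis
  proof (rule ccontr)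
    assume "\<not> ?thesis"
    then have lt: "card W * card {a\<in>A. h a = v} < card A" for v by (simp add: not_le)
    have "(\<Sum>v\<in>W. card {a\<in>A. h a = v}) = card A"
      using sum.group[OF assms, of "\<lambda>_. 1::nat"] by simp
    then have "card W * card A = (\<Sum>v\<in>W. card W * card {a\<in>A. h a = v})"
      by (simp add: sum_distrib_left[symmetric])
    also have "\<dots> < (\<Sum>v\<in>W. card A)" using assms(2) W lt by (intro sum_strict_mono) auto
    finally show False by simp
  qed
qed simp

lemma tendsto_div_ratio:
  assumes "0 < (a::nat)"
  shows "(\<lambda>n. real (n div a) / real n) \<longlonglongrightarrow> 1 / real a"
proof (rule tendsto_sandwich[of "\<lambda>n. 1 / real a - 1 / real n" _ _ "\<lambda>_. 1 / real a"])
  have *: "real n / real a - 1 \<le> real (n div a)" "real (n div a) \<le> real n / real a" for n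
  proof -
    have "n = a * (n div a) + n mod a" by simp
    then have e: "real n = real a * real (n div a) + real (n mod a)" by (metis of_nat_add of_nat_mult)
    have "real (n mod a) < real a" using assms by simp
    then show "real n / real a - 1 \<le> real (n div a)" using e assms by (simp add: field_simps)
    show "real (n div a) \<le> real n / real a" using e assms by (simp add: field_simps)
  qed
  show "\<forall>\<^sub>F n in sequentially. 1 / real a - 1 / real n \<le> real (n div a) / real n"
  proof (rule eventually_sequentiallyI[of 1])
    fix n :: nat assume n: "1 \<le> n"
    have "(real n / real a - 1) / real n \<le> real (n div a) / real n" using * by (intro divide_right_mono) auto
    then show "1 / real a - 1 / real n \<le> real (n div a) / real n" using n by (simp add: diff_divide_distrib)
  qed
  show "\<forall>\<^sub>F n in sequentially. real (n div a) / real n \<le> 1 / real a"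
  proof (rule eventually_sequentiallyI[of 1])
    fix n :: nat assume n: "1 \<le> n"
    have "real (n div a) / real n \<le> (real n / real a) / real n" using * by (intro divide_right_mono) auto
    then show "real (n div a) / real n \<le> 1 / real a" using n by simp
  qed
  have "(\<lambda>n. 1 / real a - 1 / real n) \<longlonglongrightarrow> 1 / real a - 0" by (intro tendsto_diff tendsto_const lim_const_over_n)
  then show "(\<lambda>n. 1 / real a - 1 / real n) \<longlonglongrightarrow> 1 / real a" by simp
qed simp

lemma filterlim_div_sequentially:
  assumes "0 < (a::nat)"
  shows "filterlim (\<lambda>n. n div a) sequentially sequentially"
  unfolding filterlim_at_top
proof
  fix Z
  show "\<forall>\<^sub>F n in sequentially. Z \<le> n div a"
  proof (rule eventually_sequentiallyI[of "Z * a"])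
    fix n assume "Z * a \<le> n"
    then have "(Z * a) div a \<le> n div a" by (rule div_le_mono)
    then show "Z \<le> n div a" using assms by simp
  qed
qed

context compact_system begin

section \<open>One-way gluing of blocks\<close>

text \<open>Clause (3) of the specification property for one scale e and one gap bound M, kept
  literally as in \<open>one_way_W_spec\<close> so that both unfold to the same formula.\<close>

definition spec_gap :: "nat \<Rightarrow> (nat \<Rightarrow> 'a set) \<Rightarrow> real \<Rightarrow> nat \<Rightarrow> bool" where
  "spec_gap q Xs e M \<longleftrightarrow> (\<forall>k\<ge>1. \<forall>(idx::nat \<Rightarrow> nat) (xs::nat \<Rightarrow> 'a) (ns::nat \<Rightarrow> nat).
          (\<forall>j<k. idx j < q \<and> xs j \<in> Xs (idx j) \<and> ns j \<ge> 1) \<and>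
          (\<forall>j. Suc j < k \<longrightarrow> idx j \<le> idx (Suc j)) \<longrightarrow>
          (\<exists>y\<in>X. \<exists>Ms::nat \<Rightarrow> nat. (\<forall>t. Suc t < k \<longrightarrow> Ms t \<le> M) \<and>
             (\<forall>j<k. \<forall>i<ns j.
                dist ((f ^^ i) (xs j)) ((f ^^ (i + (\<Sum>t<j. ns t + Ms t))) y) \<le> e)))"

lemma spec_gap_list:
  assumes spec: "spec_gap q Xs e M" and zs: "zs \<noteq> []" "\<And>z. z \<in> set zs \<Longrightarrow> c z < q \<and> pt z \<in> Xs (c z)"
    and srt: "sorted (map c zs)" and N: "1 \<le> N"
  shows "\<exists>y\<in>X. \<exists>Ms::nat \<Rightarrow> nat. (\<forall>t. Suc t < length zs \<longrightarrow> Ms t \<le> M) \<and>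
     (\<forall>j<length zs. \<forall>i<N. dist ((f ^^ i) (pt (zs ! j))) ((f ^^ (i + (\<Sum>t<j. N + Ms t))) y) \<le> e)"
proof -
  have 1: "1 \<le> length zs" using zs(1) by (cases zs) auto
  have "(\<forall>j<length zs. c (zs ! j) < q \<and> pt (zs ! j) \<in> Xs (c (zs ! j)) \<and> N \<ge> 1)" using zs(2) N by auto
  moreover have "\<forall>j. Suc j < length zs \<longrightarrow> c (zs ! j) \<le> c (zs ! Suc j)"
    using srt by (auto simp: sorted_iff_nth_Suc)
  ultimately show ?thesis
    using spec[unfolded spec_gap_def, rule_format, of "length zs" "\<lambda>j. c (zs ! j)" "\<lambda>j. pt (zs ! j)" "\<lambda>_. N", OF 1]
    by simp
qed

text \<open>
  One-way specification only glues blocks in increasing order of their classes, so every word is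
  first sorted stably by class. A word is recovered from its sorted version and its sequence of
  classes; pigeonholing the class sequences and the gap sequences costs a factor
  \<open>(q * Suc M) ^ K\<close> only.
\<close>

lemma many_orbits:
  assumes spec: "spec_gap q Xs e M" and N: "1 \<le> N" and K: "1 \<le> K" and n: "K * (N + M) \<le> n"
    and A: "finite A" "\<And>xs. xs \<in> A \<Longrightarrow> length xs = K" "\<And>xs. xs \<in> A \<Longrightarrow> set xs \<subseteq> I"
    and I: "\<And>z. z \<in> I \<Longrightarrow> c z < q \<and> pt z \<in> Xs (c z)"
    and sep: "\<And>i j. i \<in> I \<Longrightarrow> j \<in> I \<Longrightarrow> i \<noteq> j \<Longrightarrow> c i = c j \<Longrightarrow>
        \<exists>t<N. 4 * e < dist ((f ^^ t) (pt i)) ((f ^^ t) (pt j))"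
  shows "\<exists>Y. Y \<subseteq> X \<and> finite Y \<and> card A \<le> (q * Suc M) ^ K * card Y \<and> separated n (2 * e) Y \<and>
    (\<forall>y\<in>Y. \<exists>zs T. (\<exists>xs\<in>A. mset zs = mset xs) \<and> T 0 = 0 \<and> T K = n \<and> (\<forall>j<K. T j + N \<le> T (Suc j)) \<and>
       (\<forall>j<K. \<forall>i<N. dist ((f ^^ i) (pt (zs ! j))) ((f ^^ (i + T j)) y) \<le> e))"
proof -
  define good where "good xs y Ms \<longleftrightarrow> y \<in> X \<and> (\<forall>t. Suc t < K \<longrightarrow> Ms t \<le> M) \<and>
     (\<forall>j<K. \<forall>i<N. dist ((f ^^ i) (pt (sort_key c xs ! j))) ((f ^^ (i + (\<Sum>t<j. N + Ms t))) y) \<le> e)"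
    for xs y and Ms :: "nat \<Rightarrow> nat"
  have "\<exists>y Ms. good xs y Ms" if xs: "xs \<in> A" for xs
  proof -
    have len: "length (sort_key c xs) = K" using A(2)[OF xs] by simp
    have ne: "sort_key c xs \<noteq> []" using len K by (metis list.size(3) not_one_le_zero)
    have "\<exists>y\<in>X. \<exists>Ms::nat \<Rightarrow> nat. (\<forall>t. Suc t < length (sort_key c xs) \<longrightarrow> Ms t \<le> M) \<and>
       (\<forall>j<length (sort_key c xs). \<forall>i<N. dist ((f ^^ i) (pt (sort_key c xs ! j))) ((f ^^ (i + (\<Sum>t<j. N + Ms t))) y) \<le> e)"
      using A(3)[OF xs] I by (intro spec_gap_list[OF spec ne _ _ N]) auto
    then show ?thesis unfolding good_def len by blast
  qed
  then obtain y Ms where yM: "\<And>xs. xs \<in> A \<Longrightarrow> good xs (y xs) (Ms xs)" by metis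
  \<comment> \<open>Only the K - 1 gaps between blocks are recorded; specification says nothing
    about the value of \<open>Ms\<close> at K - 1.\<close>
  define h where "h xs = (map c xs, map (Ms xs) [0..<K - 1])" for xs
  define W where "W = words {..<q} K \<times> words {..M} (K - 1)"
  have W: "finite W" by (simp add: W_def finite_words)
  have hW: "h ` A \<subseteq> W"
  proof
    fix v assume "v \<in> h ` A"
    then obtain xs where xs: "xs \<in> A" "v = h xs" by auto
    have "set (map c xs) \<subseteq> {..<q}" using A(3)[OF xs(1)] I by auto
    moreover have "set (map (Ms xs) [0..<K - 1]) \<subseteq> {..M}" using yM[OF xs(1)] by (auto simp: good_def)
    ultimately show "v \<in> W" using xs A(2)[OF xs(1)] by (simp add: W_def words_def h_def)
  qed
  obtain v where v: "card A \<le> card W * card {xs\<in>A. h xs = v}" using pigeonhole_fiber[OF A(1) W hW] by blast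
  define F where "F = {xs\<in>A. h xs = v}"
  have cW: "card W \<le> (q * Suc M) ^ K"
  proof -
    have "card W = q ^ K * Suc M ^ (K - 1)" by (simp add: W_def card_cartesian_product card_words)
    also have "\<dots> \<le> q ^ K * Suc M ^ K" by (intro mult_left_mono power_increasing) auto
    finally show ?thesis by (simp only: power_mult_distrib)
  qed
  have diff: "\<exists>j<n. 2 * e < dist ((f ^^ j) (y xs)) ((f ^^ j) (y xs'))"
    if xs: "xs \<in> F" "xs' \<in> F" "xs \<noteq> xs'" for xs xs'
  proof -
    have inA: "xs \<in> A" "xs' \<in> A" using xs by (auto simp: F_def)
    have heq: "h xs = h xs'" using xs by (simp add: F_def)
    then have meq: "map c xs = map c xs'" by (simp add: h_def)
    have Meq: "Ms xs t = Ms xs' t" if "Suc t < K" for t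
    proof -
      have "map (Ms xs) [0..<K - 1] = map (Ms xs') [0..<K - 1]" using heq by (simp add: h_def)
      then show ?thesis using that by (auto simp: map_eq_conv)
    qed
    define zs zs' where "zs = sort_key c xs" and "zs' = sort_key c xs'"
    have len: "length zs = K" "length zs' = K" using A(2) inA by (auto simp: zs_def zs'_def)
    have "zs \<noteq> zs'" using sort_key_class_inject[OF meq] xs(3) by (auto simp: zs_def zs'_def)
    then obtain j where j: "j < K" "zs ! j \<noteq> zs' ! j" using len by (metis nth_equalityI)
    have "map c zs = map c zs'" unfolding zs_def zs'_def map_sort_key meq ..
    then have cj: "c (zs ! j) = c (zs' ! j)" using len j(1) by (metis nth_map)
    have "zs ! j \<in> set zs" "zs' ! j \<in> set zs'" using len j(1) by auto
    then have "zs ! j \<in> I" "zs' ! j \<in> I" using A(3) inA by (auto simp: zs_def zs'_def)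
    from sep[OF this j(2) cj] obtain t where t: "t < N" "4 * e < dist ((f ^^ t) (pt (zs ! j))) ((f ^^ t) (pt (zs' ! j)))" by blast
    \<comment> \<open>Words in one fibre share their gaps, so the j-th blocks of both orbits start
      at the same time and can be compared there. The separation 4 * e of the block points leaves
      more than 2 * e after two shadowing errors.\<close>
    have Teq: "(\<Sum>t<j. N + Ms xs t) = (\<Sum>t<j. N + Ms xs' t)"
      using Meq j(1) by (intro sum.cong) auto
    have tri: "dist a b \<le> dist a u + dist u w + dist b w" for a b u w :: 'a
      using dist_triangle[of a b u] dist_triangle[of u b w] by (simp add: dist_commute)
    define s where "s = t + (\<Sum>t<j. N + Ms xs t)"
    have "dist ((f ^^ t) (pt (zs ! j))) ((f ^^ s) (y xs)) \<le> e"
      using yM[OF inA(1)] j(1) t(1) by (simp add: good_def zs_def s_def)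
    moreover have "dist ((f ^^ t) (pt (zs' ! j))) ((f ^^ s) (y xs')) \<le> e"
      using yM[OF inA(2)] j(1) t(1) unfolding good_def zs'_def s_def Teq by simp
    moreover have "dist ((f ^^ t) (pt (zs ! j))) ((f ^^ t) (pt (zs' ! j))) \<le>
        dist ((f ^^ t) (pt (zs ! j))) ((f ^^ s) (y xs)) + dist ((f ^^ s) (y xs)) ((f ^^ s) (y xs'))
        + dist ((f ^^ t) (pt (zs' ! j))) ((f ^^ s) (y xs'))" by (rule tri)
    ultimately have d: "2 * e < dist ((f ^^ s) (y xs)) ((f ^^ s) (y xs'))" using t(2) by linarith
    have "(\<Sum>t<j. N + Ms xs t) \<le> (\<Sum>t<j. N + M)"
      using yM[OF inA(1)] j(1) by (intro sum_mono) (auto simp: good_def)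
    then have "s < j * (N + M) + N" using t(1) by (simp add: s_def)
    also have "\<dots> \<le> Suc j * (N + M)" by simp
    also have "\<dots> \<le> K * (N + M)" using j(1) by (intro mult_right_mono) auto
    finally have "s < n" using n by simp
    with d show ?thesis by blast
  qed
  have e0: "0 \<le> e" if xs: "xs \<in> F" for xs
  proof -
    have "good xs (y xs) (Ms xs)" using yM xs by (simp add: F_def)
    then have "\<forall>j<K. \<forall>i<N. dist ((f ^^ i) (pt (sort_key c xs ! j))) ((f ^^ (i + (\<Sum>t<j. N + Ms xs t))) (y xs)) \<le> e"
      by (simp add: good_def)
    moreover have "0 < K" "0 < N" using K N by auto
    ultimately have "dist ((f ^^ 0) (pt (sort_key c xs ! 0))) ((f ^^ (0 + (\<Sum>t<0. N + Ms xs t))) (y xs)) \<le> e"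
      by blast
    then show ?thesis using zero_le_dist order_trans by blast
  qed
  have inj: "inj_on y F"
  proof (rule inj_onI, rule ccontr)
    fix xs xs' assume a: "xs \<in> F" "xs' \<in> F" "y xs = y xs'" "xs \<noteq> xs'"
    from diff[OF a(1,2,4)] show False using a(3) e0[OF a(1)] by auto
  qed
  show ?thesis
  proof (intro exI[of _ "y ` F"] conjI ballI)
    show "y ` F \<subseteq> X" using yM by (auto simp: F_def good_def)
    show "finite (y ` F)" using A(1) by (simp add: F_def)
    have "card A \<le> card W * card F" using v by (simp add: F_def)
    also have "\<dots> \<le> (q * Suc M) ^ K * card F" using cW by (rule mult_right_mono) simp
    finally show "card A \<le> (q * Suc M) ^ K * card (y ` F)" by (simp add: card_image[OF inj])
    show "separated n (2 * e) (y ` F)" unfolding separated_def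
    proof (intro ballI impI)
      fix u u' assume "u \<in> y ` F" "u' \<in> y ` F" "u \<noteq> u'"
      then show "\<exists>j<n. 2 * e < dist ((f ^^ j) u) ((f ^^ j) u')" using diff by blast
    qed
    fix u assume "u \<in> y ` F"
    then obtain xs where xs: "xs \<in> A" "u = y xs" by (auto simp: F_def)
    \<comment> \<open>The time K is set to n, so that all orbit segments have length n and whatever
      follows the last block counts as a final gap.\<close>
    define T where "T j = (if j = K then n else \<Sum>t<j. N + Ms xs t)" for j
    have "T j + N \<le> T (Suc j)" if j: "j < K" for j
    proof (cases "Suc j = K")
      case False
      then show ?thesis using j by (simp add: T_def)
    next
      case True
      have "(\<Sum>t<j. N + Ms xs t) \<le> (\<Sum>t<j. N + M)"
        using yM[OF xs(1)] j by (intro sum_mono) (auto simp: good_def)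
      then have "(\<Sum>t<j. N + Ms xs t) + N \<le> Suc j * (N + M)" by simp
      also have "\<dots> \<le> n" using n True by simp
      finally show ?thesis using True j by (simp add: T_def)
    qed
    moreover have "T 0 = 0" "T K = n" using K by (auto simp: T_def)
    moreover have "\<forall>j<K. \<forall>i<N. dist ((f ^^ i) (pt (sort_key c xs ! j))) ((f ^^ (i + T j)) u) \<le> e"
      using yM[OF xs(1)] unfolding good_def xs(2) T_def by auto
    moreover have "\<exists>xs'\<in>A. mset (sort_key c xs) = mset xs'" using xs(1) by auto
    ultimately show "\<exists>zs T. (\<exists>xs\<in>A. mset zs = mset xs) \<and> T 0 = 0 \<and> T K = n \<and> (\<forall>j<K. T j + N \<le> T (Suc j)) \<and>
       (\<forall>j<K. \<forall>i<N. dist ((f ^^ i) (pt (zs ! j))) ((f ^^ (i + T j)) u) \<le> e)" by blast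
  qed
qed

section \<open>Birkhoff sums along glued orbits\<close>

lemma bsum_add: "bsum g (a + b) x = bsum g a x + bsum g b ((f ^^ a) x)"
proof -
  have "bsum g (a + b) x = (\<Sum>j<a. g ((f ^^ j) x)) + (\<Sum>j<b. g ((f ^^ (a + j)) x))"
    unfolding bsum_def by (induction b) (auto simp: add.assoc)
  moreover have "(f ^^ (a + j)) x = (f ^^ j) ((f ^^ a) x)" for j
    by (metis add.commute comp_apply funpow_add)
  ultimately show ?thesis by (simp add: bsum_def)
qed

lemma bsum_bound:
  assumes "x \<in> X" "\<And>x. x \<in> X \<Longrightarrow> \<bar>g x\<bar> \<le> B"
  shows "\<bar>bsum g n x\<bar> \<le> n * B"
proof -
  have "\<bar>bsum g n x\<bar> \<le> (\<Sum>j<n. \<bar>g ((f ^^ j) x)\<bar>)" unfolding bsum_def by (rule sum_abs)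
  also have "\<dots> \<le> (\<Sum>j<n. B)" using assms iter_in by (intro sum_mono) auto
  finally show ?thesis by simp
qed

lemma bsum_close:
  assumes "x \<in> X" "y \<in> X" "\<And>j. j < n \<Longrightarrow> dist ((f ^^ j) x) ((f ^^ j) y) \<le> d"
    and "\<And>x y. x \<in> X \<Longrightarrow> y \<in> X \<Longrightarrow> dist x y \<le> d \<Longrightarrow> \<bar>g x - g y\<bar> \<le> \<omega>"
  shows "\<bar>bsum g n x - bsum g n y\<bar> \<le> n * \<omega>"
proof -
  have "\<bar>bsum g n x - bsum g n y\<bar> \<le> (\<Sum>j<n. \<bar>g ((f ^^ j) x) - g ((f ^^ j) y)\<bar>)"
    unfolding bsum_def sum_subtractf[symmetric] by (rule sum_abs)
  also have "\<dots> \<le> (\<Sum>j<n. \<omega>)" using assms iter_in by (intro sum_mono) auto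
  finally show ?thesis by simp
qed

text \<open>Each shadowed block contributes an error N * \<omega>; the T K - K * N times spent in
  gaps contribute at most B each.\<close>

lemma bsum_shadow:
  assumes y: "y \<in> X" and T: "T 0 = 0" "\<And>j. j < K \<Longrightarrow> T j + N \<le> T (Suc j)"
    and pt: "\<And>j. j < K \<Longrightarrow> pt j \<in> X"
    and sh: "\<And>j i. j < K \<Longrightarrow> i < N \<Longrightarrow> dist ((f ^^ i) (pt j)) ((f ^^ (i + T j)) y) \<le> d"
    and g: "\<And>x. x \<in> X \<Longrightarrow> \<bar>g x\<bar> \<le> B" "\<And>x y. x \<in> X \<Longrightarrow> y \<in> X \<Longrightarrow> dist x y \<le> d \<Longrightarrow> \<bar>g x - g y\<bar> \<le> \<omega>"
  shows "\<bar>bsum g (T K) y - (\<Sum>j<K. bsum g N (pt j))\<bar> \<le> real K * real N * \<omega> + (real (T K) - real K * real N) * B"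
  using T(2) pt sh
proof (induction K)
  case 0
  then show ?case using T(1) by (simp add: bsum_def)
next
  case (Suc K)
  define r where "r = T (Suc K) - (T K + N)"
  have TS: "T (Suc K) = T K + N + r" using Suc.prems(1)[of K] by (simp add: r_def)
  have IH: "\<bar>bsum g (T K) y - (\<Sum>j<K. bsum g N (pt j))\<bar> \<le> real K * real N * \<omega> + (real (T K) - real K * real N) * B"
    using Suc.prems by (intro Suc.IH) auto
  have split: "bsum g (T (Suc K)) y = bsum g (T K) y + bsum g N ((f ^^ T K) y) + bsum g r ((f ^^ (T K + N)) y)"
    unfolding TS bsum_add ..
  have "\<bar>bsum g N (pt K) - bsum g N ((f ^^ T K) y)\<bar> \<le> N * \<omega>"
  proof (rule bsum_close[OF _ _ _ g(2)])
    show "pt K \<in> X" using Suc.prems(2) by simp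
    show "(f ^^ T K) y \<in> X" by (rule iter_in[OF y])
    fix j assume "j < N"
    then show "dist ((f ^^ j) (pt K)) ((f ^^ j) ((f ^^ T K) y)) \<le> d"
      using Suc.prems(3)[of K j] by (simp add: funpow_add)
  qed
  moreover have "\<bar>bsum g r ((f ^^ (T K + N)) y)\<bar> \<le> r * B"
    by (rule bsum_bound[OF iter_in[OF y] g(1)])
  ultimately have "\<bar>bsum g (T (Suc K)) y - (\<Sum>j<Suc K. bsum g N (pt j))\<bar>
      \<le> (real K * real N * \<omega> + (real (T K) - real K * real N) * B) + N * \<omega> + r * B"
    using IH unfolding split sum.lessThan_Suc by linarith
  also have "\<dots> = real (Suc K) * real N * \<omega> + (real (T (Suc K)) - real (Suc K) * real N) * B"
    unfolding TS by (simp add: algebra_simps)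
  finally show ?case .
qed

text \<open>Here invariance does the work of an ergodic theorem: under \<mu> the sum of g over a
  block has mean N times the integral of g, and replacing points by their code points alters it by
  at most N * \<omega>. The other error is the time not covered by blocks, through gaps or rounding,
  weighted by B.\<close>

lemma type_sum_close:
  fixes \<zeta> :: "'a \<Rightarrow> nat" and g :: "'a \<Rightarrow> real"
  assumes \<mu>: "\<mu> \<in> invariant_probs X f" and \<zeta>: "\<zeta> ` X \<subseteq> {..<L}" "\<And>u. {x\<in>X. \<zeta> x = u} \<in> sets (borel_on X)"
    and ae: "AE x in \<mu>. \<forall>j<N. dist ((f ^^ j) (pt (\<zeta> x))) ((f ^^ j) x) \<le> d"
    and pt: "\<And>i. i < L \<Longrightarrow> pt i \<in> X"
    and g: "continuous_on X g" "\<And>x. x \<in> X \<Longrightarrow> \<bar>g x\<bar> \<le> B"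
      "\<And>x y. x \<in> X \<Longrightarrow> y \<in> X \<Longrightarrow> dist x y \<le> d \<Longrightarrow> \<bar>g x - g y\<bar> \<le> \<omega>"
    and N: "1 \<le> N" and n: "K * N \<le> n"
  shows "\<bar>(\<Sum>i<L. real (nat \<lfloor>real K * measure \<mu> {x\<in>X. \<zeta> x = i}\<rfloor>) * bsum g N (pt i)) - n * integral\<^sup>L \<mu> g\<bar>
    \<le> (real n - N * real (\<Sum>i<L. nat \<lfloor>real K * measure \<mu> {x\<in>X. \<zeta> x = i}\<rfloor>)) * B + n * \<omega>"
proof -
  have p: "\<mu> \<in> probs X" by (rule invariant_in_probs[OF \<mu>])
  interpret prob_space \<mu> by (rule probsD[OF p])
  define P where "P i = measure \<mu> {x\<in>X. \<zeta> x = i}" for i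
  define k where "k i = real (nat \<lfloor>real K * P i\<rfloor>)" for i
  have N0: "0 < real N" using N by simp
  have gm: "g \<in> borel_measurable (borel_on X)" by (rule continuous_measurable_borel_on[OF g(1)])
  have gi: "integrable \<mu> (\<lambda>x. g ((f ^^ j) x))" for j
    using iter_in by (intro continuous_integrable[OF compact _ p] continuous_on_compose2[OF g(1) iter_cont]) auto
  have bi: "integrable \<mu> (bsum g N)" unfolding bsum_def[abs_def] by (intro Bochner_Integration.integrable_sum gi)
  have intb: "integral\<^sup>L \<mu> (bsum g N) = N * integral\<^sup>L \<mu> g"
    unfolding bsum_def by (subst Bochner_Integration.integral_sum[OF gi]) (simp add: invariant_integral_iter[OF \<mu> gm])
  have intz: "(\<integral>x. bsum g N (pt (\<zeta> x)) \<partial>\<mu>) = (\<Sum>i<L. P i * bsum g N (pt i))"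
    unfolding P_def by (rule integral_finite_range[OF p _ \<zeta>, of "\<lambda>i. bsum g N (pt i)"]) simp
  have zi: "integrable \<mu> (\<lambda>x. bsum g N (pt (\<zeta> x)))"
  proof (rule integrable_const_bound[where B = "N * B"])
    show "AE x in \<mu>. norm (bsum g N (pt (\<zeta> x))) \<le> N * B"
      using \<zeta>(1) by (intro AE_I2) (auto simp: probsD[OF p] intro!: bsum_bound pt g(2))
    have "(\<lambda>x. bsum g N (pt (\<zeta> x))) -` S \<inter> space (borel_on X) \<in> sets (borel_on X)" for S
    proof -
      have "(\<lambda>x. bsum g N (pt (\<zeta> x))) -` S \<inter> space (borel_on X) = (\<Union>i\<in>{i. i < L \<and> bsum g N (pt i) \<in> S}. {x\<in>X. \<zeta> x = i})"
        using \<zeta>(1) by auto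
      then show ?thesis using \<zeta>(2) by (auto intro!: sets.finite_UN)
    qed
    then have "(\<lambda>x. bsum g N (pt (\<zeta> x))) \<in> borel_measurable (borel_on X)" by (intro borel_measurableI)
    then show "(\<lambda>x. bsum g N (pt (\<zeta> x))) \<in> borel_measurable \<mu>" by (simp add: probsD[OF p] cong: measurable_cong_sets)
  qed
  define D where "D = (\<Sum>i<L. P i * bsum g N (pt i)) - N * integral\<^sup>L \<mu> g"
  have "\<bar>D\<bar> \<le> N * \<omega>"
  proof -
    have "D = (\<integral>x. bsum g N (pt (\<zeta> x)) - bsum g N x \<partial>\<mu>)"
      unfolding D_def intz[symmetric] intb[symmetric] by (rule Bochner_Integration.integral_diff[OF zi bi, symmetric])
    also have "\<bar>\<dots>\<bar> \<le> (\<integral>x. \<bar>bsum g N (pt (\<zeta> x)) - bsum g N x\<bar> \<partial>\<mu>)" by (rule integral_abs_bound)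
    also have "\<dots> \<le> (\<integral>x. N * \<omega> \<partial>\<mu>)"
    proof (rule integral_mono_AE)
      show "integrable \<mu> (\<lambda>x. \<bar>bsum g N (pt (\<zeta> x)) - bsum g N x\<bar>)"
        by (intro integrable_abs Bochner_Integration.integrable_diff zi bi)
      show "AE x in \<mu>. \<bar>bsum g N (pt (\<zeta> x)) - bsum g N x\<bar> \<le> N * \<omega>"
        using ae AE_space
      proof eventually_elim
        case (elim x)
        then have x: "x \<in> X" by (simp add: probsD[OF p])
        then have "pt (\<zeta> x) \<in> X" using \<zeta>(1) by (intro pt) auto
        then show ?case using elim by (intro bsum_close[OF _ x _ g(3)]) auto
      qed
    qed simp
    also have "\<dots> = N * \<omega>" by (simp add: prob_space)
    finally show ?thesis .
  qed
  have Psum: "(\<Sum>i<L. P i) = 1" unfolding P_def by (rule sum_measure_fibers[OF p _ \<zeta>]) simp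
  have kle: "N * k i \<le> n * P i" for i
  proof -
    have P0: "0 \<le> P i" by (simp add: P_def)
    then have "0 \<le> real K * P i" by simp
    then have "k i \<le> K * P i" unfolding k_def by linarith
    then have "N * k i \<le> N * (K * P i)" by (intro mult_left_mono) auto
    also have "\<dots> = real (K * N) * P i" by simp
    also have "\<dots> \<le> n * P i" using n P0 by (intro mult_right_mono) (simp_all only: of_nat_le_iff)
    finally show ?thesis .
  qed
  define b where "b i = bsum g N (pt i) / N" for i
  have bB: "\<bar>b i\<bar> \<le> B" if "i < L" for i
    unfolding b_def using bsum_bound[OF pt[OF that] g(2), where n = N] N0 by (simp add: abs_divide pos_divide_le_eq mult.commute)
  have bN: "bsum g N (pt i) = N * b i" for i using N0 by (simp add: b_def)
  \<comment> \<open>The ideal share of time for block i is n * P i, the actual one N * k i. By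
    \<open>kle\<close> the differences are all nonnegative, so their absolute values add up to
    exactly the uncovered time.\<close>
  have "(\<Sum>i<L. k i * bsum g N (pt i)) - n * integral\<^sup>L \<mu> g
     = (\<Sum>i<L. (N * k i - n * P i) * b i) + (n / N) * D"
  proof -
    have "(n / N) * D = (\<Sum>i<L. n * P i * b i) - n * integral\<^sup>L \<mu> g"
      unfolding D_def bN using N0 by (simp add: right_diff_distrib sum_distrib_left field_simps)
    moreover have "(\<Sum>i<L. k i * (N * b i)) = (\<Sum>i<L. (N * k i - n * P i) * b i) + (\<Sum>i<L. n * P i * b i)"
      unfolding sum.distrib[symmetric] by (intro sum.cong refl) (simp add: algebra_simps)
    ultimately show ?thesis unfolding bN by simp
  qed
  also have "\<bar>\<dots>\<bar> \<le> \<bar>\<Sum>i<L. (N * k i - n * P i) * b i\<bar> + \<bar>(n / N) * D\<bar>" by (rule abs_triangle_ineq)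
  also have "\<bar>\<Sum>i<L. (N * k i - n * P i) * b i\<bar> \<le> (\<Sum>i<L. \<bar>(N * k i - n * P i) * b i\<bar>)" by (rule sum_abs)
  also have "\<dots> \<le> (\<Sum>i<L. (n * P i - N * k i) * B)"
  proof (rule sum_mono)
    fix i assume "i \<in> {..<L}"
    then show "\<bar>(N * k i - n * P i) * b i\<bar> \<le> (n * P i - N * k i) * B"
      unfolding abs_mult using bB[of i] kle[of i] by (intro mult_mono) auto
  qed
  also have "\<dots> = (n * (\<Sum>i<L. P i) - N * (\<Sum>i<L. k i)) * B"
    by (simp add: sum_distrib_right[symmetric] sum_distrib_left sum_subtractf)
  also have "\<bar>(n / N) * D\<bar> \<le> (n / N) * (N * \<omega>)"
    unfolding abs_mult using \<open>\<bar>D\<bar> \<le> N * \<omega>\<close> by (intro mult_mono) auto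
  also have "(n / N) * (N * \<omega>) = n * \<omega>" using N0 by simp
  finally show ?thesis unfolding Psum by (simp add: k_def P_def)
qed

lemma continuous_bsum: "continuous_on X g \<Longrightarrow> continuous_on X (bsum g n)"
  unfolding bsum_def[abs_def] using iter_in
  by (intro continuous_on_sum continuous_on_compose2[OF _ iter_cont, of X g]) auto

lemma empirical_integral_bsum:
  assumes "0 < n" "x \<in> X" "continuous_on X g"
  shows "integral\<^sup>L (empirical X f n x) g = bsum g n x / n"
  unfolding bsum_def
  by (rule empirical_integral[OF assms(1,2) continuous_measurable_borel_on[OF assms(3)]])

text \<open>Integrals of continuous functions against empirical measures are Birkhoff averages,
  hence continuous in the point. This supplies measurability of the events in the lower
  bound.\<close>

lemma wk_open_empirical:
  assumes G: "wk_open X G" and n: "0 < n"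
  shows "openin (top_of_set X) {x\<in>X. empirical X f n x \<in> G}"
proof (subst openin_subopen, intro ballI)
  fix x assume "x \<in> {x\<in>X. empirical X f n x \<in> G}"
  then have x: "x \<in> X" "empirical X f n x \<in> G" by auto
  obtain S e where S: "finite S" "\<forall>g\<in>S. continuous_on X g" "e > 0"
    "{\<nu>\<in>probs X. \<forall>g\<in>S. \<bar>integral\<^sup>L \<nu> g - integral\<^sup>L (empirical X f n x) g\<bar> < (e::real)} \<subseteq> G"
    using G x(2) unfolding wk_open_def by blast
  define T where "T = X \<inter> (\<Inter>g\<in>S. X \<inter> (\<lambda>y. bsum g n y / n) -` ball (bsum g n x / n) e)"
  have "openin (top_of_set X) T"
  proof (cases "S = {}")
    case False
    have "openin (top_of_set X) (\<Inter>g\<in>S. X \<inter> (\<lambda>y. bsum g n y / n) -` ball (bsum g n x / n) e)"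
      using S n by (intro openin_INT2 False continuous_openin_preimage_gen continuous_intros continuous_bsum) auto
    then show ?thesis unfolding T_def by (intro openin_Int) auto
  qed (simp add: T_def)
  moreover have "x \<in> T" using x S(3) by (auto simp: T_def)
  moreover have "T \<subseteq> {x\<in>X. empirical X f n x \<in> G}"
  proof
    fix y assume y: "y \<in> T"
    then have yX: "y \<in> X" by (simp add: T_def)
    have "\<bar>integral\<^sup>L (empirical X f n y) g - integral\<^sup>L (empirical X f n x) g\<bar> < e" if g: "g \<in> S" for g
    proof -
      have "y \<in> (\<lambda>y. bsum g n y / n) -` ball (bsum g n x / n) e" using y g unfolding T_def by blast
      then have "\<bar>bsum g n y / n - bsum g n x / n\<bar> < e" by (auto simp: dist_real_def abs_minus_commute)
      then show ?thesis using S(2) g n x yX by (simp add: empirical_integral_bsum)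
    qed
    then have "empirical X f n y \<in> G" using S(4) empirical_in_probs[OF n yX] by auto
    with yX show "y \<in> {x\<in>X. empirical X f n x \<in> G}" by simp
  qed
  ultimately show "\<exists>T. openin (top_of_set X) T \<and> x \<in> T \<and> T \<subseteq> {x\<in>X. empirical X f n x \<in> G}" by blast
qed

text \<open>
  The points \<open>pt i\<close> are separated only within one class \<open>c i\<close>; the index \<open>L\<close> is a dummy code for
  the null set of wandering points.
\<close>

lemma separated_code:
  fixes Xs :: "nat \<Rightarrow> 'a set"
  assumes \<mu>: "\<mu> \<in> invariant_probs X f" and d: "0 < d"
    and Xs: "\<And>i. i < q \<Longrightarrow> compact (Xs i) \<and> Xs i \<subseteq> X" "nonwandering X f = (\<Union>i<q. Xs i)"
  obtains L pt c and \<zeta> :: "'a \<Rightarrow> nat" where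
    "\<And>i. i < L \<Longrightarrow> c i < q \<and> pt i \<in> Xs (c i)"
    "\<And>i j. i < L \<Longrightarrow> j < L \<Longrightarrow> i \<noteq> j \<Longrightarrow> c i = c j \<Longrightarrow> \<exists>t<N. d < dist ((f ^^ t) (pt i)) ((f ^^ t) (pt j))"
    "\<zeta> ` X \<subseteq> {..<Suc L}" "\<And>u. {x\<in>X. \<zeta> x = u} \<in> sets (borel_on X)" "measure \<mu> {x\<in>X. \<zeta> x = L} = 0"
    "\<And>x j. x \<in> X \<Longrightarrow> \<zeta> x < L \<Longrightarrow> j < N \<Longrightarrow> dist ((f ^^ j) (pt (\<zeta> x))) ((f ^^ j) x) \<le> d"
proof -
  have p: "\<mu> \<in> probs X" by (rule invariant_in_probs[OF \<mu>])
  have Xsm: "Xs i \<in> sets (borel_on X)" if "i < q" for i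
  proof -
    have "closedin (top_of_set X) (X \<inter> Xs i)" using Xs(1)[OF that] by (intro closedin_closed_Int compact_imp_closed) auto
    moreover have "X \<inter> Xs i = Xs i" using Xs(1)[OF that] by auto
    ultimately show ?thesis using closedin_borel_on by metis
  qed
  \<comment> \<open>With disjoint pieces a code point lies in exactly one of them, so the class
    later picked by \<open>SOME\<close> is the piece it was chosen from.\<close>
  define Y where "Y i = Xs i - (\<Union>j<i. Xs j)" for i
  have YX: "Y i \<subseteq> X" if "i < q" for i using Xs(1)[OF that] by (auto simp: Y_def)
  have Ym: "Y i \<in> sets (borel_on X)" if "i < q" for i
  proof -
    have "Xs j \<in> sets (borel_on X)" if "j < i" for j
      by (rule Xsm[OF less_trans[OF that \<open>i < q\<close>]])
    then show ?thesis unfolding Y_def using Xsm[OF that] by (intro sets.Diff sets.finite_UN) simp_all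
  qed
  have Ydisj: "i = j" if "x \<in> Y i" "x \<in> Y j" for x i j
    using that by (cases i j rule: linorder_cases) (auto simp: Y_def)
  have Ycov: "\<exists>i<q. x \<in> Y i" if "x \<in> nonwandering X f" for x
  proof -
    have ex: "\<exists>i. i < q \<and> x \<in> Xs i" using that Xs(2) by auto
    define i where "i = (LEAST i. i < q \<and> x \<in> Xs i)"
    have i: "i < q" "x \<in> Xs i" using LeastI_ex[OF ex] by (auto simp: i_def)
    have "x \<notin> Xs j" if "j < i" for j
      using not_less_Least[of j "\<lambda>i. i < q \<and> x \<in> Xs i"] that i(1) by (auto simp: i_def)
    then show ?thesis using i by (auto simp: Y_def)
  qed
  define R where "R i E \<longleftrightarrow> E \<subseteq> Y i \<and> finite E \<and> separated N d E \<and>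
    (\<forall>x. x \<in> Y i \<longrightarrow> (\<exists>y\<in>E. \<forall>j<N. dist ((f ^^ j) y) ((f ^^ j) x) \<le> d))" for i E
  have "\<exists>E. R i E" if iq: "i < q" for i
  proof -
    obtain E where E: "E \<subseteq> Y i" "finite E" "separated N d E"
      "\<And>x. x \<in> Y i \<Longrightarrow> \<exists>y\<in>E. \<forall>j<N. dist ((f ^^ j) y) ((f ^^ j) x) \<le> d"
      by (rule maximal_separated[OF p d YX[OF iq], of N]) (rule that)
    show ?thesis unfolding R_def by (intro exI[of _ E] conjI allI impI E)
  qed
  then obtain E where E: "\<And>i. i < q \<Longrightarrow> R i (E i)" by metis
  define U where "U = (\<Union>i<q. E i)"
  have "finite U" using E by (auto simp: U_def R_def)
  then obtain us where us: "set us = U" "distinct us" using finite_distinct_list by blast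
  define L where "L = length us"
  define pt where "pt i = us ! i" for i
  define c where "c i = (SOME k. k < q \<and> pt i \<in> E k)" for i
  have c: "c i < q \<and> pt i \<in> E (c i)" if "i < L" for i
  proof -
    have "pt i \<in> U" using that us(1) by (auto simp: pt_def L_def)
    then have "\<exists>k. k < q \<and> pt i \<in> E k" by (auto simp: U_def)
    from someI_ex[OF this] show ?thesis by (simp add: c_def)
  qed
  have EY: "E i \<subseteq> Y i" and Esep: "separated N d (E i)"
    and Ecov: "\<And>x. x \<in> Y i \<Longrightarrow> \<exists>y\<in>E i. \<forall>j<N. dist ((f ^^ j) y) ((f ^^ j) x) \<le> d" if "i < q" for i
    using E[OF that] unfolding R_def by blast+
  define S where "S i = Y (c i) \<inter> bowen_ball X f N (pt i) d" for i
  have Sm: "S i \<in> sets (borel_on X)" if "i < L" for i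
    unfolding S_def using Ym c[OF that] bowen_ball_sets by (intro sets.Int) auto
  \<comment> \<open>The first matching ball decides; the alternative i = L lets the search succeed
    for every x.\<close>
  define \<zeta> where "\<zeta> x = (LEAST i. i = L \<or> i < L \<and> x \<in> S i)" for x
  have zL: "\<zeta> x \<le> L" for x unfolding \<zeta>_def by (rule Least_le) simp
  have zI: "\<zeta> x = L \<or> \<zeta> x < L \<and> x \<in> S (\<zeta> x)" for x
    unfolding \<zeta>_def by (rule LeastI[of _ L]) simp
  have zmin: "x \<notin> S j" if "j < \<zeta> x" for x j
    using not_less_Least[of j "\<lambda>i. i = L \<or> i < L \<and> x \<in> S i"] that zL[of x] by (auto simp: \<zeta>_def)
  have zeq: "\<zeta> x = i" if "i < L" "x \<in> S i" "\<And>j. j < i \<Longrightarrow> x \<notin> S j" for x i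
    unfolding \<zeta>_def using that by (intro Least_equality) (auto simp: not_less[symmetric])
  have SX: "S i \<subseteq> X" for i by (auto simp: S_def bowen_ball_def)
  have f1: "{x\<in>X. \<zeta> x = u} = S u - (\<Union>j<u. S j)" if "u < L" for u
  proof (intro set_eqI iffI)
    fix x assume "x \<in> {x\<in>X. \<zeta> x = u}"
    then have "\<zeta> x = u" by simp
    then show "x \<in> S u - (\<Union>j<u. S j)" using zI[of x] zmin[of _ x] that by auto
  next
    fix x assume x: "x \<in> S u - (\<Union>j<u. S j)"
    then have "\<zeta> x = u" using that by (intro zeq) auto
    then show "x \<in> {x\<in>X. \<zeta> x = u}" using x SX[of u] by auto
  qed
  have f2: "{x\<in>X. \<zeta> x = L} = X - (\<Union>j<L. S j)"
  proof (intro set_eqI iffI)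
    fix x assume "x \<in> {x\<in>X. \<zeta> x = L}"
    then show "x \<in> X - (\<Union>j<L. S j)" using zmin by auto
  next
    fix x assume x: "x \<in> X - (\<Union>j<L. S j)"
    then show "x \<in> {x\<in>X. \<zeta> x = L}" using zI[of x] by auto
  qed
  have f3: "{x\<in>X. \<zeta> x = u} = {}" if "L < u" for u using zL that by (auto simp: not_le[symmetric])
  show ?thesis
  proof (rule that[of L c pt \<zeta>])
    show "c i < q \<and> pt i \<in> Xs (c i)" if "i < L" for i using c[OF that] EY by (auto simp: Y_def)
    show "\<exists>t<N. d < dist ((f ^^ t) (pt i)) ((f ^^ t) (pt j))"
      if ij: "i < L" "j < L" "i \<noteq> j" "c i = c j" for i j
    proof -
      have "pt i \<noteq> pt j" using ij us(2) by (simp add: pt_def L_def nth_eq_iff_index_eq)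
      moreover have "pt i \<in> E (c i)" "pt j \<in> E (c i)" "c i < q"
        using c[OF ij(1)] c[OF ij(2)] ij(4) by simp_all
      ultimately show ?thesis using Esep[of "c i"] unfolding separated_def by blast
    qed
    show "\<zeta> ` X \<subseteq> {..<Suc L}" using zL by (auto simp: less_Suc_eq_le)
    show "{x\<in>X. \<zeta> x = u} \<in> sets (borel_on X)" for u
    proof (cases u L rule: linorder_cases)
      case less
      then show ?thesis unfolding f1[OF less] using Sm by (intro sets.Diff sets.finite_UN) auto
    next
      case equal
      have "(\<Union>j<L. S j) \<in> sets (borel_on X)" using Sm by (intro sets.finite_UN) auto
      from sets.compl_sets[OF this] show ?thesis unfolding equal f2 by simp
    next
      case greater
      then show ?thesis unfolding f3[OF greater] by simp
    qed
    have nwm: "nonwandering X f \<in> sets (borel_on X)" unfolding Xs(2) using Xsm by (intro sets.finite_UN) auto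
    have "X - (\<Union>j<L. S j) \<subseteq> X - nonwandering X f"
    proof -
      have "x \<in> (\<Union>j<L. S j)" if x: "x \<in> nonwandering X f" for x
      proof -
        obtain k where k: "k < q" "x \<in> Y k" using Ycov[OF x] by blast
        obtain y where y: "y \<in> E k" "\<forall>j<N. dist ((f ^^ j) y) ((f ^^ j) x) \<le> d" using Ecov[OF k] by blast
        have "y \<in> set us" using y(1) k(1) us(1) by (auto simp: U_def)
        then obtain i where i: "i < L" "pt i = y" by (auto simp: in_set_conv_nth L_def pt_def)
        have "y \<in> Y (c i)" "y \<in> Y k" using c[OF i(1)] i(2) EY y(1) k(1) by blast+
        then have "c i = k" by (rule Ydisj)
        then have "x \<in> S i" using k YX[OF k(1)] y(2) i(2) by (auto simp: S_def bowen_ball_def)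
        then show ?thesis using i(1) by blast
      qed
      then show ?thesis by blast
    qed
    interpret prob_space \<mu> by (rule probsD[OF p])
    have "measure \<mu> (X - (\<Union>j<L. S j)) \<le> measure \<mu> (X - nonwandering X f)"
      using \<open>X - (\<Union>j<L. S j) \<subseteq> X - nonwandering X f\<close> sets.compl_sets[OF nwm]
      by (intro finite_measure_mono) (auto simp: probsD[OF p])
    then show "measure \<mu> {x\<in>X. \<zeta> x = L} = 0"
      unfolding f2 using nonwandering_full[OF \<mu> nwm] by (simp add: measure_le_0_iff)
    show "dist ((f ^^ j) (pt (\<zeta> x))) ((f ^^ j) x) \<le> d" if "x \<in> X" "\<zeta> x < L" "j < N" for x j
      using zI[of x] that by (auto simp: S_def bowen_ball_def)
  qed
qed

section \<open>Decoding a partition through compact cores\<close>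

text \<open>The Fano error per letter, rewritten with \<open>eta0\<close>, is continuous in \<beta>
  and vanishes at 0.\<close>

lemma small_error_rate:
  assumes "0 < \<delta>" "1 \<le> (V::nat)"
  obtains \<beta> :: real where "0 < \<beta>" "\<beta> < 1" "- ln (1 - \<beta>) + \<beta> * ln (V / \<beta>) \<le> \<delta>"
proof -
  define b where "b n = 1 / real (Suc (Suc n))" for n
  have b: "0 < b n" "b n < 1" for n by (auto simp: b_def)
  have lim: "b \<longlonglongrightarrow> 0"
    unfolding b_def using LIMSEQ_Suc[OF LIMSEQ_Suc[OF lim_const_over_n[of "1::real"]]] by simp
  have "(\<lambda>n. - ln (1 - b n) + (b n * ln V - eta0 (b n))) \<longlonglongrightarrow> - ln (1 - 0) + (0 * ln V - eta0 0)"
    using b by (intro tendsto_intros tendsto_eta0 lim) (auto simp: less_imp_le)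
  then have "(\<lambda>n. - ln (1 - b n) + (b n * ln V - eta0 (b n))) \<longlonglongrightarrow> 0" by (simp add: eta0_def)
  then have "\<forall>\<^sub>F n in sequentially. - ln (1 - b n) + (b n * ln V - eta0 (b n)) < \<delta>"
    using assms(1) by (rule order_tendstoD)
  then obtain n where n: "- ln (1 - b n) + (b n * ln V - eta0 (b n)) < \<delta>" using eventually_happens by force
  show ?thesis
  proof (rule that[OF b])
    have "b n * ln (V / b n) = b n * ln V - eta0 (b n)"
      using b[of n] assms(2) by (simp add: ln_div eta0_eq right_diff_distrib)
    then show "- ln (1 - b n) + b n * ln (V / b n) \<le> \<delta>" using n by linarith
  qed
qed

lemma finite_uniform_modulus:
  fixes S :: "('a \<Rightarrow> real) set"
  assumes "finite S" "\<And>g. g \<in> S \<Longrightarrow> continuous_on X g" "0 < \<omega>"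
  shows "\<exists>d>0. \<forall>g\<in>S. \<forall>x\<in>X. \<forall>y\<in>X. dist x y \<le> d \<longrightarrow> \<bar>g x - g y\<bar> \<le> \<omega>"
proof (rule finite_positive_lower_bound[OF assms(1)])
  fix g assume "g \<in> S"
  then have "uniformly_continuous_on X g" using assms(2) compact by (intro compact_uniformly_continuous)
  then obtain d where d: "0 < d" "\<forall>x\<in>X. \<forall>x'\<in>X. dist x' x < d \<longrightarrow> dist (g x') (g x) < \<omega>"
    using assms(3) unfolding uniformly_continuous_on_def by blast
  show "\<exists>d>0. \<forall>x\<in>X. \<forall>y\<in>X. dist x y \<le> d \<longrightarrow> \<bar>g x - g y\<bar> \<le> \<omega>"
  proof (intro exI[of _ "d/2"] conjI ballI impI)
    fix x y assume xy: "x \<in> X" "y \<in> X" "dist x y \<le> d / 2"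
    then have "dist x y < d" using d(1) by linarith
    then have "dist (g x) (g y) < \<omega>" using d(2) xy by blast
    then show "\<bar>g x - g y\<bar> \<le> \<omega>" by (simp add: dist_real_def)
  qed (use d in simp)
qed auto

text \<open>Inner regularity with error \<beta> / card P for each cell gives disjoint compact
  subsets, which have positive mutual distance. Cells of a Borel partition may touch, but
  approximate positions suffice to tell their cores apart.\<close>

lemma partition_cores:
  assumes \<mu>: "\<mu> \<in> probs X" and P: "P \<in> fin_partitions X" and \<beta>: "0 < \<beta>"
  obtains C d where "\<And>A. A \<in> P \<Longrightarrow> C A \<subseteq> A" "(\<Union>A\<in>P. C A) \<in> sets (borel_on X)"
    "measure \<mu> (X - (\<Union>A\<in>P. C A)) \<le> \<beta>" "0 < d"
    "\<And>A B x y. A \<in> P \<Longrightarrow> B \<in> P \<Longrightarrow> A \<noteq> B \<Longrightarrow> x \<in> C A \<Longrightarrow> y \<in> C B \<Longrightarrow> d \<le> dist x y"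
proof -
  interpret prob_space \<mu> by (rule probsD[OF \<mu>])
  have P': "finite P" "P \<subseteq> sets (borel_on X)" "\<Union>P = X" "disjoint P" using P by (auto simp: fin_partitions_def)
  have "P \<noteq> {}" using P'(3) not_empty probsD(2)[OF \<mu>] by auto
  then have cP: "0 < card P" using P'(1) by (simp add: card_gt_0_iff)
  define \<gamma> where "\<gamma> = \<beta> / card P"
  have \<gamma>: "0 < \<gamma>" using \<beta> cP by (simp add: \<gamma>_def)
  have "\<exists>C. closedin (top_of_set X) C \<and> C \<subseteq> A \<and> measure \<mu> (A - C) < \<gamma>" if "A \<in> P" for A
  proof -
    have A: "A \<in> sets (borel_on X)" using that P'(2) by auto
    obtain C where "closedin (top_of_set X) C" "C \<subseteq> A" "measure \<mu> (A - C) < \<gamma>"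
      by (rule borel_on_inner_regular[OF \<mu> A \<gamma>]) (rule that)
    then show ?thesis by blast
  qed
  then obtain C where C: "\<And>A. A \<in> P \<Longrightarrow> closedin (top_of_set X) (C A)" "\<And>A. A \<in> P \<Longrightarrow> C A \<subseteq> A"
    "\<And>A. A \<in> P \<Longrightarrow> measure \<mu> (A - C A) < \<gamma>" by metis
  have Cm: "C A \<in> sets (borel_on X)" if "A \<in> P" for A using C(1)[OF that] by (rule closedin_borel_on)
  have Cc: "compact (C A)" if "A \<in> P" for A using C(1)[OF that] compact closedin_compact by blast
  have "\<exists>d>0. \<forall>AB\<in>P \<times> P. fst AB \<noteq> snd AB \<longrightarrow> (\<forall>x\<in>C (fst AB). \<forall>y\<in>C (snd AB). d \<le> dist x y)"
  proof (rule finite_positive_lower_bound)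
    show "finite (P \<times> P)" using P'(1) by simp
    fix AB assume AB: "AB \<in> P \<times> P"
    show "\<exists>d>0. fst AB \<noteq> snd AB \<longrightarrow> (\<forall>x\<in>C (fst AB). \<forall>y\<in>C (snd AB). d \<le> dist x y)"
    proof (cases "fst AB = snd AB")
      case False
      have m: "fst AB \<in> P" "snd AB \<in> P" using AB by auto
      then have "fst AB \<inter> snd AB = {}" using P'(4) False by (auto simp: disjoint_def)
      then have "C (fst AB) \<inter> C (snd AB) = {}" using C(2)[OF m(1)] C(2)[OF m(2)] by blast
      from separate_compacts[OF Cc[OF m(1)] Cc[OF m(2)] this]
      obtain d where "0 < d" "\<And>x y. x \<in> C (fst AB) \<Longrightarrow> y \<in> C (snd AB) \<Longrightarrow> d \<le> dist x y" by blast
      then show ?thesis by blast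
    qed (auto intro: exI[of _ 1])
  qed (auto intro: order_trans)
  then obtain d where d: "0 < d" "\<forall>AB\<in>P \<times> P. fst AB \<noteq> snd AB \<longrightarrow> (\<forall>x\<in>C (fst AB). \<forall>y\<in>C (snd AB). d \<le> dist x y)" by blast
  show ?thesis
  proof (rule that[OF C(2) _ _ d(1)])
    show "(\<Union>A\<in>P. C A) \<in> sets (borel_on X)" using P'(1) Cm by (intro sets.finite_UN) auto
    have dm: "A - C A \<in> sets \<mu>" if "A \<in> P" for A using Cm[OF that] P'(2) that by (auto simp: probsD[OF \<mu>])
    have "measure \<mu> (X - (\<Union>A\<in>P. C A)) \<le> measure \<mu> (\<Union>A\<in>P. A - C A)"
      using P'(1,3) dm by (intro finite_measure_mono sets.finite_UN) auto
    also have "\<dots> \<le> (\<Sum>A\<in>P. measure \<mu> (A - C A))"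
      using P'(1) dm by (intro finite_measure_subadditive_finite) auto
    also have "\<dots> \<le> (\<Sum>A\<in>P. \<gamma>)" using C(3) by (intro sum_mono) (auto simp: less_imp_le)
    also have "\<dots> = \<beta>" using cP by (simp add: \<gamma>_def)
    finally show "measure \<mu> (X - (\<Union>A\<in>P. C A)) \<le> \<beta>" .
    show "d \<le> dist x y" if "A \<in> P" "B \<in> P" "A \<noteq> B" "x \<in> C A" "y \<in> C B" for A B x y
      using d(2)[rule_format, of "(A, B)"] that by auto
  qed
qed

text \<open>The common upper bound is the reciprocal of a common positive lower bound, which
  \<open>finite_positive_lower_bound\<close> supplies.\<close>

lemma finite_common_bound:
  fixes S :: "('a \<Rightarrow> real) set"
  assumes "finite S" "\<And>g. g \<in> S \<Longrightarrow> continuous_on X g"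
  obtains B where "0 < B" "\<And>g x. g \<in> S \<Longrightarrow> x \<in> X \<Longrightarrow> \<bar>g x\<bar> \<le> B"
proof -
  have "\<exists>d>0. \<forall>g\<in>S. \<forall>x\<in>X. \<bar>g x\<bar> * d \<le> 1"
  proof (rule finite_positive_lower_bound[OF assms(1)])
    fix g assume "g \<in> S"
    then obtain B where B: "0 < B" "\<And>x. x \<in> X \<Longrightarrow> \<bar>g x\<bar> \<le> B"
      using continuous_on_compact_bounded[OF compact assms(2)] by metis
    then show "\<exists>d>0. \<forall>x\<in>X. \<bar>g x\<bar> * d \<le> 1" by (intro exI[of _ "1 / B"]) auto
  next
    fix g :: "'a \<Rightarrow> real" and d d' :: real assume d: "\<forall>x\<in>X. \<bar>g x\<bar> * d \<le> 1" "0 < d'" "d' \<le> d"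
    show "\<forall>x\<in>X. \<bar>g x\<bar> * d' \<le> 1"
    proof
      fix x assume "x \<in> X"
      then have "\<bar>g x\<bar> * d \<le> 1" using d by blast
      moreover have "\<bar>g x\<bar> * d' \<le> \<bar>g x\<bar> * d" using d by (intro mult_left_mono) auto
      ultimately show "\<bar>g x\<bar> * d' \<le> 1" by linarith
    qed
  qed
  then obtain d where d: "0 < d" "\<forall>g\<in>S. \<forall>x\<in>X. \<bar>g x\<bar> * d \<le> 1" by blast
  then show ?thesis by (intro that[of "1 / d"]) (auto simp: pos_le_divide_eq)
qed

text \<open>The guess at time j is a cell whose core comes within d of the j-th iterate of the code
  point. Cores are more than 2 * d apart, so the guess can fail only on the null set where \<zeta> x
  = L or where the j-th iterate of x misses all cores; by invariance the latter has the same measure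
  as missing them at time 0.\<close>

lemma code_error:
  assumes \<mu>: "\<mu> \<in> invariant_probs X f" and P: "P \<in> fin_partitions X"
    and l: "l ` X \<subseteq> P" "\<And>x. x \<in> X \<Longrightarrow> x \<in> l x"
    and C: "\<And>A. A \<in> P \<Longrightarrow> C A \<subseteq> A" "(\<Union>A\<in>P. C A) \<in> sets (borel_on X)" "measure \<mu> (X - (\<Union>A\<in>P. C A)) \<le> \<beta>"
    and dist: "\<And>A B x y. A \<in> P \<Longrightarrow> B \<in> P \<Longrightarrow> A \<noteq> B \<Longrightarrow> x \<in> C A \<Longrightarrow> y \<in> C B \<Longrightarrow> 2 * d < dist x y"
    and \<zeta>: "\<And>u. {x\<in>X. \<zeta> x = u} \<in> sets (borel_on X)" "measure \<mu> {x\<in>X. \<zeta> x = (L::nat)} = 0" "\<zeta> ` X \<subseteq> {..<Suc L}"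
      "\<And>x j. x \<in> X \<Longrightarrow> \<zeta> x < L \<Longrightarrow> j < N \<Longrightarrow> dist ((f ^^ j) (pt (\<zeta> x))) ((f ^^ j) x) \<le> d"
  obtains G where "\<And>j. j < N \<Longrightarrow> measure \<mu> {x\<in>X. l ((f ^^ j) x) \<noteq> G j (\<zeta> x)} \<le> \<beta>"
proof -
  have p: "\<mu> \<in> probs X" by (rule invariant_in_probs[OF \<mu>])
  interpret prob_space \<mu> by (rule probsD[OF p])
  have P': "disjoint P" using P by (simp add: fin_partitions_def)
  define G where "G j u = (SOME A. A \<in> P \<and> (\<exists>y\<in>C A. dist ((f ^^ j) (pt u)) y \<le> d))" for j u
  define bad where "bad = X - (\<Union>A\<in>P. C A)"
  have bm: "bad \<in> sets (borel_on X)" using sets.compl_sets[OF C(2)] by (simp add: bad_def)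
  have "measure \<mu> {x\<in>X. l ((f ^^ j) x) \<noteq> G j (\<zeta> x)} \<le> \<beta>" if j: "j < N" for j
  proof -
    have sub: "{x\<in>X. l ((f ^^ j) x) \<noteq> G j (\<zeta> x)} \<subseteq> {x\<in>X. \<zeta> x = L} \<union> ((f ^^ j) -` bad \<inter> X)"
    proof (rule subsetI, rule ccontr)
      fix x assume x: "x \<in> {x\<in>X. l ((f ^^ j) x) \<noteq> G j (\<zeta> x)}" "x \<notin> {x\<in>X. \<zeta> x = L} \<union> ((f ^^ j) -` bad \<inter> X)"
      then have xX: "x \<in> X" and z: "\<zeta> x \<noteq> L" and nb: "(f ^^ j) x \<notin> bad" by auto
      have zL: "\<zeta> x < L" using z \<zeta>(3) xX by force
      have fx: "(f ^^ j) x \<in> X" by (rule iter_in[OF xX])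
      then obtain A where A: "A \<in> P" "(f ^^ j) x \<in> C A" using nb by (auto simp: bad_def)
      have "l ((f ^^ j) x) = A"
      proof (rule ccontr)
        assume ne: "l ((f ^^ j) x) \<noteq> A"
        have "l ((f ^^ j) x) \<in> P" using l(1) fx by auto
        then have "l ((f ^^ j) x) \<inter> A = {}" using P' A(1) ne by (auto simp: disjoint_def)
        moreover have "(f ^^ j) x \<in> l ((f ^^ j) x) \<inter> A" using l(2)[OF fx] A C(1) by blast
        ultimately show False by blast
      qed
      moreover have "G j (\<zeta> x) = A"
      proof -
        have ex: "A \<in> P \<and> (\<exists>y\<in>C A. dist ((f ^^ j) (pt (\<zeta> x))) y \<le> d)" using A \<zeta>(4)[OF xX zL j] by blast
        have "G j (\<zeta> x) \<in> P \<and> (\<exists>y\<in>C (G j (\<zeta> x)). dist ((f ^^ j) (pt (\<zeta> x))) y \<le> d)"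
          unfolding G_def by (rule someI[of _ A]) (rule ex)
        then obtain y where y: "G j (\<zeta> x) \<in> P" "y \<in> C (G j (\<zeta> x))" "dist ((f ^^ j) (pt (\<zeta> x))) y \<le> d" by blast
        show ?thesis
        proof (rule ccontr)
          assume "G j (\<zeta> x) \<noteq> A"
          from dist[OF y(1) A(1) this y(2) A(2)] have "2 * d < dist y ((f ^^ j) x)" .
          moreover have "dist y ((f ^^ j) x) \<le> dist ((f ^^ j) (pt (\<zeta> x))) y + dist ((f ^^ j) (pt (\<zeta> x))) ((f ^^ j) x)"
            by (rule dist_triangle3)
          ultimately show False using y(3) \<zeta>(4)[OF xX zL j] by linarith
        qed
      qed
      ultimately show False using x(1) by simp
    qed
    have "measure \<mu> {x\<in>X. l ((f ^^ j) x) \<noteq> G j (\<zeta> x)} \<le> measure \<mu> ({x\<in>X. \<zeta> x = L} \<union> ((f ^^ j) -` bad \<inter> X))"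
      using sub \<zeta>(1) iter_vimage_sets[OF bm] by (intro finite_measure_mono sets.Un) (simp_all add: probsD[OF p])
    also have "\<dots> \<le> measure \<mu> {x\<in>X. \<zeta> x = L} + measure \<mu> ((f ^^ j) -` bad \<inter> X)"
      using \<zeta>(1) iter_vimage_sets[OF bm] by (intro measure_Un_le) (simp_all add: probsD[OF p])
    also have "\<dots> = measure \<mu> bad" using \<zeta>(2) invariant_measure_iter[OF \<mu> bm] by simp
    also have "\<dots> \<le> \<beta>" using C(3) by (simp add: bad_def)
    finally show ?thesis .
  qed
  then show ?thesis by (rule that)
qed

section \<open>Orbits that realise the entropy\<close>

text \<open>All words of one type are permutations of the same multiset, so the total of their block
  sums does not depend on the order into which sorting puts the blocks. Specification at scale d / 4
  turns separation d of the code points into separation d / 2 of the glued orbits.\<close>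

lemma orbits_near_measure:
  fixes p :: "nat \<Rightarrow> real" and \<zeta> :: "'a \<Rightarrow> nat" and q M L N K n :: nat
  assumes \<mu>: "\<mu> \<in> invariant_probs X f" and spec: "spec_gap q Xs (d / 4) M" and XsX: "\<And>i. i < q \<Longrightarrow> Xs i \<subseteq> X"
    and code: "\<And>i. i < L \<Longrightarrow> c i < q \<and> pt i \<in> Xs (c i)"
      "\<And>i j. i < L \<Longrightarrow> j < L \<Longrightarrow> i \<noteq> j \<Longrightarrow> c i = c j \<Longrightarrow> \<exists>t<N. d < dist ((f ^^ t) (pt i)) ((f ^^ t) (pt j))"
      "\<zeta> ` X \<subseteq> {..<Suc L}" "\<And>u. {x\<in>X. \<zeta> x = u} \<in> sets (borel_on X)" "measure \<mu> {x\<in>X. \<zeta> x = L} = 0"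
      "\<And>x j. x \<in> X \<Longrightarrow> \<zeta> x < L \<Longrightarrow> j < N \<Longrightarrow> dist ((f ^^ j) (pt (\<zeta> x))) ((f ^^ j) x) \<le> d"
    and p: "p = (\<lambda>i. measure \<mu> {x\<in>X. \<zeta> x = i})"
    and N: "1 \<le> N" and d: "0 < d" and K: "L + 2 \<le> K" "K * (N + M) \<le> n"
  obtains Y where "Y \<subseteq> X" "finite Y" "separated n (d / 2) Y"
    "card (permutations_of_multiset (type_mset p (Suc L) K)) \<le> (max 1 (q * Suc M)) ^ K * card Y"
    "\<forall>y\<in>Y. \<forall>(g :: 'a \<Rightarrow> real) B \<omega>. continuous_on X g \<longrightarrow> (\<forall>x\<in>X. \<bar>g x\<bar> \<le> B) \<longrightarrow> 0 \<le> \<omega> \<longrightarrow>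
      (\<forall>x\<in>X. \<forall>y\<in>X. dist x y \<le> d \<longrightarrow> \<bar>g x - g y\<bar> \<le> \<omega>) \<longrightarrow>
      \<bar>bsum g n y - n * integral\<^sup>L \<mu> g\<bar> \<le> 2 * real n * \<omega> + 2 * B * (real n - N * (real K - real (Suc L)))"
proof -
  have pr: "\<mu> \<in> probs X" by (rule invariant_in_probs[OF \<mu>])
  interpret prob_space \<mu> by (rule probsD[OF pr])
  obtain x0 where x0: "x0 \<in> X" using not_empty probsD(2)[OF pr] by auto
  \<comment> \<open>The dummy index L also gets a point of X, so that the sums over all L + 1 codes
    make sense; it occurs in no word since p L = 0.\<close>
  define pt' where "pt' i = (if i < L then pt i else x0)" for i
  have ptX: "pt' i \<in> X" for i using code(1)[of i] XsX x0 by (auto simp: pt'_def)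
  define k where "k i = nat \<lfloor>real K * p i\<rfloor>" for i
  define S where "S = (\<Sum>i<Suc L. k i)"
  have psum: "(\<Sum>i<Suc L. p i) = 1" unfolding p by (rule sum_measure_fibers[OF pr _ code(3,4)]) simp
  have p0: "0 \<le> p i" for i by (simp add: p)
  have kle: "real (k i) \<le> K * p i" "K * p i - 1 \<le> real (k i)" for i
  proof -
    have "0 \<le> real K * p i" using p0 by simp
    then show "real (k i) \<le> K * p i" "K * p i - 1 \<le> real (k i)" unfolding k_def by linarith+
  qed
  have "real S \<le> (\<Sum>i<Suc L. K * p i)" unfolding S_def of_nat_sum by (rule sum_mono) (rule kle)
  also have "\<dots> = K" unfolding sum_distrib_left[symmetric] psum by simp
  finally have SK: "S \<le> K" by simp
  have "(\<Sum>i<Suc L. K * p i - 1) \<le> real S" unfolding S_def of_nat_sum by (rule sum_mono) (rule kle)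
  moreover have "(\<Sum>i<Suc L. K * p i - 1) = real K - real (Suc L)"
    unfolding sum_subtractf sum_distrib_left[symmetric] psum by simp
  ultimately have KS: "real K - real (Suc L) \<le> real S" by simp
  \<comment> \<open>Rounding removes at most L + 1 blocks, so \<open>L + 2 \<le> K\<close> leaves at
    least one.\<close>
  then have S1: "1 \<le> S" using K(1) by linarith
  define A where "A = permutations_of_multiset (type_mset p (Suc L) K)"
  have Alen: "length xs = S" if "xs \<in> A" for xs
  proof -
    have "mset xs = type_mset p (Suc L) K" using that by (simp add: A_def permutations_of_multisetD)
    then have "length xs = size (type_mset p (Suc L) K)" by (metis size_mset)
    then show ?thesis by (simp only: size_type_mset S_def k_def)
  qed
  have Aset: "set xs \<subseteq> {..<L}" if "xs \<in> A" for xs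
  proof
    fix i assume "i \<in> set xs"
    then have "i \<in># type_mset p (Suc L) K"
      using that by (metis A_def permutations_of_multisetD set_mset_mset)
    then have "0 < count (type_mset p (Suc L) K) i" by simp
    then have i: "i < Suc L" "0 < k i" unfolding count_type_mset k_def by (auto split: if_splits)
    then have "p i \<noteq> 0" by (auto simp: k_def)
    then have "i \<noteq> L" using code(5) by (auto simp: p)
    then show "i \<in> {..<L}" using i by simp
  qed
  have SnM: "S * (N + M) \<le> n"
  proof -
    have "S * (N + M) \<le> K * (N + M)" using SK by (rule mult_right_mono) simp
    then show ?thesis using K(2) by linarith
  qed
  have "\<exists>Y. Y \<subseteq> X \<and> finite Y \<and> card A \<le> (q * Suc M) ^ S * card Y \<and> separated n (2 * (d / 4)) Y \<and>
    (\<forall>y\<in>Y. \<exists>zs T. (\<exists>xs\<in>A. mset zs = mset xs) \<and> T 0 = 0 \<and> T S = n \<and> (\<forall>j<S. T j + N \<le> T (Suc j)) \<and>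
       (\<forall>j<S. \<forall>i<N. dist ((f ^^ i) (pt' (zs ! j))) ((f ^^ (i + T j)) y) \<le> d / 4))"
  proof (rule many_orbits[OF spec N S1 SnM _ Alen Aset])
    show "finite A" by (simp add: A_def)
    show "c z < q \<and> pt' z \<in> Xs (c z)" if "z \<in> {..<L}" for z using code(1)[of z] that by (simp add: pt'_def)
    show "\<exists>t<N. 4 * (d / 4) < dist ((f ^^ t) (pt' i)) ((f ^^ t) (pt' j))"
      if "i \<in> {..<L}" "j \<in> {..<L}" "i \<noteq> j" "c i = c j" for i j
      using code(2)[of i j] that by (simp add: pt'_def)
  qed
  then obtain Y where Y: "Y \<subseteq> X" "finite Y" "card A \<le> (q * Suc M) ^ S * card Y" "separated n (2 * (d / 4)) Y"
    and Yorb: "\<And>y. y \<in> Y \<Longrightarrow> \<exists>zs T. (\<exists>xs\<in>A. mset zs = mset xs) \<and> T 0 = 0 \<and> T S = n \<and> (\<forall>j<S. T j + N \<le> T (Suc j)) \<and>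
       (\<forall>j<S. \<forall>i<N. dist ((f ^^ i) (pt' (zs ! j))) ((f ^^ (i + T j)) y) \<le> d / 4)" by blast
  have ae: "AE x in \<mu>. \<forall>j<N. dist ((f ^^ j) (pt' (\<zeta> x))) ((f ^^ j) x) \<le> d"
  proof -
    have "{x\<in>X. \<zeta> x = L} \<in> null_sets \<mu>"
      using code(4,5) by (intro null_setsI) (simp_all add: probsD[OF pr] emeasure_eq_measure)
    from AE_not_in[OF this] AE_space show ?thesis
    proof eventually_elim
      case (elim x)
      then have xX: "x \<in> X" by (simp add: probsD[OF pr])
      then have "\<zeta> x < L" using elim code(3) by force
      then show ?case using code(6)[OF xX] by (simp add: pt'_def)
    qed
  qed
  show ?thesis
  proof (rule that[OF Y(1,2)])
    show "separated n (d / 2) Y" using Y(4) by simp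
    \<comment> \<open>The actual number of blocks is S rather than K; a base of at least 1 allows
      raising the exponent to K.\<close>
    have "(q * Suc M) ^ S \<le> max 1 (q * Suc M) ^ S" by (rule power_mono) auto
    also have "\<dots> \<le> max 1 (q * Suc M) ^ K" using SK by (intro power_increasing) auto
    finally have "(q * Suc M) ^ S * card Y \<le> max 1 (q * Suc M) ^ K * card Y" by (rule mult_right_mono) simp
    then show "card (permutations_of_multiset (type_mset p (Suc L) K)) \<le> (max 1 (q * Suc M)) ^ K * card Y"
      using Y(3) unfolding A_def by linarith
  next
    show "\<forall>y\<in>Y. \<forall>(g :: 'a \<Rightarrow> real) B \<omega>. continuous_on X g \<longrightarrow> (\<forall>x\<in>X. \<bar>g x\<bar> \<le> B) \<longrightarrow> 0 \<le> \<omega> \<longrightarrow>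
      (\<forall>x\<in>X. \<forall>y\<in>X. dist x y \<le> d \<longrightarrow> \<bar>g x - g y\<bar> \<le> \<omega>) \<longrightarrow>
      \<bar>bsum g n y - n * integral\<^sup>L \<mu> g\<bar> \<le> 2 * real n * \<omega> + 2 * B * (real n - N * (real K - real (Suc L)))"
    proof (intro ballI allI impI)
      fix y B \<omega> and g :: "'a \<Rightarrow> real"
      assume y: "y \<in> Y" and gc: "continuous_on X g" and gB': "\<forall>x\<in>X. \<bar>g x\<bar> \<le> B" and \<omega>: "0 \<le> \<omega>"
        and gw': "\<forall>x\<in>X. \<forall>y\<in>X. dist x y \<le> d \<longrightarrow> \<bar>g x - g y\<bar> \<le> \<omega>"
      have gB: "\<bar>g x\<bar> \<le> B" if "x \<in> X" for x using gB' that by blast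
      have gw: "\<bar>g x - g y\<bar> \<le> \<omega>" if "x \<in> X" "y \<in> X" "dist x y \<le> d" for x y using gw' that by blast
      have yX: "y \<in> X" using y Y(1) by auto
      have B0: "0 \<le> B" using gB[OF yX] by linarith
      obtain zs T xs where xs: "xs \<in> A" "mset zs = mset xs" and T: "T 0 = 0" "T S = n" "\<And>j. j < S \<Longrightarrow> T j + N \<le> T (Suc j)"
        and sh: "\<And>j i. j < S \<Longrightarrow> i < N \<Longrightarrow> dist ((f ^^ i) (pt' (zs ! j))) ((f ^^ (i + T j)) y) \<le> d / 4"
        using Yorb[OF y] by blast
      have "\<bar>bsum g (T S) y - (\<Sum>j<S. bsum g N (pt' (zs ! j)))\<bar> \<le> real S * real N * \<omega> + (real (T S) - real S * real N) * B"
      proof (rule bsum_shadow[OF yX T(1,3) ptX sh gB])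
        show "\<bar>g x - g y\<bar> \<le> \<omega>" if "x \<in> X" "y \<in> X" "dist x y \<le> d / 4" for x y using gw[OF that(1,2)] that(3) d by simp
      qed
      moreover have "(\<Sum>j<S. bsum g N (pt' (zs ! j))) = (\<Sum>i<Suc L. real (k i) * bsum g N (pt' i))"
      proof -
        have "length zs = S" using Alen[OF xs(1)] xs(2) by (metis size_mset)
        then have "(\<Sum>j<S. bsum g N (pt' (zs ! j))) = sum_list (map (\<lambda>i. bsum g N (pt' i)) zs)"
          by (simp add: sum_list_sum_nth atLeast0LessThan)
        also have "\<dots> = sum_mset (image_mset (\<lambda>i. bsum g N (pt' i)) (mset zs))"
          by (metis mset_map sum_mset_sum_list)
        also have "mset zs = type_mset p (Suc L) K" using xs by (simp add: A_def permutations_of_multisetD)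
        also have "sum_mset (image_mset (\<lambda>i. bsum g N (pt' i)) (type_mset p (Suc L) K)) = (\<Sum>i<Suc L. real (k i) * bsum g N (pt' i))"
          unfolding sum_type_mset k_def ..
        finally show ?thesis .
      qed
      moreover have "\<bar>(\<Sum>i<Suc L. real (k i) * bsum g N (pt' i)) - n * integral\<^sup>L \<mu> g\<bar> \<le> (real n - N * real S) * B + n * \<omega>"
      proof -
        have "K * N \<le> K * (N + M)" by simp
        then have KN: "K * N \<le> n" using K(2) by linarith
        show ?thesis unfolding k_def S_def p
          by (rule type_sum_close[OF \<mu> code(3,4) ae ptX gc gB gw N KN])
      qed
      ultimately have "\<bar>bsum g n y - n * integral\<^sup>L \<mu> g\<bar> \<le> real S * real N * \<omega> + n * \<omega> + 2 * B * (real n - N * real S)"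
        unfolding T(2) by (simp add: algebra_simps)
      moreover have "real S * real N * \<omega> \<le> n * \<omega>"
      proof (rule mult_right_mono[OF _ \<omega>])
        have "S * N \<le> S * (N + M)" by simp
        then have "S * N \<le> n" using SnM by linarith
        then show "real S * real N \<le> real n" by (metis of_nat_le_iff of_nat_mult)
      qed
      moreover have "2 * B * (real n - N * real S) \<le> 2 * B * (real n - N * (real K - real (Suc L)))"
        using KS B0 by (intro mult_left_mono diff_left_mono) auto
      ultimately show "\<bar>bsum g n y - n * integral\<^sup>L \<mu> g\<bar> \<le> 2 * real n * \<omega> + 2 * B * (real n - N * (real K - real (Suc L)))"
        by linarith
    qed
  qed
qed

text \<open>The loss 6 * \<delta> consists of one \<delta> for stopping at block length N, one for
  the Fano error, two for the gaps, the Stirling error and the pigeonhole factor together, one for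
  the Birkhoff sums of \<phi>, and one for the volume of Bowen balls.\<close>

lemma lower_rate:
  fixes \<delta> :: real and q :: nat
  assumes m: "m \<in> probs X" and \<phi>: "continuous_on X \<phi>" and \<mu>: "\<mu> \<in> invariant_probs X f"
    and Xs: "\<And>i. i < q \<Longrightarrow> compact (Xs i) \<and> Xs i \<subseteq> X" "nonwandering X f = (\<Union>i<q. Xs i)"
    and spec: "\<And>e. 0 < e \<Longrightarrow> \<exists>M. spec_gap q Xs e M"
    and balls: "\<And>(e::real) (\<eta>::real). 0 < e \<Longrightarrow> 0 < \<eta> \<Longrightarrow>
      \<forall>\<^sub>F n in sequentially. \<forall>x\<in>X. exp (- bsum \<phi> n x - n * \<eta>) \<le> measure m (bowen_ball X f n x e)"
    and P: "P \<in> fin_partitions X" and G: "wk_open X G" "\<mu> \<in> G" and \<delta>: "0 < \<delta>"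
  shows "\<forall>\<^sub>F n in sequentially. exp (n * (part_entropy_rate X f \<mu> P - integral\<^sup>L \<mu> \<phi> - 6 * \<delta>))
    \<le> measure m {x\<in>X. empirical X f n x \<in> G}"
proof -
  have pr: "\<mu> \<in> probs X" by (rule invariant_in_probs[OF \<mu>])
  interpret M: prob_space m by (rule probsD[OF m])
  have XsX: "Xs i \<subseteq> X" if "i < q" for i using Xs(1)[OF that] by blast
  have Xne: "X \<noteq> {}" using M.not_empty probsD(2)[OF m] by simp
  define h where "h = part_entropy_rate X f \<mu> P"
  obtain S eG where S: "finite S" "\<forall>g\<in>S. continuous_on X g" "eG > 0"
    "{\<nu>\<in>probs X. \<forall>g\<in>S. \<bar>integral\<^sup>L \<nu> g - integral\<^sup>L \<mu> g\<bar> < (eG::real)} \<subseteq> G"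
    using G unfolding wk_open_def by blast
  define SS where "SS = insert \<phi> S"
  have SS: "finite SS" "\<And>g. g \<in> SS \<Longrightarrow> continuous_on X g" using S \<phi> by (auto simp: SS_def)
  obtain B where B: "0 < B" "\<And>g x. g \<in> SS \<Longrightarrow> x \<in> X \<Longrightarrow> \<bar>g x\<bar> \<le> B"
    by (rule finite_common_bound[OF SS]) (assumption, rule that)
  \<comment> \<open>Birkhoff averages deviate by at most 3 * \<omega> on the constructed orbits and
    by 4 * \<omega> on the Bowen balls around them, which must stay below \<open>eG\<close>; for
    \<phi>, the bound 3 * \<omega> \<le> \<delta> enters the volume estimate.\<close>
  define \<omega> where "\<omega> = min (eG / 5) (\<delta> / 3)"
  have \<omega>: "0 < \<omega>" "4 * \<omega> < eG" "3 * \<omega> \<le> \<delta>" using S(3) \<delta> by (auto simp: \<omega>_def)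
  obtain l :: "'a \<Rightarrow> 'a set" where l: "borel_label l" "l ` X \<subseteq> P" "\<And>x. x \<in> X \<Longrightarrow> x \<in> l x"
    and lim: "(\<lambda>n. word_entropy \<mu> l n / n) \<longlonglongrightarrow> h"
    by (rule part_entropy_rate_lim[OF \<mu> P, folded h_def]) (rule that)
  have cV: "1 \<le> card (l ` X)" using l(1) Xne by (simp add: borel_label_def Suc_leI card_gt_0_iff)
  obtain \<beta> where \<beta>: "0 < \<beta>" "\<beta> < 1" "- ln (1 - \<beta>) + \<beta> * ln (card (l ` X) / \<beta>) \<le> \<delta>"
    by (rule small_error_rate[OF \<delta> cV]) (rule that)
  obtain C d0 where C: "\<And>A. A \<in> P \<Longrightarrow> C A \<subseteq> A" "(\<Union>A\<in>P. C A) \<in> sets (borel_on X)"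
    "measure \<mu> (X - (\<Union>A\<in>P. C A)) \<le> \<beta>" "0 < d0"
    "\<And>A B x y. A \<in> P \<Longrightarrow> B \<in> P \<Longrightarrow> A \<noteq> B \<Longrightarrow> x \<in> C A \<Longrightarrow> y \<in> C B \<Longrightarrow> d0 \<le> dist x y"
    by (rule partition_cores[OF pr P \<beta>(1)]) (rule that)
  obtain d1 where d1: "0 < d1" "\<forall>g\<in>SS. \<forall>x\<in>X. \<forall>y\<in>X. dist x y \<le> d1 \<longrightarrow> \<bar>g x - g y\<bar> \<le> \<omega>"
    using finite_uniform_modulus[OF SS \<omega>(1)] by blast
  define d where "d = min (d0 / 3) d1"
  have d: "0 < d" "2 * d < d0" "d \<le> d1" using C(4) d1(1) by (auto simp: d_def)
  have osc: "\<bar>g x - g y\<bar> \<le> \<omega>" if "g \<in> SS" "x \<in> X" "y \<in> X" "dist x y \<le> d" for g x y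
    using d1(2) that d(3) by force
  obtain M where M: "spec_gap q Xs (d / 4) M" using spec[of "d / 4"] d(1) by auto
  \<comment> \<open>\<open>Q\<close> is the factor per block lost by pigeonholing classes and gaps;
    like \<open>M\<close>, it does not depend on the block length chosen next.\<close>
  define Q where "Q = max 1 (q * Suc M)"
  define c0 where "c0 = ln (real Q)"
  have Q1: "1 \<le> Q" by (simp add: Q_def)

  have "\<forall>\<^sub>F n in sequentially. h - \<delta> < word_entropy \<mu> l n / n" using lim by (rule order_tendstoD) (use \<delta> in simp)
  moreover have "\<forall>\<^sub>F n in sequentially. max 1 (nat \<lceil>4 * B * M / \<omega>\<rceil>) \<le> n" by (rule eventually_ge_at_top)
  moreover have "\<forall>\<^sub>F n in sequentially. nat \<lceil>(\<delta> + c0 + M * \<bar>h\<bar>) / (2 * \<delta>)\<rceil> < n" by (rule eventually_gt_at_top)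
  ultimately have "\<forall>\<^sub>F n in sequentially. h - \<delta> < word_entropy \<mu> l n / n \<and> max 1 (nat \<lceil>4 * B * M / \<omega>\<rceil>) \<le> n \<and>
    nat \<lceil>(\<delta> + c0 + M * \<bar>h\<bar>) / (2 * \<delta>)\<rceil> < n" by eventually_elim blast
  \<comment> \<open>Three demands on \<open>N\<close>: the word entropy rate is close to h, the gaps
    are negligible for Birkhoff sums (4 * B * M \<le> N * \<omega>), and the fixed costs of a block,
    \<delta> + c0 + M * |h|, stay below 2 * \<delta> * N.\<close>
  then obtain N where N: "h - \<delta> < word_entropy \<mu> l N / N" "max 1 (nat \<lceil>4 * B * M / \<omega>\<rceil>) \<le> N"
    "nat \<lceil>(\<delta> + c0 + M * \<bar>h\<bar>) / (2 * \<delta>)\<rceil> < N" using eventually_happens by force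
  have N1: "1 \<le> N" using N(2) by simp
  then have N0: "0 < real N" by simp
  have NM: "4 * B * M \<le> N * \<omega>"
  proof -
    have "4 * B * M / \<omega> \<le> N" using N(2) by linarith
    then show ?thesis using \<omega>(1) by (simp add: pos_divide_le_eq)
  qed
  have Nh: "\<delta> + c0 + M * \<bar>h\<bar> < 2 * \<delta> * N"
  proof -
    have "(\<delta> + c0 + M * \<bar>h\<bar>) / (2 * \<delta>) < N" using N(3) by linarith
    then show ?thesis using \<delta> by (simp add: pos_divide_less_eq mult.commute)
  qed
  obtain L pt c and \<zeta> :: "'a \<Rightarrow> nat" where code:
    "\<And>i. i < L \<Longrightarrow> c i < q \<and> pt i \<in> Xs (c i)"
    "\<And>i j. i < L \<Longrightarrow> j < L \<Longrightarrow> i \<noteq> j \<Longrightarrow> c i = c j \<Longrightarrow> \<exists>t<N. d < dist ((f ^^ t) (pt i)) ((f ^^ t) (pt j))"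
    "\<zeta> ` X \<subseteq> {..<Suc L}" "\<And>u. {x\<in>X. \<zeta> x = u} \<in> sets (borel_on X)" "measure \<mu> {x\<in>X. \<zeta> x = L} = 0"
    "\<And>x j. x \<in> X \<Longrightarrow> \<zeta> x < L \<Longrightarrow> j < N \<Longrightarrow> dist ((f ^^ j) (pt (\<zeta> x))) ((f ^^ j) x) \<le> d"
    by (rule separated_code[OF \<mu> d(1) Xs, of N]) (assumption, rule that)
  define p where "p = (\<lambda>i. measure \<mu> {x\<in>X. \<zeta> x = i})"
  define H where "H = (\<Sum>i<Suc L. - eta0 (p i))"
  have far: "2 * d < dist x y" if "A \<in> P" "A' \<in> P" "A \<noteq> A'" "x \<in> C A" "y \<in> C A'" for A A' x y
    using C(5)[OF that] d(2) by linarith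
  obtain code_guess where code_guess: "\<And>j. j < N \<Longrightarrow> measure \<mu> {x\<in>X. l ((f ^^ j) x) \<noteq> code_guess j (\<zeta> x)} \<le> \<beta>"
    by (rule code_error[OF \<mu> P l(2,3) C(1-3) far code(4,5,3,6)]) (assumption | rule that)+
  have "word_entropy \<mu> l N \<le> H + N * (- ln (1 - \<beta>) + \<beta> * ln (card (l ` X) / \<beta>))"
    unfolding H_def p_def by (rule word_entropy_le_code[OF pr l(1) code(3,4) \<beta>(1,2) code_guess])
  also have "\<dots> \<le> H + N * \<delta>" using \<beta>(3) by (intro add_left_mono mult_left_mono) auto
  finally have "word_entropy \<mu> l N \<le> H + N * \<delta>" .
  moreover have "N * (h - \<delta>) < word_entropy \<mu> l N" using N(1) N0 by (simp add: pos_less_divide_eq mult.commute)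
  ultimately have HN: "N * (h - 2 * \<delta>) < H" by (simp add: algebra_simps)
  have p0: "0 \<le> p i" for i by (simp add: p_def)
  have psum: "(\<Sum>i<Suc L. p i) = 1" unfolding p_def by (rule sum_measure_fibers[OF pr _ code(3,4)]) simp
  define a where "a = N + M"
  have a0: "0 < a" using N1 by (simp add: a_def)
  \<comment> \<open>A block takes up to a = N + M steps; dividing its entropy by \<open>a\<close>
    instead of \<open>N\<close> is what the term M * |h| pays for.\<close>
  have static: "h - 4 * \<delta> < (H - \<delta> - c0) * (1 / real a)"
  proof -
    have "M * h \<le> M * \<bar>h\<bar>" by (intro mult_left_mono) auto
    moreover have "(h - 4 * \<delta>) * real a = N * (h - 2 * \<delta>) - 2 * \<delta> * N + M * h - 4 * (M * \<delta>)"
      by (simp add: a_def algebra_simps)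
    moreover have "0 \<le> M * \<delta>" using \<delta> by simp
    ultimately have "(h - 4 * \<delta>) * real a < H - \<delta> - c0" using HN Nh by linarith
    then show ?thesis using a0 by (simp add: pos_less_divide_eq)
  qed
  have divlim: "filterlim (\<lambda>n. n div a) sequentially sequentially" by (rule filterlim_div_sequentially[OF a0])
  have E1: "\<forall>\<^sub>F n in sequentially. exp (real (n div a) * (H - \<delta>))
      \<le> real (card (permutations_of_multiset (type_mset p (Suc L) (n div a))))"
    unfolding H_def
    by (rule eventually_compose_filterlim[OF permutations_type_growth[OF p0 psum \<delta>] divlim])
  have E2: "\<forall>\<^sub>F n in sequentially. h - 4 * \<delta> < (H - \<delta> - c0) * (real (n div a) / real n)"
    by (rule order_tendstoD(1)[OF tendsto_mult[OF tendsto_const tendsto_div_ratio[OF a0]] static])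
  have E3: "\<forall>\<^sub>F n in sequentially. nat \<lceil>4 * B * (N * (real (Suc L) + 1)) / \<omega>\<rceil> \<le> n" by (rule eventually_ge_at_top)
  have E4: "\<forall>\<^sub>F n in sequentially. L + 2 \<le> n div a"
    using divlim by (simp add: filterlim_at_top)
  have E5: "\<forall>\<^sub>F n in sequentially. \<forall>x\<in>X. exp (- bsum \<phi> n x - n * \<delta>) \<le> measure m (bowen_ball X f n x (d / 4))"
    using d(1) \<delta> by (intro balls) auto
  have E6: "\<forall>\<^sub>F n in sequentially. 0 < n" by (rule eventually_gt_at_top)
  from E1 E2 E3 E4 E5 E6 show ?thesis
  proof eventually_elim
    case (elim n)
    define K where "K = n div a"
    have n0: "0 < real n" using elim(6) by simp
    have Kn: "K * (N + M) \<le> n" unfolding K_def a_def[symmetric] by (rule div_times_less_eq_dividend)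
    obtain Y where Y: "Y \<subseteq> X" "finite Y" "separated n (d / 2) Y"
      "card (permutations_of_multiset (type_mset p (Suc L) K)) \<le> (max 1 (q * Suc M)) ^ K * card Y"
      and Yg: "\<forall>y\<in>Y. \<forall>(g :: 'a \<Rightarrow> real) B \<omega>. continuous_on X g \<longrightarrow> (\<forall>x\<in>X. \<bar>g x\<bar> \<le> B) \<longrightarrow> 0 \<le> \<omega> \<longrightarrow>
        (\<forall>x\<in>X. \<forall>y\<in>X. dist x y \<le> d \<longrightarrow> \<bar>g x - g y\<bar> \<le> \<omega>) \<longrightarrow>
        \<bar>bsum g n y - n * integral\<^sup>L \<mu> g\<bar> \<le> 2 * real n * \<omega> + 2 * B * (real n - N * (real K - real (Suc L)))"
      by (rule orbits_near_measure[OF \<mu> M XsX code p_def N1 d(1) elim(4)[folded K_def] Kn])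
        (assumption | rule that)+
    \<comment> \<open>The time outside the blocks consists of gaps, accounted for by n * (M / a),
      and of a bounded amount N * (L + 2) from rounding n div a and the letter counts. Multiplied by
      4 * B, each part is at most n * \<omega>.\<close>
    have waste: "2 * B * (real n - N * (real K - real (Suc L))) \<le> n * \<omega>"
    proof -
      have "n < a * (K + 1)" unfolding K_def using a0 by (simp add: dividend_less_times_div)
      then have "real n < real a * (real K + 1)" by (metis of_nat_1 of_nat_add of_nat_less_iff of_nat_mult)
      then have "N * (real n / a) \<le> N * (real K + 1)"
        using a0 by (intro mult_left_mono) (simp_all add: pos_divide_le_eq mult.commute)
      moreover have "N * (real n / a) = n - n * (M / a)"
      proof -
        have "real N = real a - real M" by (simp add: a_def)
        then have "N * (real n / a) = (real a - real M) * (real n / a)" by (simp only:)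
        also have "\<dots> = n - n * (M / a)" using a0 by (simp add: field_simps)
        finally show ?thesis .
      qed
      ultimately have "real n - N * (real K - real (Suc L)) \<le> n * (M / a) + N * (real (Suc L) + 1)"
        by (simp add: algebra_simps)
      then have "4 * B * (real n - N * (real K - real (Suc L))) \<le> 4 * B * (n * (M / a) + N * (real (Suc L) + 1))"
        using B(1) by (intro mult_left_mono) auto
      also have "\<dots> = n * (4 * B * M / a) + 4 * B * (N * (real (Suc L) + 1))" by (simp add: algebra_simps)
      also have "\<dots> \<le> n * \<omega> + n * \<omega>"
      proof (rule add_mono)
        have "N * \<omega> \<le> a * \<omega>" using \<omega>(1) by (intro mult_right_mono) (auto simp: a_def)
        then have "4 * B * M / a \<le> \<omega>" using NM a0 by (simp add: pos_divide_le_eq mult.commute)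
        then show "n * (4 * B * M / a) \<le> n * \<omega>" by (intro mult_left_mono) auto
        have "4 * B * (N * (real (Suc L) + 1)) / \<omega> \<le> n" using elim(3) by linarith
        then show "4 * B * (N * (real (Suc L) + 1)) \<le> n * \<omega>" using \<omega>(1) by (simp only: pos_divide_le_eq)
      qed
      finally have "4 * B * (real n - N * (real K - real (Suc L))) \<le> n * \<omega> + n * \<omega>" .
      moreover have "4 * B * z = 2 * (2 * B * z)" for z by simp
      ultimately show ?thesis by (simp only:)
    qed
    have near: "\<bar>bsum g n y - n * integral\<^sup>L \<mu> g\<bar> \<le> 3 * real n * \<omega>" if "y \<in> Y" "g \<in> SS" for y g
    proof -
      have "\<bar>bsum g n y - n * integral\<^sup>L \<mu> g\<bar> \<le> 2 * real n * \<omega> + 2 * B * (real n - N * (real K - real (Suc L)))"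
        using that \<omega>(1) by (intro Yg[rule_format] SS B osc) auto
      then show ?thesis using waste by linarith
    qed
    have sub: "bowen_ball X f n y (d / 4) \<subseteq> {x\<in>X. empirical X f n x \<in> G}" if y: "y \<in> Y" for y
    proof
      fix z assume z: "z \<in> bowen_ball X f n y (d / 4)"
      then have zX: "z \<in> X" by (simp add: bowen_ball_def)
      have yX: "y \<in> X" using y Y(1) by auto
      have "\<bar>integral\<^sup>L (empirical X f n z) g - integral\<^sup>L \<mu> g\<bar> < eG" if g: "g \<in> S" for g
      proof -
        have gS: "g \<in> SS" using g by (simp add: SS_def)
        have "\<bar>bsum g n y - bsum g n z\<bar> \<le> n * \<omega>"
        proof (rule bsum_close[OF yX zX _ osc[OF gS]])
          show "dist ((f ^^ j) y) ((f ^^ j) z) \<le> d" if "j < n" for j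
            using z that d(1) by (auto simp: bowen_ball_def intro: order_trans)
        qed
        then have "\<bar>bsum g n z - n * integral\<^sup>L \<mu> g\<bar> \<le> n * (4 * \<omega>)" using near[OF y gS] by linarith
        moreover have "bsum g n z / n - integral\<^sup>L \<mu> g = (bsum g n z - n * integral\<^sup>L \<mu> g) / n"
          using n0 by (simp add: field_simps)
        ultimately have "\<bar>bsum g n z / n - integral\<^sup>L \<mu> g\<bar> \<le> 4 * \<omega>"
          using n0 by (simp add: abs_divide pos_divide_le_eq mult.commute)
        then show ?thesis using \<omega>(2) empirical_integral_bsum[OF elim(6) zX] S(2) g by simp
      qed
      then have "empirical X f n z \<in> G" using S(4) empirical_in_probs[OF elim(6) zX] by auto
      with zX show "z \<in> {x\<in>X. empirical X f n x \<in> G}" by simp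
    qed
    have bm: "bowen_ball X f n y (d / 4) \<in> sets m" for y using bowen_ball_sets by (simp add: probsD[OF m])
    have disj: "disjoint_family_on (\<lambda>y. bowen_ball X f n y (d / 4)) Y"
      unfolding disjoint_family_on_def
    proof (intro ballI impI, rule ccontr)
      fix y y' assume y: "y \<in> Y" "y' \<in> Y" "y \<noteq> y'" "bowen_ball X f n y (d / 4) \<inter> bowen_ball X f n y' (d / 4) \<noteq> {}"
      then obtain z where z: "z \<in> bowen_ball X f n y (d / 4)" "z \<in> bowen_ball X f n y' (d / 4)" by blast
      obtain j where j: "j < n" "d / 2 < dist ((f ^^ j) y) ((f ^^ j) y')"
        using Y(3) y unfolding separated_def by blast
      have "dist ((f ^^ j) y) ((f ^^ j) z) \<le> d / 4" "dist ((f ^^ j) y') ((f ^^ j) z) \<le> d / 4"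
        using z j(1) by (auto simp: bowen_ball_def)
      then show False using dist_triangle2[of "(f ^^ j) y" "(f ^^ j) y'" "(f ^^ j) z"] j(2) by linarith
    qed
    \<comment> \<open>A lower bound for the measure of each ball: one n * \<delta> for replacing the
      Birkhoff sum of \<phi> by its integral, one from the volume estimate.\<close>
    define t where "t = exp (- (n * integral\<^sup>L \<mu> \<phi>) - 2 * real n * \<delta>)"
    have "card Y * t = (\<Sum>y\<in>Y. t)" by simp
    also have "\<dots> \<le> (\<Sum>y\<in>Y. measure m (bowen_ball X f n y (d / 4)))"
    proof (rule sum_mono)
      fix y assume y: "y \<in> Y"
      have "\<bar>bsum \<phi> n y - n * integral\<^sup>L \<mu> \<phi>\<bar> \<le> 3 * real n * \<omega>" using near[OF y] by (simp add: SS_def)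
      moreover have "3 * real n * \<omega> \<le> n * \<delta>" using mult_left_mono[OF \<omega>(3), of "real n"] by simp
      ultimately have "- (n * integral\<^sup>L \<mu> \<phi>) - 2 * real n * \<delta> \<le> - bsum \<phi> n y - n * \<delta>" by linarith
      then have "t \<le> exp (- bsum \<phi> n y - n * \<delta>)" by (simp add: t_def)
      also have "\<dots> \<le> measure m (bowen_ball X f n y (d / 4))" using elim(5) y Y(1) by blast
      finally show "t \<le> measure m (bowen_ball X f n y (d / 4))" .
    qed
    also have "\<dots> = measure m (\<Union>y\<in>Y. bowen_ball X f n y (d / 4))"
      using Y(2) bm disj by (intro M.finite_measure_finite_Union[symmetric]) auto
    also have "\<dots> \<le> measure m {x\<in>X. empirical X f n x \<in> G}"
    proof (rule M.finite_measure_mono)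
      show "(\<Union>y\<in>Y. bowen_ball X f n y (d / 4)) \<subseteq> {x\<in>X. empirical X f n x \<in> G}" using sub by blast
      show "{x\<in>X. empirical X f n x \<in> G} \<in> sets m"
        using openin_borel_on[OF wk_open_empirical[OF G(1) elim(6)]] by (simp add: probsD[OF m])
    qed
    finally have main: "card Y * t \<le> measure m {x\<in>X. empirical X f n x \<in> G}" .
    have "exp (real K * (H - \<delta>)) \<le> real (card (permutations_of_multiset (type_mset p (Suc L) K)))"
      using elim(1) by (simp only: K_def)
    also have "\<dots> \<le> real (Q ^ K * card Y)" using Y(4) unfolding Q_def by (rule of_nat_mono)
    also have "\<dots> = exp (real K * c0) * card Y"
    proof -
      have "exp (real K * c0) = real Q ^ K" using Q1 by (simp add: c0_def exp_of_nat_mult)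
      then show ?thesis by simp
    qed
    finally have "exp (real K * (H - \<delta>)) * exp (- (real K * c0)) \<le> exp (real K * c0) * card Y * exp (- (real K * c0))"
      by (rule mult_right_mono) simp
    also have "\<dots> = card Y" by (simp add: exp_minus)
    also have "exp (real K * (H - \<delta>)) * exp (- (real K * c0)) = exp (real K * (H - \<delta> - c0))"
      by (simp add: exp_add[symmetric] algebra_simps)
    finally have cY: "exp (real K * (H - \<delta> - c0)) \<le> card Y" .
    have "n * (h - 4 * \<delta>) \<le> real K * (H - \<delta> - c0)"
    proof -
      have "n * (h - 4 * \<delta>) \<le> n * ((H - \<delta> - c0) * (real K / real n))"
        using elim(2) n0 unfolding K_def by (intro mult_left_mono) auto
      then show ?thesis using n0 by (simp add: mult.commute)
    qed
    then have "exp (n * (h - 4 * \<delta>)) \<le> card Y" using cY by (meson exp_le_cancel_iff order_trans)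
    then have "exp (n * (h - 4 * \<delta>)) * t \<le> card Y * t" by (rule mult_right_mono) (simp add: t_def)
    moreover have "exp (n * (h - 4 * \<delta>)) * t = exp (n * (h - integral\<^sup>L \<mu> \<phi> - 6 * \<delta>))"
      by (simp add: t_def exp_add[symmetric] algebra_simps)
    ultimately show ?case using main by (simp add: h_def)
  qed
qed

end

section \<open>The large deviation principle\<close>

lemma elog_mono: "s \<le> t \<Longrightarrow> elog s \<le> elog t"
  by (auto simp: elog_def)

lemma elog_le_0: "t \<le> 1 \<Longrightarrow> elog t \<le> 0"
  by (auto simp: elog_def zero_ereal_def)

text \<open>For t \<le> 0 both sides fail, the left because \<open>elog t\<close> is minus infinity
  and the right because exp is positive; so events of measure 0 need no separate treatment.\<close>

lemma ereal_le_elog_iff: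
  assumes "0 < n"
  shows "ereal b \<le> ereal (1 / real n) * elog t \<longleftrightarrow> exp (n * b) \<le> t"
proof (cases "0 < t")
  case True
  have "ereal b \<le> ereal (1 / real n) * elog t \<longleftrightarrow> n * b \<le> ln t"
    using True assms by (simp add: elog_def pos_le_divide_eq mult.commute)
  then show ?thesis using True by (simp add: ln_ge_iff)
next
  case False
  have "0 < exp (n * b)" by simp
  then have "\<not> exp (n * b) \<le> t" using False by linarith
  moreover have "ereal (1 / real n) * elog t = -\<infinity>" using False assms by (simp add: elog_def)
  ultimately show ?thesis by simp
qed

lemma ereal_less_elog_iff:
  assumes "0 < n"
  shows "ereal b < ereal (1 / real n) * elog t \<longleftrightarrow> exp (n * b) < t"
proof (cases "0 < t")
  case True
  have "ereal b < ereal (1 / real n) * elog t \<longleftrightarrow> n * b < ln t"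
    using True assms by (simp add: elog_def pos_less_divide_eq mult.commute)
  also have "\<dots> \<longleftrightarrow> exp (n * b) < exp (ln t)" by simp
  finally show ?thesis using True by simp
next
  case False
  have "0 < exp (n * b)" by simp
  then have "\<not> exp (n * b) < t" using False by linarith
  moreover have "ereal (1 / real n) * elog t = -\<infinity>" using False assms by (simp add: elog_def)
  ultimately show ?thesis by simp
qed

context compact_system begin

lemma local_rate_mono:
  assumes m: "m \<in> probs X" and e: "e \<le> e'"
  shows "local_rate X f m \<phi> e n x \<le> local_rate X f m \<phi> e' n x"
proof -
  interpret prob_space m by (rule probsD[OF m])
  have "measure m (bowen_ball X f n x e) \<le> measure m (bowen_ball X f n x e')"
  proof (rule finite_measure_mono)
    show "bowen_ball X f n x e \<subseteq> bowen_ball X f n x e'"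
    proof
      fix y assume y: "y \<in> bowen_ball X f n x e"
      have "dist ((f ^^ j) x) ((f ^^ j) y) \<le> e'" if "j < n" for j
        using y that e unfolding bowen_ball_def by force
      then show "y \<in> bowen_ball X f n x e'" using y by (simp add: bowen_ball_def)
    qed
    show "bowen_ball X f n x e' \<in> sets m" unfolding probsD(3)[OF m] by (rule bowen_ball_sets)
  qed
  then show ?thesis unfolding local_rate_def
    by (intro add_right_mono ereal_mult_left_mono elog_mono) auto
qed

lemma local_rate_lower:
  assumes n: "0 < n" and le: "ereal (- \<eta>) < local_rate X f m \<phi> e n x"
  shows "exp (- bsum \<phi> n x - n * \<eta>) \<le> measure m (bowen_ball X f n x e)"
proof -
  define t where "t = measure m (bowen_ball X f n x e)"
  have "ereal (- \<eta>) < ereal (1 / real n) * elog t + ereal (bsum \<phi> n x / n)"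
    using le by (simp add: local_rate_def t_def bsum_def)
  then have "ereal (- \<eta> - bsum \<phi> n x / n) < ereal (1 / real n) * elog t"
    by (cases "ereal (1 / real n) * elog t") auto
  then have "exp (n * (- \<eta> - bsum \<phi> n x / n)) < t" by (simp only: ereal_less_elog_iff[OF n])
  moreover have "n * (- \<eta> - bsum \<phi> n x / n) = - bsum \<phi> n x - n * \<eta>" using n by (simp add: field_simps)
  ultimately show ?thesis by (simp add: t_def)
qed

lemma local_rate_upper:
  assumes n: "0 < n" and le: "local_rate X f m \<phi> e n x < ereal \<delta>"
  shows "measure m (bowen_ball X f n x e) \<le> exp (- bsum \<phi> n x + n * \<delta>)"
proof -
  define t where "t = measure m (bowen_ball X f n x e)"
  have "ereal (1 / real n) * elog t + ereal (bsum \<phi> n x / n) < ereal \<delta>"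
    using le by (simp add: local_rate_def t_def bsum_def)
  then have "\<not> ereal (\<delta> - bsum \<phi> n x / n) \<le> ereal (1 / real n) * elog t"
    by (cases "ereal (1 / real n) * elog t") auto
  then have t: "\<not> exp (n * (\<delta> - bsum \<phi> n x / n)) \<le> t"
    using ereal_le_elog_iff[OF n, of "\<delta> - bsum \<phi> n x / n" t] by blast
  have eq: "n * (\<delta> - bsum \<phi> n x / n) = - bsum \<phi> n x + n * \<delta>" using n by (simp add: field_simps)
  show ?thesis using t unfolding eq t_def by linarith
qed

text \<open>A measure that is not invariant betrays itself at some continuous g. Testing g and its
  composition with f up to half of the discrepancy excludes every invariant measure.\<close>

lemma invariant_probs_complement_open:
  assumes \<mu>: "\<mu> \<in> probs X - invariant_probs X f"
  shows "\<exists>(F::('a \<Rightarrow> real) set) e. finite F \<and> (\<forall>g\<in>F. continuous_on X g) \<and> e > 0 \<and>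
        {\<nu>\<in>probs X. \<forall>g\<in>F. \<bar>integral\<^sup>L \<nu> g - integral\<^sup>L \<mu> g\<bar> < e} \<subseteq> probs X - invariant_probs X f"
proof -
  obtain g :: "'a \<Rightarrow> real" where g: "continuous_on X g" "(\<integral>x. g (f x) \<partial>\<mu>) \<noteq> integral\<^sup>L \<mu> g"
    using \<mu> invariant_probsI[of \<mu>] by blast
  define e where "e = \<bar>(\<integral>x. g (f x) \<partial>\<mu>) - integral\<^sup>L \<mu> g\<bar> / 2"
  have gf: "continuous_on X (\<lambda>x. g (f x))" by (rule continuous_on_compose2[OF g(1) cont maps])
  show ?thesis
  proof (intro exI[of _ "{g, \<lambda>x. g (f x)}"] exI[of _ e] conjI subsetI)
    show "0 < e" using g(2) by (simp add: e_def)
    fix \<nu> assume \<nu>: "\<nu> \<in> {\<nu>\<in>probs X. \<forall>g\<in>{g, \<lambda>x. g (f x)}. \<bar>integral\<^sup>L \<nu> g - integral\<^sup>L \<mu> g\<bar> < e}"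
    have "\<nu> \<notin> invariant_probs X f"
    proof
      assume inv: "\<nu> \<in> invariant_probs X f"
      have "(\<integral>x. g (f x) \<partial>\<nu>) = integral\<^sup>L \<nu> g"
        using invariant_integral_iter[OF inv continuous_measurable_borel_on[OF g(1)], of 1] by simp
      moreover have "\<bar>integral\<^sup>L \<nu> g - integral\<^sup>L \<mu> g\<bar> < e" "\<bar>(\<integral>x. g (f x) \<partial>\<nu>) - (\<integral>x. g (f x) \<partial>\<mu>)\<bar> < e" using \<nu> by auto
      moreover have "\<bar>c - b\<bar> \<le> \<bar>a - b\<bar> + \<bar>a - c\<bar>" for a b c :: real by linarith
      from this[of "\<integral>x. g (f x) \<partial>\<mu>" "integral\<^sup>L \<mu> g" "integral\<^sup>L \<nu> g"]
      have "2 * e \<le> \<bar>integral\<^sup>L \<nu> g - integral\<^sup>L \<mu> g\<bar> + \<bar>integral\<^sup>L \<nu> g - (\<integral>x. g (f x) \<partial>\<mu>)\<bar>"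
        by (simp add: e_def)
      ultimately show False by simp
    qed
    then show "\<nu> \<in> probs X - invariant_probs X f" using \<nu> by simp
  qed (use g gf in auto)
qed

text \<open>The value is minus infinity on the open set of measures that are not invariant. Near an
  invariant one, reals t and s are interpolated because the bound c may be infinite: upper
  semicontinuity keeps the entropy below t, and \<phi> joins the test functions to control its
  integral.\<close>

lemma free_energy_usc:
  assumes \<phi>: "continuous_on X \<phi>" and usc: "wk_usc_on X (invariant_probs X f) (ks_entropy X f)"
  shows "wk_usc_on X (probs X) (free_energy X f \<phi>)"
  unfolding wk_usc_on_def
proof (intro allI)
  fix c :: ereal
  define G where "G = {\<mu>\<in>probs X. free_energy X f \<phi> \<mu> < c}"
  have "wk_open X G" unfolding wk_open_def
  proof (intro conjI ballI)
    show "G \<subseteq> probs X" by (auto simp: G_def)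
    fix \<mu> assume \<mu>G: "\<mu> \<in> G"
    then have \<mu>: "\<mu> \<in> probs X" and lt: "free_energy X f \<phi> \<mu> < c" by (auto simp: G_def)
    show "\<exists>(F::('a \<Rightarrow> real) set) e. finite F \<and> (\<forall>g\<in>F. continuous_on X g) \<and> e > 0 \<and>
        {\<nu>\<in>probs X. \<forall>g\<in>F. \<bar>integral\<^sup>L \<nu> g - integral\<^sup>L \<mu> g\<bar> < e} \<subseteq> G"
    proof (cases "\<mu> \<in> invariant_probs X f")
      case False
      have c: "- \<infinity> < c" using lt False by (simp add: free_energy_def)
      have "probs X - invariant_probs X f \<subseteq> G" using c by (auto simp: G_def free_energy_def)
      then show ?thesis using invariant_probs_complement_open[of \<mu>] False \<mu> by (meson DiffI subset_trans)
    next
      case True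
      have "ks_entropy X f \<mu> < c + ereal (integral\<^sup>L \<mu> \<phi>)"
        using lt True by (simp add: free_energy_def ereal_minus_less_iff)
      then obtain t where t: "ks_entropy X f \<mu> < ereal t" "ereal t < c + ereal (integral\<^sup>L \<mu> \<phi>)"
        using ereal_dense2 by blast
      obtain G0 where G0: "wk_open X G0" "{\<mu>\<in>invariant_probs X f. ks_entropy X f \<mu> < ereal t} = G0 \<inter> invariant_probs X f"
        using usc unfolding wk_usc_on_def by blast
      then have "\<mu> \<in> G0" using True t(1) by blast
      then obtain F0 e0 where F0: "finite F0" "\<forall>g\<in>F0. continuous_on X g" "e0 > 0"
        "{\<nu>\<in>probs X. \<forall>g\<in>F0. \<bar>integral\<^sup>L \<nu> g - integral\<^sup>L \<mu> g\<bar> < (e0::real)} \<subseteq> G0"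
        using G0(1) unfolding wk_open_def by blast
      have "ereal (t - integral\<^sup>L \<mu> \<phi>) < c" using t(2) by (cases c) auto
      then obtain s where s: "ereal (t - integral\<^sup>L \<mu> \<phi>) < ereal s" "ereal s < c" using ereal_dense2 by blast
      define e where "e = min e0 (s - (t - integral\<^sup>L \<mu> \<phi>))"
      have e: "0 < e" "e \<le> e0" "e \<le> s - (t - integral\<^sup>L \<mu> \<phi>)" using F0(3) s(1) by (auto simp: e_def)
      show ?thesis
      proof (intro exI[of _ "insert \<phi> F0"] exI[of _ e] conjI subsetI)
        fix \<nu> assume "\<nu> \<in> {\<nu>\<in>probs X. \<forall>g\<in>insert \<phi> F0. \<bar>integral\<^sup>L \<nu> g - integral\<^sup>L \<mu> g\<bar> < e}"
        then have \<nu>: "\<nu> \<in> probs X" "\<bar>integral\<^sup>L \<nu> \<phi> - integral\<^sup>L \<mu> \<phi>\<bar> < e"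
          and F: "\<And>g. g \<in> F0 \<Longrightarrow> \<bar>integral\<^sup>L \<nu> g - integral\<^sup>L \<mu> g\<bar> < e" by auto
        have "\<bar>integral\<^sup>L \<nu> g - integral\<^sup>L \<mu> g\<bar> < e0" if "g \<in> F0" for g using F[OF that] e(2) by linarith
        then have "\<nu> \<in> G0" using F0(4) \<nu>(1) by blast
        have "free_energy X f \<phi> \<nu> < c"
        proof (cases "\<nu> \<in> invariant_probs X f")
          case True
          then have "ks_entropy X f \<nu> < ereal t" using G0(2) \<open>\<nu> \<in> G0\<close> by blast
          then have "ks_entropy X f \<nu> - ereal (integral\<^sup>L \<nu> \<phi>) \<le> ereal t - ereal (integral\<^sup>L \<nu> \<phi>)"
            by (intro ereal_minus_mono) auto
          also have "\<dots> \<le> ereal s" using \<nu>(2) e(3) by simp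
          also have "\<dots> < c" by (rule s(2))
          finally show ?thesis using True by (simp add: free_energy_def)
        next
          case False
          have "- \<infinity> < c" using s(2) by (cases c) auto
          then show ?thesis using False by (simp add: free_energy_def)
        qed
        then show "\<nu> \<in> G" using \<nu>(1) by (simp add: G_def)
      qed (use F0 \<phi> e in auto)
    qed
  qed
  then show "\<exists>G. wk_open X G \<and> {\<mu>\<in>probs X. free_energy X f \<phi> \<mu> < c} = G \<inter> probs X"
    by (intro exI[of _ G]) (auto simp: G_def)
qed

lemma wk_open_probs: "wk_open X (probs X)"
  unfolding wk_open_def by (intro conjI ballI exI[of _ "{}"] exI[of _ 1]) auto

end

theorem theoremA:
  fixes X :: "'a::metric_space set" and f :: "'a \<Rightarrow> 'a" and m :: "'a measure"
    and \<phi> :: "'a \<Rightarrow> real"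
  assumes "compact X"
    and "continuous_on X f" and "f ` X \<subseteq> X"
    and "m \<in> probs X"
    and "continuous_on X \<phi>"
    and A1: "one_way_W_spec X f"
    and A2: "\<exists>L. ((\<lambda>e. liminf (\<lambda>n. INF x\<in>X. local_rate X f m \<phi> e n x)) \<longlongrightarrow> L) (at_right 0)
               \<and> L \<ge> 0"
    and A3: "wk_usc_on X (invariant_probs X f) (ks_entropy X f)"
    and A4: "\<exists>L. ((\<lambda>e. limsup (\<lambda>n. SUP x\<in>X. local_rate X f m \<phi> e n x)) \<longlongrightarrow> L) (at_right 0)
               \<and> L \<le> 0"
  shows "level2_LDP X f m (free_energy X f \<phi>)"
proof -
  interpret compact_system X f by standard fact+
  note m = \<open>m \<in> probs X\<close> and \<phi> = \<open>continuous_on X \<phi>\<close>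
  interpret M: prob_space m by (rule probsD[OF m])
  define r where "r G n = ereal (1 / real n) * elog (measure m {x\<in>X. empirical X f n x \<in> G})" for G n

  obtain q Xs where Xs: "\<forall>i<q. compact (Xs i) \<and> Xs i \<subseteq> X \<and> f ` Xs i \<subseteq> Xs i"
    "nonwandering X f = (\<Union>i<q. Xs i)" "\<forall>e>0. \<exists>M. spec_gap q Xs e M"
    using A1 unfolding one_way_W_spec_def spec_gap_def
    by (elim exE conjE) (rule that, assumption+, unfold spec_gap_def)

  have lower_balls: "\<forall>\<^sub>F n in sequentially. \<forall>x\<in>X. exp (- bsum \<phi> n x - n * \<eta>) \<le> measure m (bowen_ball X f n x e)"
    if e: "0 < e" and \<eta>: "0 < \<eta>" for e \<eta> :: real
  proof -
    define F where "F = (\<lambda>e. liminf (\<lambda>n. INF x\<in>X. local_rate X f m \<phi> e n x))"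
    obtain L where L: "(F \<longlongrightarrow> L) (at_right 0)" "0 \<le> L" unfolding F_def using A2 by blast
    \<comment> \<open>Bowen balls grow with the radius, so \<open>F\<close> is monotone and its
      limit at 0 bounds every value from below. The lower volume estimate thus holds at every scale,
      whereas the upper one is claimed at some scale only.\<close>
    have "L \<le> F e"
    proof (rule tendsto_upperbound[OF L(1)])
      have "\<forall>\<^sub>F e' in at_right 0. e' < e" unfolding eventually_at_right_field using e by blast
      then show "\<forall>\<^sub>F e' in at_right 0. F e' \<le> F e"
      proof eventually_elim
        case (elim e')
        show ?case unfolding F_def
          using elim by (intro Liminf_mono always_eventually allI INF_mono') (auto intro!: local_rate_mono[OF m])
      qed
    qed simp
    have "ereal (- \<eta>) < 0" using \<eta> by simp
    also have "0 \<le> F e" using L(2) \<open>L \<le> F e\<close> by (rule order_trans)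
    finally have "ereal (- \<eta>) < F e" .
    then have "\<forall>\<^sub>F n in sequentially. ereal (- \<eta>) < (INF x\<in>X. local_rate X f m \<phi> e n x)"
      unfolding F_def by (rule less_LiminfD)
    moreover have "\<forall>\<^sub>F n in sequentially. 0 < n" by (rule eventually_gt_at_top)
    ultimately show ?thesis
    proof eventually_elim
      case (elim n)
      show ?case
      proof
        fix x assume "x \<in> X"
        then have "ereal (- \<eta>) < local_rate X f m \<phi> e n x" using elim(1) by (meson INF_lower less_le_trans)
        then show "exp (- bsum \<phi> n x - n * \<eta>) \<le> measure m (bowen_ball X f n x e)"
          by (rule local_rate_lower[OF elim(2)])
      qed
    qed
  qed

  have upper_balls: "\<exists>e>0. \<forall>\<^sub>F n in sequentially. \<forall>x\<in>X. measure m (bowen_ball X f n x e) \<le> exp (- bsum \<phi> n x + n * \<delta>)"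
    if \<delta>: "0 < \<delta>" for \<delta> :: real
  proof -
    define F where "F = (\<lambda>e. limsup (\<lambda>n. SUP x\<in>X. local_rate X f m \<phi> e n x))"
    obtain L where L: "(F \<longlongrightarrow> L) (at_right 0)" "L \<le> 0" unfolding F_def using A4 by blast
    have "L < ereal \<delta>" using L(2) by (rule le_less_trans) (use \<delta> in simp)
    then have "\<forall>\<^sub>F e in at_right 0. F e < ereal \<delta>" using L(1) by (intro order_tendstoD)
    moreover have "\<forall>\<^sub>F e in at_right (0::real). 0 < e" by (rule eventually_at_right_less)
    ultimately have "\<forall>\<^sub>F e in at_right 0. F e < ereal \<delta> \<and> 0 < e" by (rule eventually_conj)
    then obtain e where e: "F e < ereal \<delta>" "0 < e"
      using eventually_happens[of _ "at_right (0::real)"] by force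
    have "\<forall>\<^sub>F n in sequentially. (SUP x\<in>X. local_rate X f m \<phi> e n x) < ereal \<delta>"
      using e(1) unfolding F_def by (rule Limsup_lessD)
    moreover have "\<forall>\<^sub>F n in sequentially. 0 < n" by (rule eventually_gt_at_top)
    ultimately have "\<forall>\<^sub>F n in sequentially. \<forall>x\<in>X. measure m (bowen_ball X f n x e) \<le> exp (- bsum \<phi> n x + n * \<delta>)"
    proof eventually_elim
      case (elim n)
      show ?case
      proof
        fix x assume "x \<in> X"
        then have "local_rate X f m \<phi> e n x < ereal \<delta>" using elim(1) by (meson SUP_upper le_less_trans)
        then show "measure m (bowen_ball X f n x e) \<le> exp (- bsum \<phi> n x + n * \<delta>)"
          by (rule local_rate_upper[OF elim(2)])
      qed
    qed
    with e(2) show ?thesis by blast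
  qed

  have lower: "(SUP \<mu>\<in>G. free_energy X f \<phi> \<mu>) \<le> liminf (r G)" if G: "wk_open X G" for G
  proof (rule SUP_least)
    fix \<mu> assume \<mu>G: "\<mu> \<in> G"
    show "free_energy X f \<phi> \<mu> \<le> liminf (r G)"
    proof (cases "\<mu> \<in> invariant_probs X f")
      case True
      \<comment> \<open>With the integral moved to the right, the bound for each single partition
        passes to the supremum, whether the entropy is finite or not.\<close>
      have "ereal (part_entropy_rate X f \<mu> P) \<le> liminf (r G) + ereal (integral\<^sup>L \<mu> \<phi>)" if P: "P \<in> fin_partitions X" for P
      proof -
        define s where "s = part_entropy_rate X f \<mu> P - integral\<^sup>L \<mu> \<phi>"
        have "ereal s \<le> liminf (r G)"
        proof (rule ereal_le_epsilon2)
          fix \<epsilon> :: real assume \<epsilon>: "0 < \<epsilon>"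
          have "\<forall>\<^sub>F n in sequentially. exp (n * (s - 6 * (\<epsilon> / 6))) \<le> measure m {x\<in>X. empirical X f n x \<in> G}"
            unfolding s_def using Xs \<epsilon>
            by (intro lower_rate[OF m \<phi> True _ Xs(2) _ lower_balls P G \<mu>G]) auto
          moreover have "\<forall>\<^sub>F n in sequentially. 0 < n" by (rule eventually_gt_at_top)
          ultimately have "\<forall>\<^sub>F n in sequentially. ereal (s - \<epsilon>) \<le> r G n"
          proof eventually_elim
            case (elim n)
            then show ?case unfolding r_def by (simp add: ereal_le_elog_iff)
          qed
          then have "ereal (s - \<epsilon>) \<le> liminf (r G)" by (rule Liminf_bounded)
          then show "ereal s \<le> liminf (r G) + ereal \<epsilon>" by (cases "liminf (r G)") auto
        qed
        then show ?thesis by (cases "liminf (r G)") (auto simp: s_def)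
      qed
      then have "ks_entropy X f \<mu> \<le> liminf (r G) + ereal (integral\<^sup>L \<mu> \<phi>)"
        unfolding ks_entropy_def by (rule SUP_least)
      then show ?thesis using True by (simp add: free_energy_def ereal_minus_le_iff add.commute)
    qed (simp add: free_energy_def)
  qed

  have upper: "limsup (r F) \<le> (SUP \<mu>\<in>F. free_energy X f \<phi> \<mu>)" if F: "wk_closed X F" for F
  proof (rule ccontr)
    assume "\<not> ?thesis"
    then have "(SUP \<mu>\<in>F. free_energy X f \<phi> \<mu>) < limsup (r F)" by (simp add: not_le)
    then obtain b where b: "(SUP \<mu>\<in>F. free_energy X f \<phi> \<mu>) < ereal b" "ereal b < limsup (r F)" using ereal_dense2 by blast
    obtain s where s: "(SUP \<mu>\<in>F. free_energy X f \<phi> \<mu>) < ereal s" "ereal s < ereal b" using ereal_dense2[OF b(1)] by blast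
    \<comment> \<open>This makes b - 2 * \<delta> equal to s, so the measure supplied by
      \<open>free_energy_upper\<close> contradicts the choice of s above the supremum over
      \<open>F\<close>.\<close>
    define \<delta> where "\<delta> = (b - s) / 2"
    have \<delta>: "0 < \<delta>" using s(2) by (simp add: \<delta>_def)
    obtain e where e: "0 < e" and balls: "\<forall>\<^sub>F n in sequentially. \<forall>x\<in>X. measure m (bowen_ball X f n x e) \<le> exp (- bsum \<phi> n x + n * \<delta>)"
      using upper_balls[OF \<delta>] by blast
    have "\<not> (\<forall>\<^sub>F n in sequentially. r F n \<le> ereal b)"
      using Limsup_bounded[of "r F" "ereal b" sequentially] b(2) by (auto simp: not_le[symmetric])
    then have "\<exists>\<^sub>F n in sequentially. ereal b < r F n" by (simp add: not_eventually not_le)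
    then have "\<exists>\<^sub>F n in sequentially. 0 < n \<and> ereal b < r F n"
      by (rule frequently_eventually_conj) (rule eventually_gt_at_top)
    then have "\<exists>\<^sub>F n in sequentially. exp (n * b) < measure m {x\<in>X. empirical X f n x \<in> F}"
      by (rule frequently_elim1) (use ereal_less_elog_iff in \<open>auto simp: r_def\<close>)
    from free_energy_upper[OF m e \<delta> \<phi> F this balls]
    obtain \<mu> where \<mu>: "\<mu> \<in> F" "ereal (b - 2 * \<delta>) \<le> free_energy X f \<phi> \<mu>" by blast
    have "b - 2 * \<delta> = s" by (simp add: \<delta>_def field_simps)
    then have "ereal s \<le> free_energy X f \<phi> \<mu>" using \<mu>(2) by simp
    also have "\<dots> \<le> (SUP \<mu>\<in>F. free_energy X f \<phi> \<mu>)" using \<mu>(1) by (rule SUP_upper)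
    finally show False using s(1) by simp
  qed

  have "free_energy X f \<phi> \<mu> \<le> 0" if "\<mu> \<in> probs X" for \<mu>
  proof -
    have "free_energy X f \<phi> \<mu> \<le> liminf (r (probs X))"
      using lower[OF wk_open_probs] SUP_upper[OF that, of "free_energy X f \<phi>"] by (rule order_trans[rotated])
    also have "\<dots> \<le> liminf (\<lambda>n. 0)"
    proof (intro Liminf_mono always_eventually allI)
      fix n
      show "r (probs X) n \<le> 0" unfolding r_def
        by (simp add: ereal_mult_le_0_iff elog_le_0)
    qed
    finally show ?thesis by (simp add: Liminf_const)
  qed
  then show ?thesis
    unfolding level2_LDP_def r_def[symmetric]
    using free_energy_usc[OF \<phi> A3] lower upper by (auto simp: r_def[abs_def])
qed

end
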